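(* There exists $\lambda_0\in(0,1)$ such that for all integers $m,n\ge1$, all sets of constraints $(\eta,\Delta)$, all $\lambda>0$, every $x\in\Lambda_{m,n}$ and every $k\in\mathbb{N}$, $$\mu\bigl(|\sigma_x|=|\bar\sigma_x|+k\bigr)\le(\lambda/\lambda_0)^k,$$ where $\mu$ is the Gibbs distribution with parameter $\lambda$ on $\Omega(\eta,\Delta)$.
   Context: Triangulations. $\Lambda^0_{m,n}=\{0,1,\dots,m\}\times\{0,1,\dots,n\}\subset\mathbb{Z}^2$. An edge is a straight segment joining two points of $\Lambda^0_{m,n}$ and passing through no other integer point. Two edges cross if they are distinct and meet at a point that is not a common endpoint. A (full) triangulation of $\Lambda^0_{m,n}$ is a maximal set of pairwise noncrossing edges. In every triangulation the set of midpoints of the edges is exactly $\Lambda=\Lambda_{m,n}=\bigl(\{0,\frac12,1,\dots,m\}\times\{0,\frac12,1,\dots,n\}\bigr)\setminus\Lambda^0_{m,n}$, each midpoint occurring once; so a triangulation is written $\sigma=\{\sigma_x\}_{x\in\Lambda}$, where $\sigma_x$ is the edge with midpoint $x$. Constraints. A set of constraints $(\eta,\Delta)$ is a subset $\Delta\subseteq\Lambda$ together with pairwise noncrossing edges $\eta=\{\eta_x\}_{x\in\Delta}$, $\eta_x$ having midpoint $x$. $\Omega(\eta,\Delta)$ is the (nonempty) set of triangulations $\sigma$ with $\sigma_x=\eta_x$ for all $x\in\Delta$. Gibbs distribution. $|\sigma_x|$ is the $\ell_1$ length of $\sigma_x$, $|\sigma|=\sum_x|\sigma_x|$, and $\mu(\sigma)=\lambda^{|\sigma|}/\sum_{\tau\in\Omega(\eta,\Delta)}\lambda^{|\tau|}$.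 Ground state. $\bar\sigma=\{\bar\sigma_x\}_{x\in\Lambda}$ is a ground state triangulation, i.e. one of minimum total length in $\Omega(\eta,\Delta)$; it is unique up to flipping of unit diagonals (diagonals of unit lattice squares), so $|\bar\sigma_x|$ is well defined. *)

theory Defs
  imports "HOL-Analysis.Analysis"
begin

type_synonym point = "real \<times> real"

text \<open>Edges are closed segments, i.e. subsets of the plane.\<close>

type_synonym edge = "point set"

definition lattice_pts :: "nat \<Rightarrow> nat \<Rightarrow> point set" where
  "lattice_pts m n = {(real i, real j) | i j. i \<le> m \<and> j \<le> n}"

definition midpoints :: "nat \<Rightarrow> nat \<Rightarrow> point set" where
  "midpoints m n = {(real i / 2, real j / 2) | i j. i \<le> 2 * m \<and> j \<le> 2 * n} - lattice_pts m n"

definition is_edge :: "nat \<Rightarrow> nat \<Rightarrow> edge \<Rightarrow> bool" where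
  "is_edge m n e \<longleftrightarrow>
     (\<exists>a \<in> lattice_pts m n. \<exists>b \<in> lattice_pts m n.
        a \<noteq> b \<and> e = closed_segment a b \<and> e \<inter> (\<int> \<times> \<int>) = {a, b})"

text \<open>A segment determines its unordered pair of end points, so the following three notions
  do not depend on how the segment is written; see the lemmas below.\<close>

definition endpoints :: "edge \<Rightarrow> point set" where
  "endpoints e = {a. \<exists>b. e = closed_segment a b}"

definition edge_midpoint :: "edge \<Rightarrow> point" where
  "edge_midpoint e = (THE x. \<exists>a b. e = closed_segment a b \<and> x = midpoint a b)"

definition l1_length :: "edge \<Rightarrow> real" where
  "l1_length e =
     (THE l. \<exists>a b. e = closed_segment a b \<and> l = \<bar>fst a - fst b\<bar> + \<bar>snd a - snd b\<bar>)"

lemma endpoints_segment: "endpoints (closed_segment a b) = {a, b}"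
  unfolding endpoints_def by (simp del: split_paired_Ex add: closed_segment_eq doubleton_eq_iff) blast

lemma edge_midpoint_segment: "edge_midpoint (closed_segment a b) = midpoint a b"
  unfolding edge_midpoint_def
  by (rule the_equality) (blast, force simp: closed_segment_eq doubleton_eq_iff midpoint_sym)

lemma l1_length_segment:
  "l1_length (closed_segment a b) = \<bar>fst a - fst b\<bar> + \<bar>snd a - snd b\<bar>"
  unfolding l1_length_def
  by (rule the_equality) (blast, force simp: closed_segment_eq doubleton_eq_iff abs_minus_commute)

definition cross :: "edge \<Rightarrow> edge \<Rightarrow> bool" where
  "cross e f \<longleftrightarrow> e \<noteq> f \<and> (\<exists>z \<in> e \<inter> f. z \<notin> endpoints e \<inter> endpoints f)"

definition noncrossing :: "nat \<Rightarrow> nat \<Rightarrow> edge set \<Rightarrow> bool" where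
  "noncrossing m n S \<longleftrightarrow> (\<forall>e\<in>S. is_edge m n e) \<and> (\<forall>e\<in>S. \<forall>f\<in>S. \<not> cross e f)"

definition full_triangulation :: "nat \<Rightarrow> nat \<Rightarrow> edge set \<Rightarrow> bool" where
  "full_triangulation m n \<sigma> \<longleftrightarrow>
     noncrossing m n \<sigma> \<and> (\<forall>S. noncrossing m n S \<and> \<sigma> \<subseteq> S \<longrightarrow> S = \<sigma>)"

text \<open>\<open>edge_at \<sigma> x\<close> is the edge written \<open>\<sigma>\<^sub>x\<close>. It is meaningful because in a triangulation
  every point of \<open>midpoints m n\<close> is the midpoint of exactly one edge.\<close>

definition edge_at :: "edge set \<Rightarrow> point \<Rightarrow> edge" where
  "edge_at \<sigma> x = (THE e. e \<in> \<sigma> \<and> edge_midpoint e = x)"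

text \<open>Only the values of \<open>\<eta>\<close> on \<open>\<Delta>\<close> matter.\<close>

definition constraints :: "nat \<Rightarrow> nat \<Rightarrow> (point \<Rightarrow> edge) \<Rightarrow> point set \<Rightarrow> bool" where
  "constraints m n \<eta> \<Delta> \<longleftrightarrow>
     \<Delta> \<subseteq> midpoints m n \<and> (\<forall>x\<in>\<Delta>. edge_midpoint (\<eta> x) = x) \<and> noncrossing m n (\<eta> ` \<Delta>)"

definition Omega :: "nat \<Rightarrow> nat \<Rightarrow> (point \<Rightarrow> edge) \<Rightarrow> point set \<Rightarrow> edge set set" where
  "Omega m n \<eta> \<Delta> = {\<sigma>. full_triangulation m n \<sigma> \<and> (\<forall>x\<in>\<Delta>. edge_at \<sigma> x = \<eta> x)}"

definition total_length :: "nat \<Rightarrow> nat \<Rightarrow> edge set \<Rightarrow> real" where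
  "total_length m n \<sigma> = (\<Sum>x\<in>midpoints m n. l1_length (edge_at \<sigma> x))"

definition ground_state ::
  "nat \<Rightarrow> nat \<Rightarrow> (point \<Rightarrow> edge) \<Rightarrow> point set \<Rightarrow> edge set \<Rightarrow> bool" where
  "ground_state m n \<eta> \<Delta> \<sigma> \<longleftrightarrow>
     \<sigma> \<in> Omega m n \<eta> \<Delta> \<and> (\<forall>\<tau> \<in> Omega m n \<eta> \<Delta>. total_length m n \<sigma> \<le> total_length m n \<tau>)"

definition gibbs ::
  "nat \<Rightarrow> nat \<Rightarrow> (point \<Rightarrow> edge) \<Rightarrow> point set \<Rightarrow> real \<Rightarrow> edge set measure" where
  "gibbs m n \<eta> \<Delta> lam =
     point_measure (Omega m n \<eta> \<Delta>)
       (\<lambda>\<sigma>. ennreal (lam powr total_length m n \<sigma> /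
                    (\<Sum>\<tau> \<in> Omega m n \<eta> \<Delta>. lam powr total_length m n \<tau>)))"

end

theory Submission imports Defs begin

text \<open>
  Only small \<open>\<lambda>\<close> matters, since the right-hand side is at least \<open>1\<close> for \<open>\<lambda> \<ge> \<lambda>\<^sub>0\<close> and for \<open>k = 0\<close>. Let \<open>g\<close> be the edge
  of the ground state with midpoint \<open>x\<close>. If \<open>\<sigma>\<^sub>x \<noteq> g\<close>, then \<open>\<sigma>\<^sub>x\<close> crosses \<open>g\<close>. So it suffices to bound the expectation
  of \<open>F(\<sigma>) = \<Sum>\<^sub>e \<alpha>\<^bsup>|e|\<^esup>\<close>, the sum being over the edges \<open>e\<close> of \<open>\<sigma>\<close> that cross \<open>g\<close>, by a constant times
  \<open>\<alpha>\<^bsup>|g|\<^esup>\<close> with \<open>\<alpha> = 1 / (16 \<lambda>)\<close>; Markov's inequality then gives the claim.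

  Two facts about lengths drive the proof. In a unimodular triangle the longest side is as long as the two others
  together (\<open>triangle_longest\<close>). And a primitive segment which crosses a side \<open>e\<close> of such a triangle, but not its longest
  side \<open>h \<noteq> e\<close>, is longer than \<open>e\<close> (\<open>longer_if_not_through_longest\<close>). An edge of a triangulation that is crossed by
  another edge of the grid has a unimodular triangle on either side (\<open>triangulation_apex\<close>). If an edge \<open>e\<close> is the longest side of
  both, they form a parallelogram with \<open>e\<close> as its long diagonal, and \<open>e\<close> can be flipped to the short one.

  The first consequence is that no edge of a triangulation in \<open>Omega\<close> that crosses \<open>g\<close> is shorter than \<open>g\<close>
  (\<open>crossing_ground_state_longer\<close>): a longest edge of the ground state which it crosses could otherwise be flipped.
  Hence, for an edge \<open>e\<close> of \<open>\<sigma>\<close> that crosses \<open>g\<close>, one of the following holds: \<open>e\<close> can be shortened by a flip; or \<open>g\<close>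
  also crosses a longer side of a triangle at \<open>e\<close>; or \<open>e\<close> and \<open>g\<close> are the diagonals of a unit square. In the second case
  the weight of \<open>e\<close> is at most \<open>1 / \<alpha>\<close> times that of the longer edge, so, up to a constant factor and the
  term \<open>\<alpha>\<^bsup>|g|\<^esup>\<close>, only the edges that can be shortened contribute to \<open>F\<close> (\<open>crossers_le_shortenable\<close>).

  Their contribution is estimated by performing the flip. Let \<open>\<tau>\<close> arise from \<open>\<sigma>\<close> by replacing \<open>e\<close> with the short diagonal
  \<open>e'\<close>. Unless \<open>e' = g\<close>, some long side \<open>w\<close> of the parallelogram crosses \<open>g\<close> (\<open>downflip_crossing_source\<close>). With \<open>s\<close>
  the length of the short sides, \<open>|e| = |w| + s\<close> and the flip saves \<open>2 s\<close>, so that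
  \<open>\<lambda>\<^bsup>|\<sigma>|\<^esup> \<alpha>\<^bsup>|e|\<^esup> = (\<lambda> \<alpha>)\<^sup>s \<lambda>\<^sup>s \<lambda>\<^bsup>|\<tau>|\<^esup> \<alpha>\<^bsup>|w|\<^esup> \<le> \<lambda>\<^bsup>|\<tau>|\<^esup> \<alpha>\<^bsup>|w|\<^esup> / 16\<close>.
  At most four pairs \<open>(\<sigma>, e)\<close> are charged to the same pair \<open>(\<tau>, w)\<close>. Summing up, the expectation of \<open>F\<close> is bounded
  by half of itself plus a constant times \<open>\<alpha>\<^bsup>|g|\<^esup>\<close> (\<open>crossers_bound\<close>).
  This yields the bound \<open>3 (16 \<lambda>)\<^sup>k \<le> (256 \<lambda>)\<^sup>k\<close> for \<open>k \<ge> 1\<close>, that is \<open>\<lambda>\<^sub>0 = 1 / 256\<close>.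
\<close>

section \<open>Lattice segments and their crossings\<close>

definition emb :: "int \<times> int \<Rightarrow> point" where
  "emb A = (of_int (fst A), of_int (snd A))"

definition seg :: "int \<times> int \<Rightarrow> int \<times> int \<Rightarrow> edge" where
  "seg A B = closed_segment (emb A) (emb B)"

text \<open>Twice the signed area of the triangle \<open>ABC\<close>, positive iff \<open>C\<close> lies to the left of the line from
  \<open>A\<close> to \<open>B\<close>. A triangle is called unimodular if this number is \<open>1\<close> or \<open>-1\<close>.\<close>

definition orient :: "int \<times> int \<Rightarrow> int \<times> int \<Rightarrow> int \<times> int \<Rightarrow> int" where
  "orient A B C = (fst B - fst A) * (snd C - snd A) - (snd B - snd A) * (fst C - fst A)"

definition primitive :: "int \<times> int \<Rightarrow> int \<times> int \<Rightarrow> bool" where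
  "primitive A B \<longleftrightarrow> coprime (fst B - fst A) (snd B - snd A)"

text \<open>Each segment separates the end points of the other one. Segments that share an end point do not cross
  in this sense, and for primitive segments no other kind of crossing exists
  (lemma \<open>cross_seg_iff\<close>); this turns the geometry of edges into sign conditions on integers.\<close>

definition pcross :: "int \<times> int \<Rightarrow> int \<times> int \<Rightarrow> int \<times> int \<Rightarrow> int \<times> int \<Rightarrow> bool" where
  "pcross A B C D \<longleftrightarrow> orient A B C * orient A B D < 0 \<and> orient C D A * orient C D B < 0"

definition grid :: "nat \<Rightarrow> nat \<Rightarrow> (int \<times> int) set" where
  "grid m n = {0..int m} \<times> {0..int n}"

definition len :: "int \<times> int \<Rightarrow> int \<times> int \<Rightarrow> int" where
  "len A B = \<bar>fst A - fst B\<bar> + \<bar>snd A - snd B\<bar>"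

lemma emb_inject [simp]: "emb A = emb B \<longleftrightarrow> A = B"
  by (auto simp: emb_def prod_eq_iff)

lemma seg_eq_iff: "seg A B = seg C D \<longleftrightarrow> A = C \<and> B = D \<or> A = D \<and> B = C"
  by (simp add: seg_def closed_segment_eq doubleton_eq_iff)

lemma seg_commute: "seg A B = seg B A"
  by (simp add: seg_eq_iff)

lemma primitive_commute: "primitive A B \<longleftrightarrow> primitive B A"
proof -
  have "fst A - fst B = - (fst B - fst A)" "snd A - snd B = - (snd B - snd A)" by auto
  thus ?thesis unfolding primitive_def by (metis coprime_minus_left_iff coprime_minus_right_iff)
qed

lemma orient_swap: "orient B A C = - orient A B C"
  by (simp add: orient_def algebra_simps)

lemma pcross_swap: "pcross A B C D \<longleftrightarrow> pcross B A C D" "pcross A B C D \<longleftrightarrow> pcross A B D C"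
  by (auto simp: pcross_def orient_swap[of A B] orient_swap[of C D] mult.commute)

lemma len_commute: "len A B = len B A"
  by (simp add: len_def)

lemma len_nonneg: "len A B \<ge> 0"
  by (simp add: len_def)

lemma primitive_not_eq: "primitive A B \<Longrightarrow> A \<noteq> B"
  by (auto simp: primitive_def)

lemma len_pos: "A \<noteq> B \<Longrightarrow> len A B \<ge> 1"
  by (auto simp: len_def prod_eq_iff)

lemma orient_unit_primitive:
  assumes "\<bar>orient A B C\<bar> = 1"
  shows "primitive A B"
proof -
  have "d dvd orient A B C" if "d dvd fst B - fst A" "d dvd snd B - snd A" for d
    using that unfolding orient_def by auto
  hence "is_unit d" if "d dvd fst B - fst A" "d dvd snd B - snd A" for d
    using that assms by (metis dvd_abs_iff)
  thus ?thesis unfolding primitive_def by (auto intro: coprimeI)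
qed

text \<open>The parameter \<open>t\<close> is \<open>x (P - A)\<^sub>1 + y (P - A)\<^sub>2\<close> for Bezout coefficients
  \<open>x, y\<close> of the coordinates of \<open>B - A\<close>.\<close>

lemma collinear_primitive:
  assumes "primitive A B" "orient A B P = 0"
  obtains t where "fst P = fst A + t * (fst B - fst A)" "snd P = snd A + t * (snd B - snd A)"
proof -
  let ?u = "fst B - fst A" and ?v = "snd B - snd A"
  obtain x y where xy: "x * ?u + y * ?v = 1"
    using assms(1) bezout_int[of ?u ?v] unfolding primitive_def by (metis coprime_iff_gcd_eq_1)
  have o: "?u * (snd P - snd A) = ?v * (fst P - fst A)" using assms(2) by (simp add: orient_def)
  let ?t = "x * (fst P - fst A) + y * (snd P - snd A)"
  have "?t * ?u = x * ?u * (fst P - fst A) + y * (?u * (snd P - snd A))" by (simp add: algebra_simps)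
  also have "\<dots> = (x * ?u + y * ?v) * (fst P - fst A)" by (subst o) (simp add: algebra_simps)
  finally have 1: "?t * ?u = fst P - fst A" using xy by simp
  have "?t * ?v = x * (?v * (fst P - fst A)) + y * ?v * (snd P - snd A)" by (simp add: algebra_simps)
  also have "\<dots> = (x * ?u + y * ?v) * (snd P - snd A)" by (subst o[symmetric]) (simp add: algebra_simps)
  finally have 2: "?t * ?v = snd P - snd A" using xy by simp
  show ?thesis using that[of ?t] 1 2 by simp
qed

lemma in_seg_iff:
  "z \<in> seg A B \<longleftrightarrow> (\<exists>s. 0 \<le> s \<and> s \<le> 1 \<and>
     fst z = of_int (fst A) + s * (of_int (fst B) - of_int (fst A)) \<and>
     snd z = of_int (snd A) + s * (of_int (snd B) - of_int (snd A)))"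
  by (auto simp: seg_def emb_def in_segment prod_eq_iff algebra_simps)

lemma seg_lattice_points:
  assumes "primitive A B"
  shows "seg A B \<inter> (\<int> \<times> \<int>) = {emb A, emb B}"
proof
  show "{emb A, emb B} \<subseteq> seg A B \<inter> (\<int> \<times> \<int>)"
    by (auto simp: seg_def emb_def)
  show "seg A B \<inter> (\<int> \<times> \<int>) \<subseteq> {emb A, emb B}"
  proof
    fix z assume z: "z \<in> seg A B \<inter> (\<int> \<times> \<int>)"
    then obtain p q where pq: "fst z = of_int p" "snd z = of_int q"
      by (metis IntD2 Ints_cases mem_Times_iff)
    obtain s where s: "0 \<le> s" "s \<le> 1"
      "fst z = of_int (fst A) + s * (of_int (fst B) - of_int (fst A))"
      "snd z = of_int (snd A) + s * (of_int (snd B) - of_int (snd A))"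
      using z by (auto simp: in_seg_iff)
    have "of_int p - of_int (fst A) = s * (of_int (fst B) - of_int (fst A) :: real)"
      "of_int q - of_int (snd A) = s * (of_int (snd B) - of_int (snd A) :: real)"
      using s(3,4) pq by simp_all
    note pq' = this
    have "of_int (orient A B (p, q)) = (of_int (fst B) - of_int (fst A)) * (of_int q - of_int (snd A))
      - (of_int (snd B) - of_int (snd A)) * (of_int p - of_int (fst A) :: real)"
      by (simp add: orient_def)
    hence "of_int (orient A B (p, q)) = (0::real)" unfolding pq' by (simp add: algebra_simps)
    hence "orient A B (p, q) = 0" by simp
    then obtain t where t: "p = fst A + t * (fst B - fst A)" "q = snd A + t * (snd B - snd A)"
      using collinear_primitive[OF assms] by (metis fst_conv snd_conv)
    have "(s - of_int t) * (of_int (fst B) - of_int (fst A)) = 0"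
         "(s - of_int t) * (of_int (snd B) - of_int (snd A)) = 0"
      using s(3,4) pq t by (simp_all add: algebra_simps)
    moreover have "A \<noteq> B" using primitive_not_eq[OF assms] .
    ultimately have "s = of_int t" by (auto simp: prod_eq_iff)
    hence "t = 0 \<or> t = 1" using s(1,2) by auto
    thus "z \<in> {emb A, emb B}" using t pq by (auto simp: emb_def prod_eq_iff)
  qed
qed

lemma lattice_pts_eq: "lattice_pts m n = emb ` grid m n"
proof
  show "lattice_pts m n \<subseteq> emb ` grid m n"
  proof
    fix z assume "z \<in> lattice_pts m n"
    then obtain i j where "z = (real i, real j)" "i \<le> m" "j \<le> n" by (auto simp: lattice_pts_def)
    hence "z = emb (int i, int j)" "(int i, int j) \<in> grid m n" by (auto simp: emb_def grid_def)
    thus "z \<in> emb ` grid m n" by blast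
  qed
  show "emb ` grid m n \<subseteq> lattice_pts m n"
  proof
    fix z assume "z \<in> emb ` grid m n"
    then obtain i j where "z = emb (i, j)" "0 \<le> i" "i \<le> int m" "0 \<le> j" "j \<le> int n"
      by (auto simp: grid_def)
    hence "z = (real (nat i), real (nat j))" "nat i \<le> m" "nat j \<le> n" by (auto simp: emb_def)
    thus "z \<in> lattice_pts m n" by (auto simp: lattice_pts_def)
  qed
qed

text \<open>If \<open>d\<close> divides both coordinates of \<open>B - A\<close>, then \<open>A + (B - A) / \<bar>d\<bar>\<close> is a lattice point of the
  segment, and it is an end point only for \<open>\<bar>d\<bar> = 1\<close>.\<close>

lemma is_edge_seg_iff: "is_edge m n (seg A B) \<longleftrightarrow> A \<in> grid m n \<and> B \<in> grid m n \<and> primitive A B"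
proof
  assume r: "A \<in> grid m n \<and> B \<in> grid m n \<and> primitive A B"
  show "is_edge m n (seg A B)"
    unfolding is_edge_def lattice_pts_eq
    using r seg_lattice_points[of A B] primitive_not_eq[of A B]
    by (intro bexI[of _ "emb A"] bexI[of _ "emb B"]) (auto simp: seg_def)
next
  assume "is_edge m n (seg A B)"
  then obtain P Q where PQ: "P \<in> grid m n" "Q \<in> grid m n" "P \<noteq> Q" "seg A B = seg P Q"
    "seg A B \<inter> (\<int> \<times> \<int>) = {emb P, emb Q}"
    unfolding is_edge_def lattice_pts_eq by (auto simp: seg_def)
  hence eq: "{A, B} = {P, Q}" by (auto simp: seg_eq_iff)
  hence AB: "A \<noteq> B" "A \<in> grid m n" "B \<in> grid m n" "seg A B \<inter> (\<int> \<times> \<int>) = {emb A, emb B}"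
    using PQ by (auto simp: doubleton_eq_iff)
  let ?u = "fst B - fst A" and ?v = "snd B - snd A"
  have "is_unit d" if d: "d dvd ?u" "d dvd ?v" for d
  proof -
    obtain p q where p: "?u = d * p" and q: "?v = d * q" using d by (meson dvdE)
    have d0: "d \<noteq> 0" using p q AB(1) by (auto simp: prod_eq_iff)
    define c where "c = \<bar>d\<bar>"
    have c: "c \<ge> 1" using d0 by (simp add: c_def)
    define P where "P = (fst A + sgn d * p, snd A + sgn d * q)"
    have u: "?u = c * (sgn d * p)" "?v = c * (sgn d * q)"
      using p q by (simp_all add: c_def mult_sgn_abs flip: mult.assoc) (metis mult.commute mult_sgn_abs)+
    have "emb P \<in> seg A B"
    proof -
      have "real_of_int (fst B) - of_int (fst A) = of_int c * (of_int (sgn d * p))"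
        "real_of_int (snd B) - of_int (snd A) = of_int c * (of_int (sgn d * q))"
        using u by (metis of_int_diff of_int_mult)+
      thus ?thesis unfolding in_seg_iff using c
        by (intro exI[of _ "1 / of_int c"]) (auto simp: P_def emb_def)
    qed
    moreover have "emb P \<in> \<int> \<times> \<int>" by (simp add: emb_def)
    ultimately have "emb P \<in> seg A B \<inter> (\<int> \<times> \<int>)" by (rule IntI)
    hence "emb P \<in> {emb A, emb B}" by (simp only: AB(4))
    hence "P = A \<or> P = B" by simp
    thus ?thesis
    proof
      assume "P = A"
      hence "sgn d * p = 0" "sgn d * q = 0" by (auto simp: P_def prod_eq_iff)
      hence "?u = 0" "?v = 0" using u by simp_all
      thus ?thesis using AB(1) by (auto simp: prod_eq_iff)
    next
      assume "P = B"
      hence *: "?u = sgn d * p" "?v = sgn d * q" by (auto simp: P_def prod_eq_iff)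
      have "?u \<noteq> 0 \<or> ?v \<noteq> 0" using AB(1) by (auto simp: prod_eq_iff)
      hence "c = 1" using * u by auto
      thus ?thesis using c_def by auto
    qed
  qed
  hence "primitive A B" unfolding primitive_def by (intro coprimeI) auto
  thus "A \<in> grid m n \<and> B \<in> grid m n \<and> primitive A B" using AB by blast
qed

lemma is_edge_obtain:
  assumes "is_edge m n e"
  obtains A B where "e = seg A B" "A \<in> grid m n" "B \<in> grid m n" "primitive A B"
proof -
  obtain A B where "e = seg A B" using assms unfolding is_edge_def lattice_pts_eq by (auto simp: seg_def)
  thus ?thesis using assms that is_edge_seg_iff by blast
qed

lemma endpoints_seg: "endpoints (seg A B) = {emb A, emb B}"
  by (simp add: seg_def endpoints_segment)

text \<open>A common point at an end of one of the segments is a lattice point, hence an end of the other one as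
  well. Any other common point is interior to both segments; two parallel primitive segments with such a
  point coincide, because on their common line both join consecutive lattice points.\<close>

lemma cross_seg_iff:
  assumes AB: "primitive A B" and CD: "primitive C D"
  shows "cross (seg A B) (seg C D) \<longleftrightarrow> pcross A B C D"
proof
  define K where "K = (fst B - fst A) * (snd D - snd C) - (snd B - snd A) * (fst D - fst C)"
  have K1: "orient A B D - orient A B C = K" "orient C D A - orient C D B = K"
    by (simp_all add: orient_def K_def algebra_simps)
  show "pcross A B C D" if "cross (seg A B) (seg C D)"
  proof -
    obtain z where z: "z \<in> seg A B" "z \<in> seg C D" and nz: "z \<notin> {emb A, emb B} \<inter> {emb C, emb D}"
      and ne: "seg A B \<noteq> seg C D"
      using \<open>cross _ _\<close> by (auto simp: cross_def endpoints_seg)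
    have "z \<notin> \<int> \<times> \<int>"
      using seg_lattice_points[OF AB] seg_lattice_points[OF CD] z nz by blast
    hence znot: "z \<noteq> emb A" "z \<noteq> emb B" "z \<noteq> emb C" "z \<noteq> emb D" by (auto simp: emb_def)
    obtain s where s: "0 \<le> s" "s \<le> 1"
      "fst z = of_int (fst A) + s * (of_int (fst B) - of_int (fst A))"
      "snd z = of_int (snd A) + s * (of_int (snd B) - of_int (snd A))"
      using z by (auto simp: in_seg_iff)
    obtain t where t: "0 \<le> t" "t \<le> 1"
      "fst z = of_int (fst C) + t * (of_int (fst D) - of_int (fst C))"
      "snd z = of_int (snd C) + t * (of_int (snd D) - of_int (snd C))"
      using z by (auto simp: in_seg_iff)
    have s01: "0 < s" "s < 1" using s znot by (auto simp: emb_def prod_eq_iff less_le)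
    have t01: "0 < t" "t < 1" using t znot by (auto simp: emb_def prod_eq_iff less_le)
    have e1: "of_int (fst A) - of_int (fst C) = t * (of_int (fst D) - of_int (fst C)) - s * (of_int (fst B) - of_int (fst A) :: real)"
      and e2: "of_int (snd A) - of_int (snd C) = t * (of_int (snd D) - of_int (snd C)) - s * (of_int (snd B) - of_int (snd A) :: real)"
      using s t by linarith+
    have oC: "of_int (orient A B C) = - t * of_int K"
    proof -
      have "of_int (orient A B C) = (of_int (snd B) - of_int (snd A)) * (of_int (fst A) - of_int (fst C))
        - (of_int (fst B) - of_int (fst A)) * (of_int (snd A) - of_int (snd C) :: real)"
        by (simp add: orient_def algebra_simps)
      thus ?thesis unfolding e1 e2 by (simp add: K_def algebra_simps)
    qed
    have oA: "of_int (orient C D A) = s * of_int K"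
    proof -
      have "of_int (orient C D A) = (of_int (fst D) - of_int (fst C)) * (of_int (snd A) - of_int (snd C))
        - (of_int (snd D) - of_int (snd C)) * (of_int (fst A) - of_int (fst C) :: real)"
        by (simp add: orient_def algebra_simps)
      thus ?thesis unfolding e1 e2 by (simp add: K_def algebra_simps)
    qed
    have oD: "of_int (orient A B D) = (1 - t) * of_int K"
    proof -
      have "orient A B D = orient A B C + K" using K1(1) by simp
      hence "of_int (orient A B D) = (of_int (orient A B C) + of_int K :: real)" by (simp only: of_int_add)
      thus ?thesis unfolding oC by (simp add: algebra_simps)
    qed
    have oB: "of_int (orient C D B) = - ((1 - s) * of_int K)"
    proof -
      have "orient C D B = orient C D A - K" using K1(2) by simp
      hence "of_int (orient C D B) = (of_int (orient C D A) - of_int K :: real)" by (simp only: of_int_diff)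
      thus ?thesis unfolding oA by (simp add: algebra_simps)
    qed
    have "K \<noteq> 0"
    proof
      assume "K = 0"
      hence "orient A B C = 0" "orient A B D = 0" using oC oD by simp_all
      then obtain c d where c: "fst C = fst A + c * (fst B - fst A)" "snd C = snd A + c * (snd B - snd A)"
        and d: "fst D = fst A + d * (fst B - fst A)" "snd D = snd A + d * (snd B - snd A)"
        using collinear_primitive[OF AB] by metis
      have "fst D - fst C = (d - c) * (fst B - fst A)" "snd D - snd C = (d - c) * (snd B - snd A)"
        using c d by (simp_all add: algebra_simps)
      hence "is_unit (d - c)" using CD unfolding primitive_def
        by (metis coprime_common_divisor dvd_triv_left)
      hence dc: "d = c + 1 \<or> d = c - 1" by auto
      have "(s - of_int c - t * of_int (d - c)) * (of_int (fst B) - of_int (fst A)) = 0"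
           "(s - of_int c - t * of_int (d - c)) * (of_int (snd B) - of_int (snd A)) = 0"
        using s(3,4) t(3,4) c d by (simp_all add: algebra_simps)
      moreover have "A \<noteq> B" using primitive_not_eq[OF AB] .
      ultimately have "s = of_int c + t * of_int (d - c)" by (auto simp: prod_eq_iff)
      with dc show False
      proof (elim disjE)
        assume d1: "d = c + 1" and "s = of_int c + t * of_int (d - c)"
        hence "s = of_int c + t" by simp
        hence "c = 0" using s01 t01 by linarith
        hence "C = A" "D = B" using c d d1 by (auto simp: prod_eq_iff)
        thus False using ne by simp
      next
        assume d1: "d = c - 1" and "s = of_int c + t * of_int (d - c)"
        hence "s = of_int c - t" by simp
        hence "c = 1" using s01 t01 by linarith
        hence "C = B" "D = A" using c d d1 by (auto simp: prod_eq_iff)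
        thus False using ne by (simp add: seg_commute)
      qed
    qed
    hence K2: "(of_int K)\<^sup>2 > (0::real)" by simp
    have "of_int (orient A B C * orient A B D) = - (t * (1 - t) * (of_int K)\<^sup>2)"
      unfolding of_int_mult oC oD by (simp add: power2_eq_square algebra_simps)
    also have "\<dots> < 0" using t01 K2 by simp
    finally have 1: "orient A B C * orient A B D < 0" by (simp only: of_int_less_0_iff)
    have "of_int (orient C D A * orient C D B) = - (s * (1 - s) * (of_int K)\<^sup>2)"
      unfolding of_int_mult oA oB by (simp add: power2_eq_square algebra_simps)
    also have "\<dots> < 0" using s01 K2 by simp
    finally have "orient C D A * orient C D B < 0" by (simp only: of_int_less_0_iff)
    with 1 show ?thesis by (simp add: pcross_def)
  qed
  show "cross (seg A B) (seg C D)" if "pcross A B C D"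
  proof -
    have p: "orient A B C * orient A B D < 0" "orient C D A * orient C D B < 0"
      using that by (auto simp: pcross_def)
    have K0: "K \<noteq> 0" using p(1) K1(1) by (auto simp: mult_less_0_iff)
    define s where "s = (of_int (orient C D A) / of_int K :: real)"
    define t where "t = (- of_int (orient A B C) / of_int K :: real)"
    have s01: "0 < s" "s < 1"
      using p(2) K0 K1(2) unfolding s_def
      by (auto simp: mult_less_0_iff divide_simps)
    have t01: "0 < t" "t < 1"
      using p(1) K0 K1(1) unfolding t_def
      by (auto simp: mult_less_0_iff divide_simps)
    define z where "z = (of_int (fst A) + s * (of_int (fst B) - of_int (fst A)),
                         of_int (snd A) + s * (of_int (snd B) - of_int (snd A)))"
    have i1: "K * (fst A - fst C) + orient C D A * (fst B - fst A) + orient A B C * (fst D - fst C) = 0"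
      by (simp add: K_def orient_def algebra_simps)
    have i2: "K * (snd A - snd C) + orient C D A * (snd B - snd A) + orient A B C * (snd D - snd C) = 0"
      by (simp add: K_def orient_def algebra_simps)
    have r1: "fst z = of_int (fst C) + t * (of_int (fst D) - of_int (fst C))"
    proof -
      have "of_int K * (fst z - (of_int (fst C) + t * (of_int (fst D) - of_int (fst C)))) =
        of_int (K * (fst A - fst C) + orient C D A * (fst B - fst A) + orient A B C * (fst D - fst C))"
        using K0 by (simp add: z_def s_def t_def field_simps)
      thus ?thesis unfolding i1 using K0 by simp
    qed
    have r2: "snd z = of_int (snd C) + t * (of_int (snd D) - of_int (snd C))"
    proof -
      have "of_int K * (snd z - (of_int (snd C) + t * (of_int (snd D) - of_int (snd C)))) =
        of_int (K * (snd A - snd C) + orient C D A * (snd B - snd A) + orient A B C * (snd D - snd C))"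
        using K0 by (simp add: z_def s_def t_def field_simps)
      thus ?thesis unfolding i2 using K0 by simp
    qed
    have zA: "z \<in> seg A B" unfolding in_seg_iff using s01 by (intro exI[of _ s]) (auto simp: z_def)
    have zC: "z \<in> seg C D" unfolding in_seg_iff using t01 r1 r2 by (intro exI[of _ t]) auto
    have "z \<noteq> emb A"
      using s01 primitive_not_eq[OF AB] by (auto simp: z_def emb_def prod_eq_iff)
    moreover have "z \<noteq> emb B"
    proof
      assume "z = emb B"
      hence "(1 - s) * (of_int (fst B) - of_int (fst A)) = 0" "(1 - s) * (of_int (snd B) - of_int (snd A)) = 0"
        by (simp_all add: z_def emb_def prod_eq_iff algebra_simps)
      thus False using s01 primitive_not_eq[OF AB] by (auto simp: prod_eq_iff)
    qed
    moreover have "seg A B \<noteq> seg C D"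
    proof
      assume "seg A B = seg C D"
      hence "orient A B C = 0" by (auto simp: seg_eq_iff orient_def algebra_simps)
      thus False using p by simp
    qed
    ultimately show ?thesis unfolding cross_def endpoints_seg using zA zC by blast
  qed
qed

lemma l1_length_seg: "l1_length (seg A B) = of_int (len A B)"
  by (simp add: seg_def l1_length_segment len_def emb_def)

lemma edge_midpoint_seg:
  "edge_midpoint (seg A B) = (of_int (fst A + fst B) / 2, of_int (snd A + snd B) / 2)"
  by (simp add: seg_def edge_midpoint_segment emb_def midpoint_def prod_eq_iff)

lemma edge_midpoint_seg_eq_iff:
  "edge_midpoint (seg A B) = edge_midpoint (seg C D) \<longleftrightarrow> A + B = C + D"
proof -
  have "edge_midpoint (seg A B) = edge_midpoint (seg C D) \<longleftrightarrow>
    real_of_int (fst A + fst B) = of_int (fst C + fst D) \<and> real_of_int (snd A + snd B) = of_int (snd C + snd D)"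
    unfolding edge_midpoint_seg by (simp del: of_int_add)
  thus ?thesis by (simp only: of_int_eq_iff) (auto simp: prod_eq_iff)
qed

section \<open>Unimodular triangles\<close>

text \<open>The barycentric coordinates of \<open>X\<close> with respect to \<open>ABC\<close>, scaled by \<open>orient A B C\<close>. For a unimodular
  triangle they are therefore integers, and they determine \<open>X\<close> and all orientations.\<close>

lemma orient_bary_sum: "orient B C X + orient C A X + orient A B X = orient A B C"
  by (simp add: orient_def algebra_simps)

lemma orient_bary:
  assumes "orient A B C = 1"
  shows "orient P Q A = orient C A P * orient A B Q - orient A B P * orient C A Q"
    and "orient P Q B = orient A B P * orient B C Q - orient B C P * orient A B Q"
    and "orient P Q C = orient B C P * orient C A Q - orient C A P * orient B C Q"
    and "fst X = orient B C X * fst A + orient C A X * fst B + orient A B X * fst C"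
    and "snd X = orient B C X * snd A + orient C A X * snd B + orient A B X * snd C"
proof -
  have "orient P Q A * orient A B C = orient C A P * orient A B Q - orient A B P * orient C A Q"
    by (simp add: orient_def algebra_simps)
  thus "orient P Q A = orient C A P * orient A B Q - orient A B P * orient C A Q" using assms by simp
  have "orient P Q B * orient A B C = orient A B P * orient B C Q - orient B C P * orient A B Q"
    by (simp add: orient_def algebra_simps)
  thus "orient P Q B = orient A B P * orient B C Q - orient B C P * orient A B Q" using assms by simp
  have "orient P Q C * orient A B C = orient B C P * orient C A Q - orient C A P * orient B C Q"
    by (simp add: orient_def algebra_simps)
  thus "orient P Q C = orient B C P * orient C A Q - orient C A P * orient B C Q" using assms by simp
  have "fst X * orient A B C = orient B C X * fst A + orient C A X * fst B + orient A B X * fst C"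
    by (simp add: orient_def algebra_simps)
  thus "fst X = orient B C X * fst A + orient C A X * fst B + orient A B X * fst C" using assms by simp
  have "snd X * orient A B C = orient B C X * snd A + orient C A X * snd B + orient A B X * snd C"
    by (simp add: orient_def algebra_simps)
  thus "snd X = orient B C X * snd A + orient C A X * snd B + orient A B X * snd C" using assms by simp
qed

text \<open>Read \<open>(b, c)\<close> and \<open>(b', c')\<close> as two points on different sides of the line \<open>c = 0\<close>. The line through them
  meets \<open>c = 0\<close> at a positive and \<open>c = 1\<close> at a negative value of \<open>b\<close>, so \<open>b\<close> decreases along it; hence it is positive
  at the first point and negative at the second one.\<close>

lemma interpolation_sign:
  fixes b b' c c' :: int
  assumes "c < 0" "c' > 0" "b * c' - c * b' > 0" "b' * (1 - c) + b * (c' - 1) < 0"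
  shows "b > 0 \<and> b' < 0"
proof -
  have "b > 0"
  proof (rule ccontr)
    assume "\<not> b > 0"
    hence b: "b \<le> 0" by simp
    have "b * c' \<le> 0" using b assms(2) by (simp add: mult_le_0_iff)
    hence "c * b' < 0" using assms(3) by linarith
    hence b': "b' > 0" using assms(1) by (simp add: mult_less_0_iff)
    have "b' * (1 - c) + b * (c' - 1) = b' - b + (b * c' - c * b')" by (simp add: algebra_simps)
    thus False using b b' assms(3,4) by linarith
  qed
  moreover have "b' < 0"
  proof (rule ccontr)
    assume "\<not> b' < 0"
    hence "b' * (1 - c) \<ge> 0" "b * (c' - 1) \<ge> 0" using assms(1,2) \<open>b > 0\<close> by simp_all
    thus False using assms(4) by linarith
  qed
  ultimately show ?thesis by simp
qed

text \<open>The side through which \<open>PQ\<close> leaves the triangle is decided by the side of \<open>PQ\<close> on which \<open>C\<close> lies. If \<open>C\<close>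
  is on the line of \<open>PQ\<close>, then \<open>Q = C\<close> because no lattice point is interior to \<open>PQ\<close>. The signs of the
  barycentric coordinates, and not only the crossing, are recorded since they bound the direction of \<open>PQ\<close>.\<close>

lemma exit_signed:
  assumes T: "orient A B C = 1" and PQ: "primitive P Q"
    and c: "orient A B P < 0" "orient A B Q > 0" and x: "orient P Q A * orient P Q B < 0"
  shows "(orient C A P > 0 \<and> orient C A Q < 0 \<and> pcross A C P Q) \<or>
         (orient B C P > 0 \<and> orient B C Q < 0 \<and> pcross B C P Q) \<or>
         (Q = C \<and> orient C A P > 0 \<and> orient B C P > 0)"
proof -
  define a b c' where "a = orient B C" and "b = orient C A" and "c' = orient A B"
  have s: "a P + b P + c' P = 1" "a Q + b Q + c' Q = 1"
    using orient_bary_sum[of B C _ A] T by (simp_all add: a_def b_def c'_def)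
  have psi: "orient P Q A = b P * c' Q - c' P * b Q" "orient P Q B = c' P * a Q - a P * c' Q"
    "orient P Q C = a P * b Q - b P * a Q"
    using orient_bary[OF T] by (simp_all add: a_def b_def c'_def)
  have c2: "c' P < 0" "c' Q > 0" using c by (simp_all add: c'_def)
  have aP: "a P = 1 - b P - c' P" and aQ: "a Q = 1 - b Q - c' Q" using s by linarith+
  have diff: "orient P Q A - orient P Q B = c' Q - c' P"
    unfolding psi aP aQ by (simp add: algebra_simps)
  have pA: "orient P Q A > 0" and pB: "orient P Q B < 0"
    using x diff c2 by (auto simp: mult_less_0_iff)
  have pC: "orient P Q C = b Q * (1 - c' P) + b P * (c' Q - 1)"
    unfolding psi aP aQ by (simp add: algebra_simps)
  have bP: "b P = 1 - a P - c' P" and bQ: "b Q = 1 - a Q - c' Q" using s by linarith+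
  have pC': "- orient P Q C = a Q * (1 - c' P) + a P * (c' Q - 1)"
    unfolding psi bP bQ by (simp add: algebra_simps)
  consider "orient P Q C < 0" | "orient P Q C > 0" | "orient P Q C = 0" by linarith
  thus ?thesis
  proof cases
    case 1
    have "b P > 0 \<and> b Q < 0"
      using interpolation_sign[OF c2, of "b P" "b Q"] pA pC 1 by (simp add: psi)
    moreover from this have "b P * b Q < 0" by (simp add: mult_less_0_iff)
    moreover have "orient P Q A * orient P Q C < 0" using pA 1 by (simp add: mult_less_0_iff)
    ultimately show ?thesis by (simp add: pcross_def orient_swap[of A C] b_def)
  next
    case 2
    have "a P > 0 \<and> a Q < 0"
      using interpolation_sign[OF c2, of "a P" "a Q"] pB pC' 2 by (simp add: psi algebra_simps)
    moreover from this have "a P * a Q < 0" by (simp add: mult_less_0_iff)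
    moreover have "orient P Q B * orient P Q C < 0" using pB 2 by (simp add: mult_less_0_iff)
    ultimately show ?thesis by (simp add: pcross_def a_def)
  next
    case 3
    obtain t where t: "fst C = fst P + t * (fst Q - fst P)" "snd C = snd P + t * (snd Q - snd P)"
      using collinear_primitive[OF PQ 3] .
    have "c' C = c' P + t * (c' Q - c' P)"
      unfolding c'_def orient_def t by (simp add: algebra_simps)
    define k where "k = c' Q - c' P"
    have k: "k \<ge> 2" "c' Q = c' P + k" using c2 by (simp_all add: k_def)
    have tc: "c' P + t * k = 1" using T \<open>c' C = _\<close> by (simp add: c'_def k_def)
    have "t > 0"
    proof (rule ccontr)
      assume "\<not> t > 0"
      hence "t * k \<le> 0" using k by (simp add: mult_le_0_iff)
      thus False using tc c2 by linarith
    qed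
    moreover have "t < 2"
    proof (rule ccontr)
      assume "\<not> t < 2"
      hence "2 * k \<le> t * k" using k by (intro mult_right_mono) auto
      thus False using tc c2 k by linarith
    qed
    ultimately have "t = 1" by linarith
    hence CQ: "Q = C" using t by (simp add: prod_eq_iff)
    hence "b Q = 0" "a Q = 0" "c' Q = 1" using T by (simp_all add: a_def b_def c'_def orient_def)
    hence "b P > 0" "a P > 0" using pA pB by (simp_all add: psi)
    thus ?thesis using CQ by (simp add: a_def b_def)
  qed
qed

text \<open>A primitive segment that enters a unimodular triangle through one side leaves it through another side
  or stops at the opposite corner, because the triangle contains no other lattice point.\<close>

lemma exit_triangle:
  assumes "\<bar>orient A B C\<bar> = 1" "primitive P Q" "pcross A B P Q"
  shows "pcross A C P Q \<or> pcross B C P Q \<or> C = P \<or> C = Q"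
proof -
  have main: "pcross A C P Q \<or> pcross B C P Q \<or> C = P \<or> C = Q"
    if T: "orient A B C = 1" and PQ: "primitive P Q" and x: "pcross A B P Q" for A B P Q
  proof (cases "orient A B P < 0")
    case True
    hence "orient A B Q > 0" using x by (auto simp: pcross_def mult_less_0_iff)
    thus ?thesis using exit_signed[OF T PQ True] x by (auto simp: pcross_def)
  next
    case False
    hence "orient A B Q < 0" "orient A B P > 0" using x by (auto simp: pcross_def mult_less_0_iff)
    moreover have "primitive Q P" "pcross A B Q P" using PQ x primitive_commute pcross_swap by blast+
    ultimately show ?thesis using exit_signed[OF T, of Q P] pcross_swap(2) by (auto simp: pcross_def)
  qed
  show ?thesis
  proof (cases "orient A B C = 1")
    case False
    hence "orient B A C = 1" using assms(1) by (auto simp: orient_swap[of B A])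
    thus ?thesis using main[of B A P Q] assms pcross_swap by blast
  qed (use main assms in blast)
qed

lemma abs_diff_eq_add: "\<bar>x - y\<bar> = \<bar>x\<bar> + \<bar>y\<bar> \<Longrightarrow> (x::int) \<ge> 0 \<and> y \<le> 0 \<or> x \<le> 0 \<and> y \<ge> 0"
  by linarith

lemma abs_comb_ge:
  fixes x y p q :: int
  assumes "\<bar>x - y\<bar> = \<bar>x\<bar> + \<bar>y\<bar>" "p \<ge> 0" "q \<ge> 0"
  shows "\<bar>p * x - q * y\<bar> = p * \<bar>x\<bar> + q * \<bar>y\<bar>"
  using abs_diff_eq_add[OF assms(1)]
proof
  assume *: "x \<ge> 0 \<and> y \<le> 0"
  hence "p * x \<ge> 0" "q * y \<le> 0" using assms by (simp_all add: mult_nonneg_nonpos)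
  thus ?thesis using * by simp
next
  assume *: "x \<le> 0 \<and> y \<ge> 0"
  hence "p * x \<le> 0" "q * y \<ge> 0" using assms by (simp_all add: mult_nonneg_nonpos)
  thus ?thesis using * by simp
qed

text \<open>Leaving the triangle through \<open>BC\<close> or at \<open>C\<close>, the segment has direction \<open>p (A - B) - q (C - B)\<close>, up to sign,
  with \<open>p \<ge> 1\<close> and \<open>q \<ge> 2\<close>. If \<open>AC\<close> is the longest side, then \<open>A - B\<close> and \<open>B - C\<close> point into the same
  quadrant, so the lengths add up to \<open>p |AB| + q |BC|\<close>. Thus an edge which is not longer than \<open>AB\<close> and
  crosses it also crosses the longest side of the triangle.\<close>

lemma longer_if_not_through_longest:
  assumes T: "\<bar>orient A B C\<bar> = 1" and PQ: "primitive P Q" and x: "pcross A B P Q"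
    and longest: "len A C = len A B + len B C" and nx: "\<not> pcross A C P Q"
  shows "len P Q > len A B \<and> len P Q \<ge> 3"
proof -
  have abs: "\<bar>(fst A - fst B) - (fst C - fst B)\<bar> = \<bar>fst A - fst B\<bar> + \<bar>fst C - fst B\<bar>"
    "\<bar>(snd A - snd B) - (snd C - snd B)\<bar> = \<bar>snd A - snd B\<bar> + \<bar>snd C - snd B\<bar>"
    using longest unfolding len_def by linarith+
  have AB: "A \<noteq> B" "B \<noteq> C" using T by (auto simp: orient_def)
  have main: ?thesis if PQ: "primitive P' Q'" and c: "orient A B P' * s < 0" "orient A B Q' * s > 0" 
      and s: "s = orient A B C" and x: "pcross A B P' Q'" and nx: "\<not> pcross A C P' Q'"
      and l: "len P' Q' = len P Q" for P' Q' s
  proof -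
    define a c where "a X = s * orient B C X" and "c X = s * orient A B X" for X
    define p q where "p = a P' - a Q'" and "q = c Q' - c P'"
    have s1: "s = 1 \<or> s = -1" using T s by auto
    have pq: "p \<ge> 1 \<and> q \<ge> 2 \<and> fst Q' - fst P' = - (p * (fst A - fst B) - q * (fst C - fst B)) 
       \<and> snd Q' - snd P' = - (p * (snd A - snd B) - q * (snd C - snd B))"
      using s1
    proof
      assume s': "s = 1"
      hence T1: "orient A B C = 1" using s by simp
      have c': "orient A B P' < 0" "orient A B Q' > 0" using c s' by simp_all
      from exit_signed[OF T1 PQ c'] x nx 
      have cases: "(orient B C P' > 0 \<and> orient B C Q' < 0) \<or> (Q' = C \<and> orient B C P' > 0)"
        by (auto simp: pcross_def)
      have "orient B C C = 0" by (simp add: orient_def)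
      with cases c' have 1: "p \<ge> 1" "q \<ge> 2" by (auto simp: p_def q_def a_def c_def s')
      have b: "orient C A P' = 1 - orient B C P' - orient A B P'" "orient C A Q' = 1 - orient B C Q' - orient A B Q'"
        using orient_bary_sum[of B C P' A] orient_bary_sum[of B C Q' A] T1 by linarith+
      have "fst Q' - fst P' = - (p * (fst A - fst B) - q * (fst C - fst B))"
        "snd Q' - snd P' = - (p * (snd A - snd B) - q * (snd C - snd B))"
        by (subst (1 2) orient_bary(4,5)[OF T1], unfold b, simp add: p_def q_def a_def c_def s' algebra_simps)+
      thus ?thesis using 1 by blast
    next
      assume s': "s = -1"
      hence T1: "orient B A C = 1" using s by (simp add: orient_swap[of B A])
      have c': "orient B A P' < 0" "orient B A Q' > 0" using c s' by (simp_all add: orient_swap[of B A])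
      have x': "pcross B A P' Q'" using x pcross_swap by blast
      from exit_signed[OF T1 PQ c'] x' nx 
      have cases: "(orient C B P' > 0 \<and> orient C B Q' < 0) \<or> (Q' = C \<and> orient C B P' > 0)"
        by (auto simp: pcross_def)
      have "orient C B C = 0" by (simp add: orient_def)
      with cases c' have 1: "p \<ge> 1" "q \<ge> 2" 
        by (auto simp: p_def q_def a_def c_def s' orient_swap[of B C] orient_swap[of A B])
      have b: "orient A C P' = 1 - orient C B P' - orient B A P'" "orient A C Q' = 1 - orient C B Q' - orient B A Q'"
        using orient_bary_sum[of A C P' B] orient_bary_sum[of A C Q' B] T1 by linarith+
      have "fst Q' - fst P' = - (p * (fst A - fst B) - q * (fst C - fst B))"
        "snd Q' - snd P' = - (p * (snd A - snd B) - q * (snd C - snd B))"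
        by (subst (1 2) orient_bary(4,5)[OF T1], unfold b, simp add: p_def q_def a_def c_def s' orient_swap[of B C] orient_swap[of A B] algebra_simps)+
      thus ?thesis using 1 by blast
    qed
    have "len P' Q' = \<bar>p * (fst A - fst B) - q * (fst C - fst B)\<bar> + \<bar>p * (snd A - snd B) - q * (snd C - snd B)\<bar>"
    proof -
      have "len P' Q' = \<bar>fst Q' - fst P'\<bar> + \<bar>snd Q' - snd P'\<bar>" by (simp add: len_def)
      thus ?thesis using pq by (simp only: abs_minus_cancel)
    qed
    also have "\<dots> = p * len A B + q * len B C"
      using abs_comb_ge[OF abs(1), of p q] abs_comb_ge[OF abs(2), of p q] pq
      by (simp add: len_def algebra_simps abs_minus_commute)
    finally have "len P' Q' = p * len A B + q * len B C" .
    moreover have "p * len A B \<ge> 1 * len A B" using pq len_nonneg by (intro mult_right_mono) auto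
    moreover have "q * len B C \<ge> 2 * len B C" using pq len_nonneg by (intro mult_right_mono) auto
    ultimately show ?thesis using l len_pos[OF AB(1)] len_pos[OF AB(2)] by linarith
  qed
  have "orient A B C = 1 \<or> orient A B C = -1" using T by auto
  moreover have "orient A B P * orient A B Q < 0" using x by (simp add: pcross_def)
  ultimately have "orient A B P * orient A B C < 0 \<and> orient A B Q * orient A B C > 0 
     \<or> orient A B Q * orient A B C < 0 \<and> orient A B P * orient A B C > 0"
    by (auto simp: mult_less_0_iff)
  thus ?thesis
    using main[OF PQ _ _ refl x nx refl] main[of Q P, OF _ _ _ refl] PQ x nx primitive_commute pcross_swap(2) len_commute
    by blast
qed

text \<open>Two of the three edge vectors, suitably oriented, lie in a common closed quadrant, for otherwise the
  determinant would have absolute value at least two; their sum is the third edge vector.\<close>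

lemma triangle_longest:
  assumes T: "\<bar>orient A B C\<bar> = 1"
  shows "len A B = len A C + len B C \<or> len A C = len A B + len B C \<or> len B C = len A B + len A C"
proof -
  define u1 u2 v1 v2 where "u1 = fst B - fst A" and "u2 = snd B - snd A" 
    and "v1 = fst C - fst A" and "v2 = snd C - snd A"
  have det: "\<bar>u1 * v2 - u2 * v1\<bar> = 1" using T by (simp add: orient_def u1_def u2_def v1_def v2_def)
  have l: "len A B = \<bar>u1\<bar> + \<bar>u2\<bar>" "len A C = \<bar>v1\<bar> + \<bar>v2\<bar>" "len B C = \<bar>u1 - v1\<bar> + \<bar>u2 - v2\<bar>"
    by (simp_all add: len_def u1_def u2_def v1_def v2_def)
  have key: "\<bar>x1\<bar> + \<bar>x2\<bar> = \<bar>y1\<bar> + \<bar>y2\<bar> + (\<bar>x1 - y1\<bar> + \<bar>x2 - y2\<bar>) \<or>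
     \<bar>y1\<bar> + \<bar>y2\<bar> = \<bar>x1\<bar> + \<bar>x2\<bar> + (\<bar>x1 - y1\<bar> + \<bar>x2 - y2\<bar>) \<or>
     \<bar>x1 - y1\<bar> + \<bar>x2 - y2\<bar> = \<bar>x1\<bar> + \<bar>x2\<bar> + (\<bar>y1\<bar> + \<bar>y2\<bar>)"
    if d: "\<bar>x1 * y2 - x2 * y1\<bar> = 1" and x: "x1 \<ge> 0" "x2 \<ge> 0" for x1 x2 y1 y2 :: int
  proof -
    consider "y1 \<le> 0" "y2 \<le> 0" | "y1 > 0" "y2 < 0" | "y1 < 0" "y2 > 0" | "y1 \<ge> 0" "y2 \<ge> 0" by linarith
    thus ?thesis
    proof cases
      case 2
      have "x1 = 0 \<or> x2 = 0"
      proof (rule ccontr)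
        assume "\<not> ?thesis"
        hence "x1 * y2 \<le> -1" "x2 * y1 \<ge> 1" using x 2
          by (smt (verit) mult_less_0_iff, smt (verit) mult_pos_pos)
        thus False using d by linarith
      qed
      thus ?thesis
      proof
        assume "x1 = 0"
        hence "\<bar>x2\<bar> = 1" "\<bar>y1\<bar> = 1" using d abs_zmult_eq_1[of x2 y1] abs_zmult_eq_1[of y1 x2] by (auto simp: mult.commute)
        thus ?thesis using x 2 \<open>x1 = 0\<close> by auto
      next
        assume "x2 = 0"
        hence "\<bar>x1\<bar> = 1" "\<bar>y2\<bar> = 1" using d abs_zmult_eq_1[of x1 y2] abs_zmult_eq_1[of y2 x1] by (auto simp: mult.commute)
        thus ?thesis using x 2 \<open>x2 = 0\<close> by auto
      qed
    next
      case 3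
      have "x1 = 0 \<or> x2 = 0"
      proof (rule ccontr)
        assume "\<not> ?thesis"
        hence "x1 * y2 \<ge> 1" "x2 * y1 \<le> -1" using x 3
          by (smt (verit) mult_pos_pos, smt (verit) mult_less_0_iff)
        thus False using d by linarith
      qed
      thus ?thesis
      proof
        assume "x1 = 0"
        hence "\<bar>x2\<bar> = 1" "\<bar>y1\<bar> = 1" using d abs_zmult_eq_1[of x2 y1] abs_zmult_eq_1[of y1 x2] by (auto simp: mult.commute)
        thus ?thesis using x 3 \<open>x1 = 0\<close> by auto
      next
        assume "x2 = 0"
        hence "\<bar>x1\<bar> = 1" "\<bar>y2\<bar> = 1" using d abs_zmult_eq_1[of x1 y2] abs_zmult_eq_1[of y2 x1] by (auto simp: mult.commute)
        thus ?thesis using x 3 \<open>x2 = 0\<close> by auto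
      qed
    next
      case 4
      show ?thesis
      proof (cases "x1 \<ge> y1 \<and> x2 \<ge> y2 \<or> x1 \<le> y1 \<and> x2 \<le> y2")
        case True
        thus ?thesis using x 4 by auto
      next
        case False
        hence "x1 > y1 \<and> x2 < y2 \<or> x1 < y1 \<and> x2 > y2" by auto
        thus ?thesis
        proof
          assume a: "x1 > y1 \<and> x2 < y2"
          have "(y1 + 1) * (x2 + 1) \<le> x1 * y2" using a x 4 by (intro mult_mono) auto
          hence "x1 * y2 - x2 * y1 \<ge> 1 + x2 + y1" by (simp add: algebra_simps)
          hence "x2 = 0" "y1 = 0" using d x 4 by linarith+
          thus ?thesis using x 4 by auto
        next
          assume a: "x1 < y1 \<and> x2 > y2"
          have "(x1 + 1) * (y2 + 1) \<le> y1 * x2" using a x 4 by (intro mult_mono) auto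
          hence "x2 * y1 - x1 * y2 \<ge> 1 + x1 + y2" by (simp add: algebra_simps)
          hence "x1 = 0" "y2 = 0" using d x 4 by linarith+
          thus ?thesis using x 4 by auto
        qed
      qed
    qed (use x in auto)
  qed
  define s t :: int where "s = (if u1 \<ge> 0 then 1 else -1)" and "t = (if u2 \<ge> 0 then 1 else -1)"
  have "\<bar>(s * u1) * (t * v2) - (t * u2) * (s * v1)\<bar> = \<bar>s * t\<bar> * \<bar>u1 * v2 - u2 * v1\<bar>"
    by (simp add: algebra_simps flip: abs_mult)
  also have "\<dots> = 1" using det by (simp add: s_def t_def)
  finally have d: "\<bar>(s * u1) * (t * v2) - (t * u2) * (s * v1)\<bar> = 1" .
  have "s * u1 \<ge> 0" "t * u2 \<ge> 0" by (auto simp: s_def t_def)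
  note key[OF d this]
  moreover have "\<bar>s * u1\<bar> = \<bar>u1\<bar>" "\<bar>t * u2\<bar> = \<bar>u2\<bar>" "\<bar>s * v1\<bar> = \<bar>v1\<bar>" "\<bar>t * v2\<bar> = \<bar>v2\<bar>"
    "\<bar>s * u1 - s * v1\<bar> = \<bar>u1 - v1\<bar>" "\<bar>t * u2 - t * v2\<bar> = \<bar>u2 - v2\<bar>"
    by (auto simp: s_def t_def)
  ultimately show ?thesis unfolding l by auto
qed

section \<open>The triangles adjacent to an edge of a triangulation\<close>

lemma finite_grid: "finite (grid m n)"
  by (simp add: grid_def)

lemma triangulation_is_edge: "full_triangulation m n \<sigma> \<Longrightarrow> e \<in> \<sigma> \<Longrightarrow> is_edge m n e"
  by (simp add: full_triangulation_def noncrossing_def)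

lemma triangulation_not_cross:
  "full_triangulation m n \<sigma> \<Longrightarrow> e \<in> \<sigma> \<Longrightarrow> f \<in> \<sigma> \<Longrightarrow> \<not> cross e f"
  by (simp add: full_triangulation_def noncrossing_def)

lemma triangulation_edge:
  assumes "full_triangulation m n \<sigma>" "e \<in> \<sigma>"
  obtains A B where "e = seg A B" "A \<in> grid m n" "B \<in> grid m n" "primitive A B"
  using is_edge_obtain[OF triangulation_is_edge[OF assms]] by metis

lemma triangulation_seg:
  assumes "full_triangulation m n \<sigma>" "seg A B \<in> \<sigma>"
  shows "A \<in> grid m n" "B \<in> grid m n" "primitive A B"
  using triangulation_is_edge[OF assms] by (simp_all add: is_edge_seg_iff)

lemma triangulation_not_pcross:
  assumes "full_triangulation m n \<sigma>" "seg A B \<in> \<sigma>" "seg C D \<in> \<sigma>"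
  shows "\<not> pcross A B C D"
  using triangulation_not_cross[OF assms] cross_seg_iff triangulation_seg(3)[OF assms(1)] assms(2,3) by simp

lemma cross_commute: "cross e f \<longleftrightarrow> cross f e"
  by (auto simp: cross_def)

lemma triangulation_maximal:
  assumes \<sigma>: "full_triangulation m n \<sigma>" and AB: "A \<in> grid m n" "B \<in> grid m n" "primitive A B"
    and nc: "\<And>P Q. seg P Q \<in> \<sigma> \<Longrightarrow> \<not> pcross A B P Q"
  shows "seg A B \<in> \<sigma>"
proof -
  have nx: "\<not> cross (seg A B) f" if "f \<in> \<sigma>" for f
    using triangulation_edge[OF \<sigma> that] nc cross_seg_iff[OF AB(3)] that by metis
  have "noncrossing m n (insert (seg A B) \<sigma>)"
    unfolding noncrossing_def
  proof (intro conjI ballI)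
    show "is_edge m n e" if "e \<in> insert (seg A B) \<sigma>" for e
      using that AB triangulation_is_edge[OF \<sigma>] by (auto simp: is_edge_seg_iff)
    show "\<not> cross e f" if "e \<in> insert (seg A B) \<sigma>" "f \<in> insert (seg A B) \<sigma>" for e f
    proof (cases "e = f")
      case True
      thus ?thesis by (simp add: cross_def)
    next
      case False
      thus ?thesis using that nx triangulation_not_cross[OF \<sigma>] cross_commute by (metis insertE)
    qed
  qed
  hence "insert (seg A B) \<sigma> = \<sigma>"
    using \<sigma> subset_insertI[of \<sigma> "seg A B"] by (simp add: full_triangulation_def)
  thus ?thesis by (metis insertI1)
qed

lemma orient_coords:
  assumes "orient A B C = 1"
  shows "orient P Q X = (orient C A Q - orient C A P) * (orient A B X - orient A B P)
    - (orient A B Q - orient A B P) * (orient C A X - orient C A P)"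
proof -
  have "orient P Q X * orient A B C = (orient C A Q - orient C A P) * (orient A B X - orient A B P)
    - (orient A B Q - orient A B P) * (orient C A X - orient C A P)"
    by (simp add: orient_def algebra_simps)
  thus ?thesis using assms by simp
qed

text \<open>Consider the segment from \<open>(p, c)\<close> to \<open>(q, c')\<close>, second coordinate being the height. It passes height \<open>0\<close> at a
  point with first coordinate at most \<open>0\<close> and height \<open>1\<close> at one with positive first coordinate, so it leans to
  the right.\<close>

lemma slope_signs:
  fixes c c' p q :: int
  assumes "c \<le> 0" "c' \<ge> 1" "p * c' - c * q \<le> 0" "q * (1 - c) + p * (c' - 1) > 0"
  shows "p \<le> 0 \<and> q \<ge> 1"
proof -
  have "q * (1 - c) + p * (c' - 1) = q - p + (p * c' - c * q)" by (simp add: algebra_simps)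
  hence qp: "q > p" using assms by linarith
  have p: "p \<le> 0"
  proof (rule ccontr)
    assume "\<not> p \<le> 0"
    hence "p * c' > 0" "c * q \<le> 0" using assms(1,2) qp by (auto simp: mult_le_0_iff)
    thus False using assms(3) by linarith
  qed
  have "q \<ge> 1"
  proof (rule ccontr)
    assume "\<not> q \<ge> 1"
    hence "q * (1 - c) \<le> 0" "p * (c' - 1) \<le> 0" using p assms(1,2) by (auto simp: mult_le_0_iff)
    thus False using assms(4) by linarith
  qed
  with p show ?thesis by simp
qed

text \<open>Let \<open>PQ\<close> and \<open>P'Q'\<close> cross the strip between the line of \<open>AB\<close> and the parallel line through \<open>C\<close>. The former
  passes to the left of \<open>A\<close> and to the right of \<open>C\<close>, the latter to the right of \<open>B\<close> and to the left of
  \<open>C + B - A\<close>. Within the strip their distance shrinks from at least \<open>1\<close> to less than \<open>1\<close>; since they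
  end at lattice points, they lean so much that \<open>Q\<close> and \<open>Q'\<close> are in exchanged order.\<close>

lemma strip_edges_cross:
  assumes T: "orient A B C = 1"
    and P: "orient A B P \<le> 0" "orient A B Q \<ge> 1" "orient P Q A \<le> 0" "orient P Q C > 0"
    and P': "orient A B P' \<le> 0" "orient A B Q' \<ge> 1" "orient P' Q' B \<ge> 0" "orient P' Q' (C + B - A) < 0"
  shows "pcross P Q P' Q'"
proof -
  define b c where "b = orient C A" and "c = orient A B"
  define E where "E = C + B - A"
  note co = orient_coords[OF T, folded b_def c_def]
  have val: "b A = 0" "c A = 0" "b B = 1" "c B = 0" "b C = 0" "c C = 1" "b E = 1" "c E = 1"
    using T by (simp_all add: b_def c_def E_def orient_def algebra_simps)
  have cc: "c P \<le> 0" "c Q \<ge> 1" "c P' \<le> 0" "c Q' \<ge> 1" using P P' by (simp_all add: c_def)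
  have s1: "b P \<le> 0 \<and> b Q \<ge> 1"
    using P(3,4) cc by (intro slope_signs[of "c P" "c Q"]) (simp_all add: co[of P Q] val algebra_simps)
  have "1 - b P' \<le> 0 \<and> 1 - b Q' \<ge> 1"
    using P'(3,4)[folded E_def] cc by (intro slope_signs[of "c P'" "c Q'"]) (simp_all add: co[of P' Q'] val algebra_simps)
  hence s2: "b P' \<ge> 1" "b Q' \<le> 0" by simp_all
  have d: "b Q - b P \<ge> 0" "c Q - c P \<ge> 1" "b Q' - b P' \<le> 0" "c Q' - c P' \<ge> 1" using s1 s2 cc by linarith+
  have "orient P' Q' Q = orient P' Q' E + (b Q' - b P') * (c Q - 1) - (c Q' - c P') * (b Q - 1)"
    by (simp add: co[of P' Q'] val algebra_simps)
  moreover have "(b Q' - b P') * (c Q - 1) \<le> 0" "(c Q' - c P') * (b Q - 1) \<ge> 0"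
    using d s1 cc by (simp_all add: mult_nonpos_nonneg)
  ultimately have 1: "orient P' Q' Q < 0" using P'[folded E_def] by linarith
  have "orient P' Q' P = orient P' Q' B + (c Q' - c P') + (b Q' - b P') * c P - (c Q' - c P') * b P"
    by (simp add: co[of P' Q'] val algebra_simps)
  moreover have "(b Q' - b P') * c P \<ge> 0" "(c Q' - c P') * b P \<le> 0"
    using d s1 cc by (simp_all add: mult_nonpos_nonpos mult_nonneg_nonpos)
  ultimately have 2: "orient P' Q' P > 0" using P' d by linarith
  have "orient P Q Q' = orient P Q C + (b Q - b P) * (c Q' - 1) - (c Q - c P) * b Q'"
    by (simp add: co[of P Q] val algebra_simps)
  moreover have "(b Q - b P) * (c Q' - 1) \<ge> 0" "(c Q - c P) * b Q' \<le> 0"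
    using d s2 cc by (simp_all add: mult_nonneg_nonpos)
  ultimately have 3: "orient P Q Q' > 0" using P by linarith
  have "orient P Q P' = orient P Q A - (c Q - c P) + (b Q - b P) * c P' - (c Q - c P) * (b P' - 1)"
    by (simp add: co[of P Q] val algebra_simps)
  moreover have "(b Q - b P) * c P' \<le> 0" "(c Q - c P) * (b P' - 1) \<ge> 0"
    using d s2 cc by (simp_all add: mult_nonneg_nonpos)
  ultimately have 4: "orient P Q P' < 0" using P d by linarith
  show ?thesis unfolding pcross_def using 1 2 3 4 by (simp add: mult_less_0_iff)
qed

lemma strip_sides:
  fixes p q c c' :: int
  assumes "p * q < 0" "(p * c' - c * q) * (q * (1 - c) + p * (c' - 1)) < 0"
  shows "c \<le> 0 \<and> c' \<ge> 1 \<or> c' \<le> 0 \<and> c \<ge> 1"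
proof (rule ccontr)
  assume "\<not> ?thesis"
  hence or: "c \<ge> 1 \<and> c' \<ge> 1 \<or> c \<le> 0 \<and> c' \<le> 0" by linarith
  let ?x = "p * c' - c * q" and ?y = "q * (1 - c) + p * (c' - 1)"
  have "?x \<ge> 0 \<and> ?y \<ge> 0 \<or> ?x \<le> 0 \<and> ?y \<le> 0"
  proof (cases "p > 0")
    case True
    hence q: "q < 0" using assms(1) by (simp add: mult_less_0_iff)
    from or show ?thesis
    proof
      assume *: "c \<ge> 1 \<and> c' \<ge> 1"
      hence "p * c' \<ge> 0" "c * q \<le> 0" "q * (1 - c) \<ge> 0" "p * (c' - 1) \<ge> 0"
        using True q by (simp_all add: mult_nonneg_nonpos mult_nonpos_nonpos)
      thus ?thesis by linarith
    next
      assume *: "c \<le> 0 \<and> c' \<le> 0"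
      hence "p * c' \<le> 0" "c * q \<ge> 0" "q * (1 - c) \<le> 0" "p * (c' - 1) \<le> 0"
        using True q by (simp_all add: mult_nonneg_nonpos mult_nonpos_nonpos mult_nonpos_nonneg)
      thus ?thesis by linarith
    qed
  next
    case False
    hence q: "p < 0" "q > 0" using assms(1) by (auto simp: mult_less_0_iff)
    from or show ?thesis
    proof
      assume *: "c \<ge> 1 \<and> c' \<ge> 1"
      hence "p * c' \<le> 0" "c * q \<ge> 0" "q * (1 - c) \<le> 0" "p * (c' - 1) \<le> 0"
        using q by (simp_all add: mult_nonneg_nonpos mult_nonpos_nonneg)
      thus ?thesis by linarith
    next
      assume *: "c \<le> 0 \<and> c' \<le> 0"
      hence "p * c' \<ge> 0" "c * q \<le> 0" "q * (1 - c) \<ge> 0" "p * (c' - 1) \<ge> 0"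
        using q by (simp_all add: mult_nonpos_nonpos mult_nonpos_nonneg)
      thus ?thesis by linarith
    qed
  qed
  thus False using assms(2) by (auto simp: mult_less_0_iff)
qed

text \<open>The open strip between the line of \<open>AB\<close> and its parallel through \<open>C\<close> contains no lattice point, so a segment
  that crosses \<open>AC\<close> or \<open>BC\<close> has to traverse it.\<close>

lemma strip_crossing:
  assumes T: "orient A B C = 1" and x: "pcross A C P Q \<or> pcross B C P Q"
  shows "orient A B P \<le> 0 \<and> orient A B Q \<ge> 1 \<or> orient A B Q \<le> 0 \<and> orient A B P \<ge> 1"
proof -
  define a b c where "a = orient B C" and "b = orient C A" and "c = orient A B"
  have s: "a P + b P + c P = 1" "a Q + b Q + c Q = 1"
    using orient_bary_sum[of B C _ A] T by (simp_all add: a_def b_def c_def)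
  have psi: "orient P Q A = b P * c Q - c P * b Q" "orient P Q B = c P * a Q - a P * c Q"
    "orient P Q C = a P * b Q - b P * a Q"
    using orient_bary[OF T] by (simp_all add: a_def b_def c_def)
  have aP: "a P = 1 - b P - c P" and aQ: "a Q = 1 - b Q - c Q" using s by linarith+
  have pC: "orient P Q C = b Q * (1 - c P) + b P * (c Q - 1)"
    unfolding psi aP aQ by (simp add: algebra_simps)
  have bP: "b P = 1 - a P - c P" and bQ: "b Q = 1 - a Q - c Q" using s by linarith+
  have pC': "orient P Q C = - (a Q * (1 - c P) + a P * (c Q - 1))"
    unfolding psi bP bQ by (simp add: algebra_simps)
  from x show ?thesis
  proof
    assume "pcross A C P Q"
    hence "b P * b Q < 0" "orient P Q A * orient P Q C < 0"
      by (simp_all add: pcross_def orient_swap[of A C] b_def)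
    thus ?thesis using strip_sides[of "b P" "b Q" "c Q" "c P"] pC psi(1) by (simp add: c_def)
  next
    assume "pcross B C P Q"
    hence *: "a P * a Q < 0" "orient P Q B * orient P Q C < 0"
      by (simp_all add: pcross_def a_def)
    have "orient P Q B * orient P Q C = (a P * c Q - c P * a Q) * (a Q * (1 - c P) + a P * (c Q - 1))"
      unfolding psi(2) pC' by (simp add: algebra_simps)
    thus ?thesis using strip_sides[of "a P" "a Q" "c Q" "c P"] * by (simp add: c_def)
  qed
qed

text \<open>\<open>x\<close> is a convex combination of \<open>q\<close>, \<open>b\<close> and \<open>a\<close>.\<close>

lemma convex_bounds:
  fixes d r q a b x :: int
  assumes "d \<ge> 1" "0 \<le> r" "r \<le> d - 1" "d * x = q + r * b + (d - 1 - r) * a"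
    "0 \<le> q" "q \<le> k" "0 \<le> a" "a \<le> k" "0 \<le> b" "b \<le> k"
  shows "0 \<le> x" "x \<le> k"
proof -
  have "r * b \<ge> 0" "(d - 1 - r) * a \<ge> 0" "r * b \<le> r * k" "(d - 1 - r) * a \<le> (d - 1 - r) * k"
    using assms by (auto intro: mult_left_mono)
  hence "d * x \<ge> 0" "d * x \<le> k + r * k + (d - 1 - r) * k" using assms by linarith+
  moreover have "k + r * k + (d - 1 - r) * k = d * k" by (simp add: algebra_simps)
  ultimately show "0 \<le> x" "x \<le> k" using assms(1) by (simp_all add: zero_le_mult_iff)
qed

lemma grid_iff: "A \<in> grid m n \<longleftrightarrow> 0 \<le> fst A \<and> fst A \<le> int m \<and> 0 \<le> snd A \<and> snd A \<le> int n"
  by (auto simp: grid_def mem_Times_iff)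

lemma primitive_apex:
  assumes "primitive A B"
  obtains C where "orient A B C = 1"
proof -
  obtain x y where "x * (fst B - fst A) + y * (snd B - snd A) = 1"
    using assms bezout_int[of "fst B - fst A" "snd B - snd A"] unfolding primitive_def
    by (metis coprime_iff_gcd_eq_1)
  hence "orient A B (fst A - y, snd A + x) = 1" by (simp add: orient_def algebra_simps)
  thus ?thesis using that by blast
qed

text \<open>The lattice points with \<open>orient A B C = 1\<close> form a row \<open>C\<^sub>j\<close>, \<open>j \<in> \<int>\<close>, with steps \<open>B - A\<close>. An edge of the triangulation
  that traverses the strip between this row and \<open>AB\<close> passes on the side of \<open>A\<close> or on the side of \<open>B\<close>; in the first case it
  obstructs all \<open>C\<^sub>j\<close> on its left, in the second case all \<open>C\<^sub>j\<close> on its right. Take the least \<open>j\<close> with \<open>C\<^sub>j\<close> in the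
  grid that no edge of the first kind obstructs. If an edge of the second kind obstructed it, this edge would
  cross the one that obstructs \<open>C\<^bsub>j-1\<^esub>\<close> (lemma \<open>strip_edges_cross\<close>). So nothing crosses \<open>AC\<^sub>j\<close> or \<open>BC\<^sub>j\<close>,
  and maximality applies.\<close>

lemma triangulation_apex:
  assumes \<sigma>: "full_triangulation m n \<sigma>" and AB: "seg A B \<in> \<sigma>" and V: "V \<in> grid m n" "orient A B V > 0"
  obtains C where "C \<in> grid m n" "orient A B C = 1" "seg A C \<in> \<sigma>" "seg B C \<in> \<sigma>"
proof -
  note AB' = triangulation_seg[OF \<sigma> AB]
  obtain C0 where C0: "orient A B C0 = 1" using primitive_apex[OF AB'(3)] .
  define pt where "pt j = (fst C0 + j * (fst B - fst A), snd C0 + j * (snd B - snd A))" for j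
  have o_pt: "orient A B (pt j) = 1" for j
    using C0 by (simp add: pt_def orient_def algebra_simps)
  have shift: "orient P Q (pt j) = orient P Q (pt i) - (j - i) * (orient A B Q - orient A B P)" for P Q i j
    by (simp add: pt_def orient_def algebra_simps)
  have pt_add: "pt (j - 1) + B - A = pt j" for j
    by (simp add: pt_def prod_eq_iff algebra_simps)
  define J where "J = {j. pt j \<in> grid m n}"
  have "inj pt" using primitive_not_eq[OF AB'(3)] by (auto simp: inj_def pt_def prod_eq_iff)
  hence finJ: "finite J" unfolding J_def using finite_vimageI[OF finite_grid] by (simp add: vimage_def)
  \<comment> \<open>The triangle with base \<open>AB\<close> and apex \<open>Q\<close> contains some \<open>C\<^sub>j\<close>, obtained by division with remainder \<open>r\<close>; the
    equation writes it as a convex combination of \<open>Q\<close>, \<open>B\<close> and \<open>A\<close> and is applied to affine functions.\<close>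
  have quot: "\<exists>j\<in>J. \<exists>r. 0 \<le> r \<and> r \<le> orient A B Q - 1 \<and> (\<forall>P R. orient A B Q * orient P R (pt j) =
      orient P R Q + r * orient P R B + (orient A B Q - 1 - r) * orient P R A)"
    if Q: "Q \<in> grid m n" "orient A B Q \<ge> 1" for Q
  proof -
    define d b where "d = orient A B Q" and "b = orient C0 A Q"
    define h j r where "h = (- b) div d" and "j = - h" and "r = (- b) mod d"
    have d: "d \<ge> 1" using Q by (simp add: d_def)
    have r: "0 \<le> r" "r \<le> d - 1" using d by (simp_all add: r_def zle_diff1_eq)
    have "d * h + r = - b" unfolding h_def r_def by (rule mult_div_mod_eq)
    hence rj: "r = d * j - b" by (simp add: j_def)
    have a: "orient B C0 Q = 1 - b - d" using orient_bary_sum[of B C0 Q A] C0 by (simp add: b_def d_def)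
    have 1: "d * fst (pt j) = fst Q + r * fst B + (d - 1 - r) * fst A"
      unfolding rj by (subst orient_bary(4)[OF C0, of Q], fold d_def b_def, unfold a) (simp add: pt_def algebra_simps)
    have 2: "d * snd (pt j) = snd Q + r * snd B + (d - 1 - r) * snd A"
      unfolding rj by (subst orient_bary(5)[OF C0, of Q], fold d_def b_def, unfold a) (simp add: pt_def algebra_simps)
    have "pt j \<in> grid m n"
      using convex_bounds[OF d r 1] convex_bounds[OF d r 2] Q(1) AB' by (auto simp: grid_iff)
    moreover have "d * orient P R (pt j) = orient P R Q + r * orient P R B + (d - 1 - r) * orient P R A" for P R
    proof -
      have "d * orient P R (pt j) = (fst R - fst P) * (d * snd (pt j) - d * snd P) - (snd R - snd P) * (d * fst (pt j) - d * fst P)"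
        by (simp add: orient_def algebra_simps)
      thus ?thesis unfolding 1 2 by (simp add: orient_def algebra_simps)
    qed
    ultimately show ?thesis using r unfolding J_def d_def by blast
  qed
  define up where "up P Q \<longleftrightarrow> seg P Q \<in> \<sigma> \<and> orient A B P \<le> 0 \<and> orient A B Q \<ge> 1" for P Q
  \<comment> \<open>Edges of the first kind have both \<open>A\<close> and \<open>B\<close> weakly on their right, those of the second kind on their left.\<close>
  define badL where "badL j \<longleftrightarrow> (\<exists>P Q. up P Q \<and> orient P Q A \<le> 0 \<and> orient P Q B \<le> 0 \<and> orient P Q (pt j) > 0)" for j
  define badR where "badR j \<longleftrightarrow> (\<exists>P Q. up P Q \<and> orient P Q A \<ge> 0 \<and> orient P Q B \<ge> 0 \<and> orient P Q (pt j) < 0)" for j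
  have quot_sign: "\<exists>j\<in>J. (orient P Q A \<le> 0 \<and> orient P Q B \<le> 0 \<longrightarrow> orient P Q (pt j) \<le> 0) \<and>
      (orient P Q A \<ge> 0 \<and> orient P Q B \<ge> 0 \<longrightarrow> orient P Q (pt j) \<ge> 0)" if "up P Q" for P Q
  proof -
    let ?d = "orient A B Q"
    have "Q \<in> grid m n" "?d \<ge> 1" using that triangulation_seg(2)[OF \<sigma>, of P Q] by (simp_all add: up_def)
    from quot[OF this] obtain j r where j: "j \<in> J" "0 \<le> r" "r \<le> ?d - 1"
      "?d * orient P Q (pt j) = orient P Q Q + r * orient P Q B + (?d - 1 - r) * orient P Q A" by blast
    have "orient P Q Q = 0" by (simp add: orient_def)
    hence e: "?d * orient P Q (pt j) = r * orient P Q B + (?d - 1 - r) * orient P Q A" using j by simp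
    have "orient P Q (pt j) \<le> 0" if "orient P Q A \<le> 0" "orient P Q B \<le> 0"
    proof -
      have "r * orient P Q B \<le> 0" "(?d - 1 - r) * orient P Q A \<le> 0"
        using that j by (simp_all add: mult_nonneg_nonpos)
      hence "?d * orient P Q (pt j) \<le> 0" using e by linarith
      thus ?thesis using \<open>?d \<ge> 1\<close> by (simp add: mult_le_0_iff)
    qed
    moreover have "orient P Q (pt j) \<ge> 0" if "orient P Q A \<ge> 0" "orient P Q B \<ge> 0"
    proof -
      have "r * orient P Q B \<ge> 0" "(?d - 1 - r) * orient P Q A \<ge> 0"
        using that j by simp_all
      hence "?d * orient P Q (pt j) \<ge> 0" using e by linarith
      thus ?thesis using \<open>?d \<ge> 1\<close> by (simp add: zero_le_mult_iff)
    qed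
    ultimately show ?thesis using j by blast
  qed
  have Jne: "J \<noteq> {}" using quot[of V] V by auto
  define G where "G = {j \<in> J. \<not> badL j}"
  have "\<not> badL (Max J)"
  proof
    assume "badL (Max J)"
    then obtain P Q where PQ: "up P Q" "orient P Q A \<le> 0" "orient P Q B \<le> 0" "orient P Q (pt (Max J)) > 0"
      unfolding badL_def by blast
    obtain j where j: "j \<in> J" "orient P Q (pt j) \<le> 0" using quot_sign[OF PQ(1)] PQ by blast
    have "j \<le> Max J" using j finJ by simp
    hence "(Max J - j) * (orient A B Q - orient A B P) \<ge> 0" using PQ(1) by (simp add: up_def)
    thus False using shift[of P Q "Max J" j] PQ j by linarith
  qed
  hence Gne: "G \<noteq> {}" and finG: "finite G" using Jne finJ unfolding G_def by (auto intro: Max_in)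
  define k where "k = Min G"
  have kG: "k \<in> G" using Gne finG by (simp add: k_def)
  have kJ: "k \<in> J" and kL: "\<not> badL k" using kG by (simp_all add: G_def)
  have kR: "\<not> badR k"
  proof
    assume "badR k"
    then obtain P' Q' where PQ': "up P' Q'" "orient P' Q' A \<ge> 0" "orient P' Q' B \<ge> 0" "orient P' Q' (pt k) < 0"
      unfolding badR_def by blast
    obtain j where j: "j \<in> J" "orient P' Q' (pt j) \<ge> 0" using quot_sign[OF PQ'(1)] PQ' by blast
    have "j < k"
    proof (rule ccontr)
      assume "\<not> j < k"
      hence "(j - k) * (orient A B Q' - orient A B P') \<ge> 0" using PQ'(1) by (simp add: up_def)
      thus False using shift[of P' Q' j k] PQ' j by linarith
    qed
    have between: "0 \<le> c + (k - 1) * u \<and> c + (k - 1) * u \<le> N"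
      if "0 \<le> c + k * u" "c + k * u \<le> N" "0 \<le> c + j * u" "c + j * u \<le> N" for c u N :: int
    proof (cases "u \<ge> 0")
      case True
      hence "j * u \<le> (k - 1) * u" "(k - 1) * u \<le> k * u" using \<open>j < k\<close> by (auto intro: mult_right_mono)
      thus ?thesis using that by linarith
    next
      case False
      hence "j * u \<ge> (k - 1) * u" "(k - 1) * u \<ge> k * u" using \<open>j < k\<close> by (auto intro: mult_right_mono_neg)
      thus ?thesis using that by linarith
    qed
    have "k - 1 \<in> J"
      using between[of "fst C0" "fst B - fst A" "int m"] between[of "snd C0" "snd B - snd A" "int n"] kJ j(1)
      unfolding J_def grid_iff pt_def by simp
    moreover have "k - 1 \<notin> G" using finG by (metis Min_le k_def not_less zle_diff1_eq order_refl)
    ultimately have "badL (k - 1)" by (simp add: G_def)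
    then obtain P Q where PQ: "up P Q" "orient P Q A \<le> 0" "orient P Q B \<le> 0" "orient P Q (pt (k - 1)) > 0"
      unfolding badL_def by blast
    have "pcross P Q P' Q'"
      using strip_edges_cross[OF o_pt[of "k - 1"]] PQ PQ' unfolding up_def pt_add by blast
    thus False using triangulation_not_pcross[OF \<sigma>] PQ(1) PQ'(1) unfolding up_def by blast
  qed
  define C where "C = pt k"
  have oC: "orient A B C = 1" by (simp add: C_def o_pt)
  have CG: "C \<in> grid m n" using kJ by (simp add: J_def C_def)
  have no: "\<not> (pcross A C P Q \<or> pcross B C P Q)" if u: "up P Q" for P Q
  proof -
    have PQ: "seg P Q \<in> \<sigma>" "orient A B P \<le> 0" "orient A B Q \<ge> 1" using u by (auto simp: up_def)
    have diff: "orient P Q A - orient P Q B = orient A B Q - orient A B P"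
      by (simp add: orient_def algebra_simps)
    have "orient P Q A * orient P Q B \<ge> 0"
    proof (cases "orient A B P < 0")
      case True
      hence "orient A B P * orient A B Q < 0" using PQ by (simp add: mult_less_0_iff)
      thus ?thesis using triangulation_not_pcross[OF \<sigma> AB PQ(1)] by (simp add: pcross_def)
    next
      case False
      hence P0: "orient A B P = 0" using PQ by simp
      have s: "orient B C P = 1 - orient C A P" using orient_bary_sum[of B C P A] P0 oC by simp
      have "orient P Q A = orient C A P * orient A B Q" "orient P Q B = (orient C A P - 1) * orient A B Q"
        using orient_bary(1,2)[OF oC, of P Q] P0 s by (simp_all add: algebra_simps)
      hence "orient P Q A * orient P Q B = (orient C A P * (orient C A P - 1)) * (orient A B Q)\<^sup>2"
        by (simp add: power2_eq_square)
      moreover have "orient C A P * (orient C A P - 1) \<ge> 0"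
        by (cases "orient C A P \<ge> 1") (auto intro: mult_nonpos_nonpos)
      ultimately show ?thesis by simp
    qed
    hence "(orient P Q A \<le> 0 \<and> orient P Q B \<le> 0) \<or> (orient P Q A \<ge> 0 \<and> orient P Q B \<ge> 0)"
      by (auto simp: zero_le_mult_iff)
    thus ?thesis
    proof
      assume *: "orient P Q A \<le> 0 \<and> orient P Q B \<le> 0"
      hence "orient P Q C \<le> 0" using kL u unfolding badL_def C_def by (metis linorder_not_le)
      thus ?thesis using * unfolding pcross_def by (auto simp: mult_less_0_iff)
    next
      assume *: "orient P Q A \<ge> 0 \<and> orient P Q B \<ge> 0"
      hence "orient P Q C \<ge> 0" using kR u unfolding badR_def C_def by (metis linorder_not_le)
      thus ?thesis using * unfolding pcross_def by (auto simp: mult_less_0_iff)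
    qed
  qed
  have no': "\<not> (pcross A C P Q \<or> pcross B C P Q)" if PQ: "seg P Q \<in> \<sigma>" for P Q
  proof
    assume x: "pcross A C P Q \<or> pcross B C P Q"
    have "up P Q \<or> up Q P" using strip_crossing[OF oC x] PQ by (auto simp: up_def seg_commute)
    thus False using no[of P Q] no[of Q P] x pcross_swap(2) by blast
  qed
  have "orient A C B = -1" "orient B C A = 1" using oC by (simp_all add: orient_def algebra_simps)
  hence pr: "primitive A C" "primitive B C" using orient_unit_primitive[of A C B] orient_unit_primitive[of B C A] by simp_all
  have "seg A C \<in> \<sigma>" "seg B C \<in> \<sigma>"
    using triangulation_maximal[OF \<sigma> _ CG] AB' pr no' by blast+
  thus ?thesis using that CG oC by blast
qed

text \<open>For two apexes \<open>C \<noteq> D\<close> on the same side of \<open>AB\<close>, either \<open>AD\<close> and \<open>BC\<close> or \<open>AC\<close> and \<open>BD\<close> cross.\<close>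

lemma apex_unique:
  assumes \<sigma>: "full_triangulation m n \<sigma>" and T: "orient A B C = 1" "orient A B D = 1"
    and S: "seg A C \<in> \<sigma>" "seg B C \<in> \<sigma>" "seg A D \<in> \<sigma>" "seg B D \<in> \<sigma>"
  shows "C = D"
proof -
  have pos: "orient C A D \<le> 0"
    if T: "orient A B C = 1" "orient A B D = 1" and S: "seg B C \<in> \<sigma>" "seg A D \<in> \<sigma>" for C D
  proof (rule ccontr)
    assume j: "\<not> orient C A D \<le> 0"
    have v: "orient C A A = 0" "orient A B A = 0" "orient C A B = 1" "orient A B B = 0" "orient C A C = 0"
      using T by (simp_all add: orient_def algebra_simps)
    note co = orient_coords[OF T(1)]
    have "orient A D B * orient A D C < 0" "orient B C A * orient B C D < 0"
      unfolding co[of A D] co[of B C] v T using j by (simp_all add: mult_less_0_iff)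
    hence "pcross A D B C" by (simp add: pcross_def)
    thus False using triangulation_not_pcross[OF \<sigma> S(2,1)] by blast
  qed
  have "orient C A D = - orient D A C" by (simp add: orient_def algebra_simps)
  hence 0: "orient C A D = 0" using pos[OF T S(2,3)] pos[OF T(2,1) S(4,1)] by linarith
  have "orient B C D = 0" using orient_bary_sum[of B C D A] 0 T by simp
  thus "C = D" using orient_bary(4,5)[OF T(1), of D] 0 T(2) by (simp add: prod_eq_iff)
qed

section \<open>Midpoints of the edges of a triangulation\<close>

text \<open>Two edges with the same midpoint cross, so a noncrossing set is maximal as soon as it uses all midpoints.\<close>

lemma full_triangulation_if_midpoints:
  assumes "noncrossing m n S" "full_triangulation m n \<sigma>" "edge_midpoint ` \<sigma> \<subseteq> edge_midpoint ` S"
    and cover: "\<And>e. is_edge m n e \<Longrightarrow> edge_midpoint e \<in> edge_midpoint ` \<sigma>"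
    and same: "\<And>e f. is_edge m n e \<Longrightarrow> is_edge m n f \<Longrightarrow> edge_midpoint e = edge_midpoint f \<Longrightarrow> \<not> cross e f \<Longrightarrow> e = f"
  shows "full_triangulation m n S"
  unfolding full_triangulation_def
proof (intro conjI allI impI)
  fix R assume R: "noncrossing m n R \<and> S \<subseteq> R"
  have "e \<in> S" if e: "e \<in> R" for e
  proof -
    have ee: "is_edge m n e" using R e by (simp add: noncrossing_def)
    then obtain f where f: "f \<in> S" "edge_midpoint f = edge_midpoint e"
      using cover[of e] assms(3) by (metis (no_types, lifting) image_iff subsetD)
    hence "f \<in> R" using R by blast
    hence "e = f" using same[OF ee, of f] R f e by (simp add: noncrossing_def)
    thus ?thesis using f by simp
  qed
  thus "R = S" using R by blast
qed (use assms in simp)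

lemma cross_if_same_midpoint:
  assumes "is_edge m n e" "is_edge m n f" "edge_midpoint e = edge_midpoint f" "\<not> cross e f"
  shows "e = f"
proof (rule ccontr)
  assume ne: "e \<noteq> f"
  obtain A B where e: "e = seg A B" "primitive A B" using is_edge_obtain[OF assms(1)] by metis
  obtain C D where f: "f = seg C D" "primitive C D" using is_edge_obtain[OF assms(2)] by metis
  let ?z = "midpoint (emb A) (emb B)"
  have z: "?z = midpoint (emb C) (emb D)"
    using assms(3) by (simp add: e f seg_def edge_midpoint_segment)
  have "?z \<in> e" by (simp add: e seg_def midpoint_in_closed_segment)
  moreover have "?z \<in> f" unfolding z by (simp add: f seg_def midpoint_in_closed_segment)
  moreover have "?z \<notin> endpoints e"
    using primitive_not_eq[OF e(2)] by (simp add: e endpoints_seg midpoint_eq_endpoint)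
  ultimately have "cross e f" using ne by (auto simp: cross_def)
  thus False using assms(4) by simp
qed

lemma is_edge_midpoint_in_midpoints:
  assumes "is_edge m n e"
  shows "edge_midpoint e \<in> midpoints m n"
proof -
  obtain A B where e: "e = seg A B" "A \<in> grid m n" "B \<in> grid m n" "primitive A B"
    using is_edge_obtain[OF assms] by metis
  have "edge_midpoint e \<in> seg A B"
    by (simp add: e seg_def edge_midpoint_segment midpoint_in_closed_segment)
  moreover have "edge_midpoint e \<notin> {emb A, emb B}"
    using primitive_not_eq[OF e(4)] by (simp add: e seg_def edge_midpoint_segment midpoint_eq_endpoint)
  ultimately have "edge_midpoint e \<notin> \<int> \<times> \<int>"
    unfolding seg_lattice_points[OF e(4), symmetric] by (metis IntI)
  hence 1: "edge_midpoint e \<notin> lattice_pts m n" by (auto simp: lattice_pts_def)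
  have "edge_midpoint e = (real (nat (fst A + fst B)) / 2, real (nat (snd A + snd B)) / 2)"
    using e by (simp add: edge_midpoint_seg grid_iff)
  moreover have "nat (fst A + fst B) \<le> 2 * m" "nat (snd A + snd B) \<le> 2 * n"
    using e by (auto simp: grid_iff)
  ultimately show ?thesis using 1 unfolding midpoints_def by blast
qed

text \<open>The midpoint in question is \<open>(V + W) / 2\<close> for opposite corners \<open>V\<close>, \<open>W\<close> of a unit square or ends of a unit edge.
  Descend from it along a line that is tilted so slightly that it misses all grid points, and let \<open>AB\<close> be
  the first edge that is met below. The line leaves the triangle \<open>ABC\<close> above \<open>AB\<close> through a
  second side. By the choice of \<open>AB\<close> the midpoint is not above this side, and it is not in the open
  triangle, where its barycentric coordinates would be three positive multiples of \<open>1 / 2\<close> with sum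
  \<open>1\<close>. So it lies on the second side, and it can only be the midpoint of it.\<close>

lemma midpoint_covered_int:
  assumes \<sigma>: "full_triangulation m n \<sigma>" and VW: "V \<in> grid m n" "W \<in> grid m n"
    and d: "fst W - fst V \<in> {0, 1}" "snd W - snd V \<in> {0, 1}" "V \<noteq> W"
  shows "\<exists>B C. seg B C \<in> \<sigma> \<and> B + C = V + W"
proof -
  \<comment> \<open>The level lines of \<open>l\<close> have slope \<open>-M\<close>, and \<open>M\<close> exceeds all differences of doubled heights in the grid; \<open>o2 A B\<close>
    and \<open>x\<close> are the doubled values of \<open>orient A B\<close> and \<open>l\<close> at the midpoint.\<close>
  define M where "M = 2 * int n + 1"
  define l where "l X = M * fst X + snd X" for X :: "int \<times> int"
  define x where "x = l V + l W"
  define o2 where "o2 A B = orient A B V + orient A B W" for A B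
  have odd: "odd (fst V + fst W) \<or> odd (snd V + snd W)"
  proof -
    have "fst V + fst W = 2 * fst V + (fst W - fst V)" "snd V + snd W = 2 * snd V + (snd W - snd V)" by simp_all
    moreover have "fst W - fst V = 1 \<or> snd W - snd V = 1" using d by (auto simp: prod_eq_iff)
    ultimately show ?thesis by (metis even_add even_mult_iff odd_one even_numeral)
  qed
  have generic: "2 * l X \<noteq> x" if X: "X \<in> grid m n" for X
  proof
    assume "2 * l X = x"
    hence e: "M * (2 * fst X - (fst V + fst W)) = snd V + snd W - 2 * snd X"
      by (simp add: l_def x_def algebra_simps)
    have b: "\<bar>snd V + snd W - 2 * snd X\<bar> < M" using X VW by (auto simp: grid_iff M_def)
    have "2 * fst X - (fst V + fst W) = 0"
    proof (rule ccontr)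
      assume "2 * fst X - (fst V + fst W) \<noteq> 0"
      hence "M * 1 \<le> \<bar>M\<bar> * \<bar>2 * fst X - (fst V + fst W)\<bar>" by (intro mult_mono) auto
      thus False using e b by (simp add: abs_mult)
    qed
    moreover from this have "snd V + snd W = 2 * snd X" using e by simp
    ultimately have "fst V + fst W = 2 * fst X" "snd V + snd W = 2 * snd X" by simp_all
    thus False using odd by simp
  qed
  have on_edge: "P + Q = V + W"
    if h: "seg P Q \<in> \<sigma>" "2 * l P < x" "x < 2 * l Q" "o2 P Q = 0" for P Q
  proof -
    have "orient P Q (V + W - P) = o2 P Q" by (simp add: o2_def orient_def algebra_simps)
    then obtain t where t: "fst (V + W - P) = fst P + t * (fst Q - fst P)" "snd (V + W - P) = snd P + t * (snd Q - snd P)"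
      using collinear_primitive[OF triangulation_seg(3)[OF \<sigma> h(1)]] h(4) by metis
    have "x - l P = M * fst (V + W - P) + snd (V + W - P)" by (simp add: x_def l_def algebra_simps)
    also have "\<dots> = l P + t * (l Q - l P)" unfolding t by (simp add: l_def algebra_simps)
    finally have e: "x - 2 * l P = t * (l Q - l P)" by simp
    define k where "k = l Q - l P"
    have k: "0 < t * k" "t * k < 2 * k" "k > 0" using h e by (simp_all add: k_def)
    have "t = 1" using k by (simp add: zero_less_mult_iff)
    hence "fst (V + W - P) = fst Q" "snd (V + W - P) = snd Q" using t by simp_all
    thus ?thesis by (auto simp: prod_eq_iff)
  qed
  consider "snd V = 0" "snd W = 0" | "fst V = int m" "fst W = int m"
    | "snd V + snd W > 0" "fst V < int m"
    using d VW by (fastforce simp: grid_iff)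
  thus ?thesis
  proof cases
    case 1
    hence VW1: "fst W = fst V + 1" using d by (auto simp: prod_eq_iff)
    have "seg V W \<in> \<sigma>"
    proof (rule triangulation_maximal[OF \<sigma> VW])
      show "primitive V W" using 1 VW1 by (simp add: primitive_def)
      show "\<not> pcross V W P Q" if "seg P Q \<in> \<sigma>" for P Q
        using 1 VW1 triangulation_seg(1,2)[OF \<sigma> that] by (auto simp: pcross_def orient_def grid_iff mult_less_0_iff)
    qed
    thus ?thesis by blast
  next
    case 2
    hence VW1: "snd W = snd V + 1" using d by (auto simp: prod_eq_iff)
    have "seg V W \<in> \<sigma>"
    proof (rule triangulation_maximal[OF \<sigma> VW])
      show "primitive V W" using 2 VW1 by (simp add: primitive_def)
      show "\<not> pcross V W P Q" if "seg P Q \<in> \<sigma>" for P Q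
        using 2 VW1 triangulation_seg(1,2)[OF \<sigma> that] by (auto simp: pcross_def orient_def grid_iff mult_less_0_iff)
    qed
    thus ?thesis by blast
  next
    case 3
    define E where "E = {(A, B). seg A B \<in> \<sigma> \<and> 2 * l A < x \<and> x < 2 * l B \<and> o2 A B > 0}"
    \<comment> \<open>\<open>f (A, B)\<close> is the distance from the midpoint down to \<open>AB\<close>, up to a constant factor, measured along the level
      line of \<open>l\<close>.\<close>
    define f where "f = (\<lambda>(A, B). of_int (o2 A B) / of_int (l B - l A) :: real)"
    have finE: "finite E"
      by (rule finite_subset[of _ "grid m n \<times> grid m n"])
        (use triangulation_seg[OF \<sigma>] in \<open>auto simp: E_def finite_grid\<close>)
    \<comment> \<open>The bottom edge below the midpoint shows that there is an edge to choose from.\<close>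
    let ?A = "(fst V, 0)" and ?B = "(fst V + 1, 0)"
    have AB0: "?A \<in> grid m n" "?B \<in> grid m n" using VW 3 by (auto simp: grid_iff)
    have "seg ?A ?B \<in> \<sigma>"
    proof (rule triangulation_maximal[OF \<sigma> AB0])
      show "primitive ?A ?B" by (simp add: primitive_def)
      show "\<not> pcross ?A ?B P Q" if "seg P Q \<in> \<sigma>" for P Q
        using triangulation_seg(1,2)[OF \<sigma> that] by (auto simp: pcross_def orient_def grid_iff mult_less_0_iff)
    qed
    moreover have "2 * l ?A < x"
    proof -
      have "M * (2 * fst V) \<le> M * (fst V + fst W)" using d by (intro mult_left_mono) (auto simp: M_def)
      thus ?thesis using 3 by (simp add: x_def l_def algebra_simps)
    qed
    moreover have "x < 2 * l ?B"
    proof -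
      have "M * (fst V + fst W) \<le> M * (2 * fst V + 1)" using d by (intro mult_left_mono) (auto simp: M_def)
      moreover have "snd V + snd W < M" using VW by (auto simp: grid_iff M_def)
      ultimately show ?thesis by (simp add: x_def l_def algebra_simps)
    qed
    moreover have "o2 ?A ?B > 0" using 3 by (simp add: o2_def orient_def)
    ultimately have "(?A, ?B) \<in> E" by (simp add: E_def)
    hence "E \<noteq> {}" by blast
    then obtain A B where AB: "(A, B) \<in> E" and min: "\<And>p. p \<in> E \<Longrightarrow> f (A, B) \<le> f p"
      using ex_min_if_finite[of "f ` E"] finE
      by (metis (no_types, lifting) arg_min_if_finite(1) arg_min_least surj_pair)
    have S: "seg A B \<in> \<sigma>" "2 * l A < x" "x < 2 * l B" "o2 A B > 0" using AB by (simp_all add: E_def)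
    have "orient A B V > 0 \<or> orient A B W > 0" using S(4) unfolding o2_def by linarith
    then obtain C where C: "C \<in> grid m n" "orient A B C = 1" "seg A C \<in> \<sigma>" "seg B C \<in> \<sigma>"
      using triangulation_apex[OF \<sigma> S(1)] VW by metis
    define a b c where "a = o2 B C" and "b = o2 C A" and "c = o2 A B"
    have abc: "a + b + c = 2"
      using orient_bary_sum[of B C V A] orient_bary_sum[of B C W A] C(2) by (simp add: a_def b_def c_def o2_def)
    have bary: "x = a * l A + b * l B + c * l C"
    proof -
      have "l X = orient B C X * l A + orient C A X * l B + orient A B X * l C" for X
        using orient_bary(4,5)[OF C(2), of X] unfolding l_def by (simp add: algebra_simps)
      from this[of V] this[of W] show ?thesis
        by (simp add: x_def a_def b_def c_def o2_def algebra_simps)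
    qed
    have c0: "c \<ge> 1" using S(4) by (simp add: c_def)
    have swap: "o2 C B = - a" "o2 A C = - b"
      by (simp_all add: a_def b_def o2_def orient_def algebra_simps)
    consider "2 * l C < x" | "2 * l C > x" using generic[OF C(1)] by linarith
    thus ?thesis
    proof cases
      case 1
      consider "a < 0" | "a = 0" | "a > 0" by linarith
      thus ?thesis
      proof cases
        case a: 1
        have "(C, B) \<in> E" using a 1 S(3) C(4) swap by (simp add: E_def seg_commute)
        hence "f (A, B) \<le> f (C, B)" by (rule min)
        hence le: "of_int c / of_int (l B - l A) \<le> (of_int (- a) / of_int (l B - l C) :: real)"
          by (simp add: f_def c_def swap)
        have pos: "l B - l A > 0" "l B - l C > 0" using S 1 by linarith+
        have "of_int c * of_int (l B - l C) \<le> (of_int (- a) * of_int (l B - l A) :: real)"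
          using le pos by (simp add: divide_simps mult.commute del: of_int_diff of_int_minus)
        hence "c * (l B - l C) \<le> (- a) * (l B - l A)" by (simp only: flip: of_int_mult of_int_le_iff)
        moreover have "a * (l B - l A) + c * (l B - l C) = (a + b + c) * l B - x"
          unfolding bary by (simp add: algebra_simps)
        ultimately show ?thesis using S(3) abc by simp
      next
        case 2
        thus ?thesis using on_edge[of C B] C(4) 1 S(3) swap by (metis seg_commute neg_equal_0_iff_equal)
      next
        case a: 3
        hence "b \<le> 0" using abc c0 by linarith
        have "2 * x = a * (2 * l A) + b * (2 * l B) + c * (2 * l C)" unfolding bary by (simp add: algebra_simps)
        moreover have "a * (2 * l A) < a * x" "c * (2 * l C) < c * x" using a c0 S 1 by (auto intro: mult_strict_left_mono)
        moreover have "b * (2 * l B) \<le> b * x" using \<open>b \<le> 0\<close> S by (intro mult_left_mono_neg) auto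
        moreover have "a * x + b * x + c * x = 2 * x" using abc by (metis distrib_right)
        ultimately show ?thesis by linarith
      qed
    next
      case 2
      consider "b < 0" | "b = 0" | "b > 0" by linarith
      thus ?thesis
      proof cases
        case b: 1
        have "(A, C) \<in> E" using b 2 S(2) C(3) swap by (simp add: E_def)
        hence "f (A, B) \<le> f (A, C)" by (rule min)
        hence le: "of_int c / of_int (l B - l A) \<le> (of_int (- b) / of_int (l C - l A) :: real)"
          by (simp add: f_def c_def swap)
        have pos: "l B - l A > 0" "l C - l A > 0" using S 2 by linarith+
        have "of_int c * of_int (l C - l A) \<le> (of_int (- b) * of_int (l B - l A) :: real)"
          using le pos by (simp add: divide_simps mult.commute del: of_int_diff of_int_minus)
        hence "c * (l C - l A) \<le> (- b) * (l B - l A)" by (simp only: flip: of_int_mult of_int_le_iff)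
        moreover have "b * (l B - l A) + c * (l C - l A) = x - (a + b + c) * l A"
          unfolding bary by (simp add: algebra_simps)
        ultimately show ?thesis using S(2) abc by simp
      next
        case b0: 2
        thus ?thesis using on_edge[of A C] C(3) 2 S(2) swap by (metis neg_equal_0_iff_equal)
      next
        case b: 3
        hence "a \<le> 0" using abc c0 by linarith
        have "2 * x = a * (2 * l A) + b * (2 * l B) + c * (2 * l C)" unfolding bary by (simp add: algebra_simps)
        moreover have "b * (2 * l B) > b * x" "c * (2 * l C) > c * x" using b c0 S 2 by (auto intro: mult_strict_left_mono)
        moreover have "a * (2 * l A) \<ge> a * x" using \<open>a \<le> 0\<close> S by (intro mult_left_mono_neg) auto
        moreover have "a * x + b * x + c * x = 2 * x" using abc by (metis distrib_right)
        ultimately show ?thesis by linarith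
      qed
    qed
  qed
qed

lemma triangulation_midpoint_exists:
  assumes \<sigma>: "full_triangulation m n \<sigma>" and x: "x \<in> midpoints m n"
  obtains e where "e \<in> \<sigma>" "edge_midpoint e = x"
proof -
  obtain i j where ij: "x = (real i / 2, real j / 2)" "i \<le> 2 * m" "j \<le> 2 * n" and nl: "x \<notin> lattice_pts m n"
    using x by (auto simp: midpoints_def)
  define V where "V = (int (i div 2), int (j div 2))"
  define W where "W = (int ((i + 1) div 2), int ((j + 1) div 2))"
  have VW: "V \<in> grid m n" "W \<in> grid m n" using ij by (auto simp: V_def W_def grid_iff)
  have sum: "fst V + fst W = int i" "snd V + snd W = int j" by (simp_all add: V_def W_def)
  have "V \<noteq> W"
  proof
    assume "V = W"
    hence "real i = 2 * of_int (fst V)" "real j = 2 * of_int (snd V)"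
      using sum by (metis mult_2 of_int_add of_int_of_nat_eq)+
    hence "x = emb V" using ij by (simp add: emb_def)
    thus False using nl VW by (simp add: lattice_pts_eq)
  qed
  moreover have "fst W - fst V \<in> {0, 1}" "snd W - snd V \<in> {0, 1}"
    by (simp_all add: V_def W_def) presburger+
  ultimately obtain B C where BC: "seg B C \<in> \<sigma>" "B + C = V + W"
    using midpoint_covered_int[OF \<sigma> VW] by blast
  have "fst B + fst C = int i" "snd B + snd C = int j"
    using BC(2) sum by (simp_all flip: fst_add snd_add)
  hence "edge_midpoint (seg B C) = x" unfolding edge_midpoint_seg ij by simp
  thus ?thesis using that BC by blast
qed

lemma triangulation_midpoint_unique:
  assumes "full_triangulation m n \<sigma>" "e \<in> \<sigma>" "f \<in> \<sigma>" "edge_midpoint e = edge_midpoint f"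
  shows "e = f"
  using cross_if_same_midpoint triangulation_is_edge triangulation_not_cross assms by metis

lemma triangulation_bij_midpoints:
  assumes "full_triangulation m n \<sigma>"
  shows "bij_betw edge_midpoint \<sigma> (midpoints m n)"
  unfolding bij_betw_def
proof
  show "inj_on edge_midpoint \<sigma>"
    using triangulation_midpoint_unique[OF assms] by (auto intro: inj_onI)
  show "edge_midpoint ` \<sigma> = midpoints m n"
    using triangulation_midpoint_exists[OF assms] is_edge_midpoint_in_midpoints triangulation_is_edge[OF assms]
    by (metis image_eqI image_subset_iff subset_antisym subsetI)
qed

lemma edge_at_midpoint:
  assumes "full_triangulation m n \<sigma>" "e \<in> \<sigma>"
  shows "edge_at \<sigma> (edge_midpoint e) = e"
  unfolding edge_at_def using assms triangulation_midpoint_unique[OF assms(1)] by (intro the_equality) auto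

lemma edge_at_in:
  assumes "full_triangulation m n \<sigma>" "x \<in> midpoints m n"
  shows "edge_at \<sigma> x \<in> \<sigma>" "edge_midpoint (edge_at \<sigma> x) = x"
  using triangulation_midpoint_exists[OF assms] edge_at_midpoint[OF assms(1)] by metis+

lemma total_length_sum:
  assumes "full_triangulation m n \<sigma>"
  shows "total_length m n \<sigma> = (\<Sum>e\<in>\<sigma>. l1_length e)"
proof -
  have "(\<Sum>e\<in>\<sigma>. l1_length e) = (\<Sum>e\<in>\<sigma>. l1_length (edge_at \<sigma> (edge_midpoint e)))"
    using edge_at_midpoint[OF assms] by simp
  also have "\<dots> = (\<Sum>x\<in>midpoints m n. l1_length (edge_at \<sigma> x))"
    by (rule sum.reindex_bij_betw[OF triangulation_bij_midpoints[OF assms]])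
  finally show ?thesis by (simp add: total_length_def)
qed

lemma triangulation_subset:
  assumes "full_triangulation m n \<sigma>"
  shows "\<sigma> \<subseteq> case_prod seg ` (grid m n \<times> grid m n)"
proof
  fix e assume "e \<in> \<sigma>"
  then obtain A B where "e = case_prod seg (A, B)" "(A, B) \<in> grid m n \<times> grid m n"
    using triangulation_edge[OF assms] by (metis SigmaI case_prod_conv)
  thus "e \<in> case_prod seg ` (grid m n \<times> grid m n)" by (rule image_eqI)
qed

lemma finite_triangulation: "full_triangulation m n \<sigma> \<Longrightarrow> finite \<sigma>"
  by (rule finite_subset[OF triangulation_subset]) (simp_all add: finite_grid)

lemma finite_Omega: "finite (Omega m n \<eta> \<Delta>)"
proof (rule finite_subset)
  show "Omega m n \<eta> \<Delta> \<subseteq> Pow (case_prod seg ` (grid m n \<times> grid m n))"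
  proof
    fix \<sigma> assume "\<sigma> \<in> Omega m n \<eta> \<Delta>"
    hence "full_triangulation m n \<sigma>" by (simp add: Omega_def)
    thus "\<sigma> \<in> Pow (case_prod seg ` (grid m n \<times> grid m n))" by (intro PowI triangulation_subset)
  qed
qed (simp add: finite_grid)

section \<open>Flips\<close>

text \<open>An edge other than \<open>AB\<close> that crosses \<open>CD\<close> enters the unimodular triangles \<open>CDA\<close> and \<open>CDB\<close> through their
  common side. It cannot leave them through the sides of the parallelogram, hence it ends at \<open>A\<close> and \<open>B\<close>.\<close>

lemma flip:
  assumes \<sigma>: "full_triangulation m n \<sigma>" and T: "orient A B C = 1" and D: "D = A + B - C"
    and S: "seg A B \<in> \<sigma>" "seg A C \<in> \<sigma>" "seg B C \<in> \<sigma>" "seg A D \<in> \<sigma>" "seg B D \<in> \<sigma>"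
  shows "full_triangulation m n (insert (seg C D) (\<sigma> - {seg A B}))" (is ?full)
    and "\<And>f. f \<in> \<sigma> \<Longrightarrow> f \<noteq> seg A B \<Longrightarrow> \<not> cross (seg C D) f"
    and "edge_midpoint (seg C D) = edge_midpoint (seg A B)"
    and "seg C D \<notin> \<sigma>"
proof -
  have T1: "\<bar>orient C D A\<bar> = 1" "\<bar>orient C D B\<bar> = 1"
    using T unfolding D by (simp_all add: orient_def algebra_simps)
  have prim: "primitive C D" using orient_unit_primitive[OF T1(1)] .
  have AB: "A \<noteq> B" using primitive_not_eq[OF triangulation_seg(3)[OF \<sigma> S(1)]] .
  show nc: "\<not> cross (seg C D) f" if f: "f \<in> \<sigma>" "f \<noteq> seg A B" for f
  proof
    assume x: "cross (seg C D) f"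
    obtain P Q where PQ: "f = seg P Q" "primitive P Q" using triangulation_edge[OF \<sigma> f(1)] by metis
    hence px: "pcross C D P Q" using x cross_seg_iff[OF prim PQ(2)] by simp
    have n: "\<not> pcross A C P Q" "\<not> pcross B C P Q" "\<not> pcross A D P Q" "\<not> pcross B D P Q"
      using triangulation_not_pcross[OF \<sigma>] S f PQ(1) by auto
    have "A = P \<or> A = Q" "B = P \<or> B = Q"
      using exit_triangle[OF T1(1) PQ(2) px] exit_triangle[OF T1(2) PQ(2) px] n pcross_swap(1) by blast+
    thus False using AB f(2) PQ(1) by (auto simp: seg_commute)
  qed
  show mid: "edge_midpoint (seg C D) = edge_midpoint (seg A B)"
    by (simp add: edge_midpoint_seg_eq_iff D)
  have "seg C D \<noteq> seg A B" using T by (auto simp: seg_eq_iff orient_def)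
  thus "seg C D \<notin> \<sigma>"
    using triangulation_midpoint_unique[OF \<sigma> _ S(1) mid] by blast
  let ?\<tau> = "insert (seg C D) (\<sigma> - {seg A B})"
  have CD: "is_edge m n (seg C D)"
    using prim triangulation_seg(2)[OF \<sigma> S(2)] triangulation_seg(2)[OF \<sigma> S(4)] by (simp add: is_edge_seg_iff)
  have "noncrossing m n ?\<tau>"
    unfolding noncrossing_def
  proof (intro conjI ballI)
    show "is_edge m n e" if "e \<in> ?\<tau>" for e
      using that CD triangulation_is_edge[OF \<sigma>] by auto
    show "\<not> cross e f" if "e \<in> ?\<tau>" "f \<in> ?\<tau>" for e f
    proof (cases "e = f")
      case True
      thus ?thesis by (simp add: cross_def)
    next
      case False
      thus ?thesis using that nc triangulation_not_cross[OF \<sigma>] cross_commute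
        by (metis DiffE insertE singletonI)
    qed
  qed
  moreover have "edge_midpoint ` \<sigma> \<subseteq> edge_midpoint ` ?\<tau>"
    using mid by force
  moreover have "edge_midpoint e \<in> edge_midpoint ` \<sigma>" if "is_edge m n e" for e
    using is_edge_midpoint_in_midpoints[OF that] triangulation_bij_midpoints[OF \<sigma>] by (simp add: bij_betw_def)
  ultimately show ?full
    using full_triangulation_if_midpoints[OF _ \<sigma>] cross_if_same_midpoint by metis
qed

section \<open>Parallelograms and their diagonals\<close>

text \<open>Both \<open>x\<close> and \<open>x + j u\<close> lie between \<open>0\<close> and \<open>u\<close>.\<close>

lemma between_shift:
  fixes u x j :: int
  assumes "\<bar>u\<bar> = \<bar>x\<bar> + \<bar>u - x\<bar>" "\<bar>u\<bar> = \<bar>x + j * u\<bar> + \<bar>u - (x + j * u)\<bar>" "j \<ge> 1"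
  shows "x = 0"
proof -
  define w where "w = j * u"
  have "(j - 1) * u \<ge> 0 \<longleftrightarrow> u \<ge> 0 \<or> j = 1" using assms(3) by (auto simp: zero_le_mult_iff)
  hence "u \<ge> 0 \<and> w \<ge> u \<or> u \<le> 0 \<and> w \<le> u"
    using mult_left_mono[of 1 j u] mult_right_mono_neg[of 1 j u] assms(3) mult_right_mono[of 1 j u]
    by (cases "u \<ge> 0") (auto simp: w_def)
  thus ?thesis using assms(1,2) unfolding w_def[symmetric] by linarith
qed

lemma len_alt: "len A B = \<bar>fst B - fst A\<bar> + \<bar>snd B - snd A\<bar>"
  by (simp add: len_def abs_minus_commute)

lemma abs_components:
  fixes u1 u2 x1 x2 :: int
  assumes "\<bar>u1\<bar> + \<bar>u2\<bar> = \<bar>x1\<bar> + \<bar>x2\<bar> + (\<bar>u1 - x1\<bar> + \<bar>u2 - x2\<bar>)"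
  shows "\<bar>u1\<bar> = \<bar>x1\<bar> + \<bar>u1 - x1\<bar>" "\<bar>u2\<bar> = \<bar>x2\<bar> + \<bar>u2 - x2\<bar>"
proof -
  have add: "a = c \<and> b = d" if "a + b = c + d" "a \<le> c" "b \<le> d" for a b c d :: int
    using that by linarith
  have "\<bar>u1\<bar> \<le> \<bar>x1\<bar> + \<bar>u1 - x1\<bar>" "\<bar>u2\<bar> \<le> \<bar>x2\<bar> + \<bar>u2 - x2\<bar>" by linarith+
  from add[OF _ this] assms
  show "\<bar>u1\<bar> = \<bar>x1\<bar> + \<bar>u1 - x1\<bar>" "\<bar>u2\<bar> = \<bar>x2\<bar> + \<bar>u2 - x2\<bar>" by (simp_all add: ac_simps)
qed

text \<open>\<open>AB\<close> is the longest side iff the apex lies in the bounding box of \<open>AB\<close>. The apexes on one side of \<open>AB\<close> differ by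
  multiples of \<open>B - A\<close>, so two of them in the box would have to be \<open>A\<close> and \<open>B\<close>.\<close>

lemma longest_apex_unique:
  assumes T: "orient A B C = 1" "orient A B D = 1"
    and l: "len A B = len A C + len B C" "len A B = len A D + len B D"
  shows "C = D"
proof -
  have prim: "primitive A B" using orient_unit_primitive[of A B C] T by simp
  define u1 u2 x1 x2 where "u1 = fst B - fst A" and "u2 = snd B - snd A"
    and "x1 = fst C - fst A" and "x2 = snd C - snd A"
  have "orient A B (A + D - C) = orient A B D - orient A B C" by (simp add: orient_def algebra_simps)
  hence "orient A B (A + D - C) = 0" using T by simp
  then obtain j where "fst (A + D - C) = fst A + j * (fst B - fst A)" "snd (A + D - C) = snd A + j * (snd B - snd A)"
    using collinear_primitive[OF prim] by blast
  hence j: "fst D - fst A = x1 + j * u1" "snd D - snd A = x2 + j * u2"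
    by (simp_all add: u1_def u2_def x1_def x2_def)
  have l': "\<bar>u1\<bar> + \<bar>u2\<bar> = \<bar>x1\<bar> + \<bar>x2\<bar> + (\<bar>u1 - x1\<bar> + \<bar>u2 - x2\<bar>)"
    "\<bar>u1\<bar> + \<bar>u2\<bar> = \<bar>fst D - fst A\<bar> + \<bar>snd D - snd A\<bar>
       + (\<bar>u1 - (fst D - fst A)\<bar> + \<bar>u2 - (snd D - snd A)\<bar>)"
  proof -
    have "u1 - x1 = fst B - fst C" "u2 - x2 = snd B - snd C"
      "u1 - (fst D - fst A) = fst B - fst D" "u2 - (snd D - snd A) = snd B - snd D"
      by (simp_all add: u1_def u2_def x1_def x2_def)
    note e = this
    show "\<bar>u1\<bar> + \<bar>u2\<bar> = \<bar>x1\<bar> + \<bar>x2\<bar> + (\<bar>u1 - x1\<bar> + \<bar>u2 - x2\<bar>)"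
      using l(1) unfolding e unfolding u1_def u2_def x1_def x2_def len_alt[of A] len_def[of B] .
    show "\<bar>u1\<bar> + \<bar>u2\<bar> = \<bar>fst D - fst A\<bar> + \<bar>snd D - snd A\<bar>
       + (\<bar>u1 - (fst D - fst A)\<bar> + \<bar>u2 - (snd D - snd A)\<bar>)"
      using l(2) unfolding e unfolding u1_def u2_def len_alt[of A] len_def[of B] .
  qed
  note c = abs_components[OF l'(1)] and d = abs_components[OF l'(2), unfolded j]
  consider "j = 0" | "j \<ge> 1" | "- j \<ge> 1" by linarith
  thus ?thesis
  proof cases
    case 1
    thus ?thesis using j by (simp add: x1_def x2_def prod_eq_iff)
  next
    case 2
    have "x1 = 0" "x2 = 0" using between_shift[OF c(1) d(1) 2] between_shift[OF c(2) d(2) 2] by auto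
    hence "C = A" by (simp add: x1_def x2_def prod_eq_iff)
    thus ?thesis using T by (simp add: orient_def)
  next
    case 3
    have ret: "x1 + j * u1 + - j * u1 = x1" "x2 + j * u2 + - j * u2 = x2" by simp_all
    have "x1 + j * u1 = 0" by (rule between_shift[OF d(1) _ 3]) (simp only: ret c(1)[symmetric])
    moreover have "x2 + j * u2 = 0" by (rule between_shift[OF d(2) _ 3]) (simp only: ret c(2)[symmetric])
    ultimately have "fst D - fst A = 0" "snd D - snd A = 0" using j by simp_all
    hence "D = A" by (simp add: prod_eq_iff)
    thus ?thesis using T by (simp add: orient_def)
  qed
qed

lemma longest_both_sides_parallelogram:
  assumes T: "orient A B C = 1" "orient A B D = -1"
    and l: "len A B = len A C + len B C" "len A B = len A D + len B D"
  shows "D = A + B - C"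
proof -
  have "orient A B (A + B - D) = 1" using T(2) by (simp add: orient_def algebra_simps)
  moreover have "len A (A + B - D) = len B D" "len B (A + B - D) = len A D"
    by (simp_all add: len_def abs_minus_commute)
  ultimately have "C = A + B - D" using longest_apex_unique[OF T(1)] l by simp
  thus ?thesis by (simp add: prod_eq_iff)
qed

text \<open>In the triangle \<open>A\<close>, \<open>C\<close>, \<open>A + B - C\<close> the longest side is \<open>AC\<close> or the one of length \<open>|BC|\<close>: for it to be the short
  diagonal, \<open>C - A\<close> and \<open>B - C\<close> would have to be orthogonal unit vectors, and then \<open>|AB| = 2\<close>.\<close>

lemma short_diagonal_length:
  assumes T: "\<bar>orient A B C\<bar> = 1" and l: "len A B = len A C + len B C" "len A B \<ge> 3"
  shows "len C (A + B - C) = \<bar>len A C - len B C\<bar>" "len A C \<noteq> len B C"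
proof -
  let ?D = "A + B - C"
  have T': "\<bar>orient A C ?D\<bar> = 1" using T by (simp add: orient_def algebra_simps)
  have AD: "len A ?D = len B C" by (simp add: len_def abs_minus_commute)
  have "orient A C C = 0" by (simp add: orient_def)
  hence "C \<noteq> ?D" using T' by (metis abs_zero zero_neq_one)
  moreover have "A \<noteq> C" "B \<noteq> C" using T by (auto simp: orient_def)
  ultimately have pos: "len A C \<ge> 1" "len B C \<ge> 1" "len C ?D \<ge> 1" by (auto intro: len_pos)
  have no: "len C ?D \<noteq> len A C + len B C"
  proof
    assume a: "len C ?D = len A C + len B C"
    define u1 u2 v1 v2 where "u1 = fst C - fst A" and "u2 = snd C - snd A"
      and "v1 = fst B - fst C" and "v2 = snd B - snd C"
    have e: "\<bar>v1 - u1\<bar> + \<bar>v2 - u2\<bar> = \<bar>u1\<bar> + \<bar>u2\<bar> + (\<bar>v1\<bar> + \<bar>v2\<bar>)"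
      "\<bar>u1 + v1\<bar> + \<bar>u2 + v2\<bar> = \<bar>u1\<bar> + \<bar>u2\<bar> + (\<bar>v1\<bar> + \<bar>v2\<bar>)"
    proof -
      have d: "v1 - u1 = fst ?D - fst C" "v2 - u2 = snd ?D - snd C" "u1 + v1 = fst B - fst A" "u2 + v2 = snd B - snd A"
        by (simp_all add: u1_def u2_def v1_def v2_def)
      show "\<bar>v1 - u1\<bar> + \<bar>v2 - u2\<bar> = \<bar>u1\<bar> + \<bar>u2\<bar> + (\<bar>v1\<bar> + \<bar>v2\<bar>)"
        using a unfolding d unfolding u1_def u2_def v1_def v2_def len_alt[of C] len_alt[of A] len_def[of B] .
      show "\<bar>u1 + v1\<bar> + \<bar>u2 + v2\<bar> = \<bar>u1\<bar> + \<bar>u2\<bar> + (\<bar>v1\<bar> + \<bar>v2\<bar>)"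
        using l(1) unfolding d unfolding u1_def u2_def v1_def v2_def len_alt[of A] len_def[of B] .
    qed
    have "\<bar>v1 - u1\<bar> + \<bar>u1 + v1\<bar> = 2 * \<bar>u1\<bar> + 2 * \<bar>v1\<bar>" "\<bar>v2 - u2\<bar> + \<bar>u2 + v2\<bar> = 2 * \<bar>u2\<bar> + 2 * \<bar>v2\<bar>"
    proof -
      have tri: "\<bar>y - x\<bar> + \<bar>x + y\<bar> \<le> 2 * \<bar>x\<bar> + 2 * \<bar>y\<bar>" for x y :: int by linarith
      have add: "a = c \<and> b = d" if "a + b = c + d" "a \<le> c" "b \<le> d" for a b c d :: int
        using that by linarith
      from add[OF _ tri[of v1 u1] tri[of v2 u2]] e
      show "\<bar>v1 - u1\<bar> + \<bar>u1 + v1\<bar> = 2 * \<bar>u1\<bar> + 2 * \<bar>v1\<bar>" "\<bar>v2 - u2\<bar> + \<bar>u2 + v2\<bar> = 2 * \<bar>u2\<bar> + 2 * \<bar>v2\<bar>"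
        by (simp_all add: algebra_simps)
    qed
    hence "u1 = 0 \<or> v1 = 0" "u2 = 0 \<or> v2 = 0" by linarith+
    moreover have "\<bar>u1 * v2 - u2 * v1\<bar> = 1" using T by (simp add: orient_def u1_def u2_def v1_def v2_def algebra_simps)
    ultimately have "\<bar>u1 * v2\<bar> = 1 \<and> v1 = 0 \<and> u2 = 0 \<or> \<bar>u2 * v1\<bar> = 1 \<and> u1 = 0 \<and> v2 = 0"
      by auto
    hence "\<bar>u1\<bar> + \<bar>u2\<bar> + (\<bar>v1\<bar> + \<bar>v2\<bar>) = 2"
      using abs_zmult_eq_1[of u1 v2] abs_zmult_eq_1[of v2 u1] abs_zmult_eq_1[of u2 v1] abs_zmult_eq_1[of v1 u2]
      by (auto simp: mult.commute)
    moreover have "len A B = \<bar>u1\<bar> + \<bar>u2\<bar> + (\<bar>v1\<bar> + \<bar>v2\<bar>)"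
      using l(1) unfolding u1_def u2_def v1_def v2_def len_alt[of A] len_def[of B] .
    ultimately have "len A B = 2" by simp
    thus False using l by simp
  qed
  show "len C ?D = \<bar>len A C - len B C\<bar>"
    using triangle_longest[OF T'] no AD pos by linarith
  thus "len A C \<noteq> len B C" using pos by linarith
qed

text \<open>The end points are at least two apart in the direction across the unit edge, and a primitive segment of
  this kind is not parallel to an axis.\<close>

lemma cross_unit_edge:
  assumes "pcross A C P Q" "len A C = 1" "primitive P Q"
  shows "len P Q \<ge> 3"
proof -
  have o: "orient A C P * orient A C Q < 0" using assms by (simp add: pcross_def)
  have far: "\<bar>x - y\<bar> \<ge> 2" if "s * x * (s * y) < 0" for s x y :: int
  proof -
    have "x * y < 0"
    proof (rule ccontr)
      assume "\<not> x * y < 0"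
      hence "s\<^sup>2 * (x * y) \<ge> 0" by simp
      thus False using that by (simp add: power2_eq_square algebra_simps)
    qed
    thus ?thesis by (auto simp: mult_less_0_iff)
  qed
  have "fst A = fst C \<or> snd A = snd C" using assms(2) unfolding len_def by linarith
  thus ?thesis
  proof
    assume a: "fst A = fst C"
    have "\<bar>(fst P - fst A) - (fst Q - fst A)\<bar> \<ge> 2"
      using o by (intro far[of "snd C - snd A"]) (simp add: orient_def a)
    hence 2: "\<bar>fst Q - fst P\<bar> \<ge> 2" by simp
    have "snd Q - snd P \<noteq> 0"
    proof
      assume "snd Q - snd P = 0"
      hence "is_unit (fst Q - fst P)" using assms(3) by (simp add: primitive_def)
      thus False using 2 by auto
    qed
    thus ?thesis using 2 by (simp add: len_def)
  next
    assume a: "snd A = snd C"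
    have "\<bar>(snd P - snd A) - (snd Q - snd A)\<bar> \<ge> 2"
      using o by (intro far[of "fst C - fst A"]) (simp add: orient_def a)
    hence 2: "\<bar>snd Q - snd P\<bar> \<ge> 2" by simp
    have "fst Q - fst P \<noteq> 0"
    proof
      assume "fst Q - fst P = 0"
      hence "is_unit (snd Q - snd P)" using assms(3) by (simp add: primitive_def)
      thus False using 2 by auto
    qed
    thus ?thesis using 2 by (simp add: len_def)
  qed
qed

section \<open>Longest sides and shortening flips\<close>

text \<open>The relation along which weight is transported in the summation: each step leads to a strictly longer edge,
  and only boundedly many edges lead to the same one.\<close>

definition child :: "edge \<Rightarrow> edge \<Rightarrow> bool" where
  "child f h \<longleftrightarrow> (\<exists>A B C. h = seg A B \<and> f = seg A C \<and> \<bar>orient A B C\<bar> = 1 \<and> len A B = len A C + len B C)"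

lemma child_shorter: "child f h \<Longrightarrow> l1_length f + 1 \<le> l1_length h"
proof -
  assume "child f h"
  then obtain A B C where h: "h = seg A B" "f = seg A C" "\<bar>orient A B C\<bar> = 1" "len A B = len A C + len B C"
    unfolding child_def by blast
  have "B \<noteq> C" using h(3) by (auto simp: orient_def)
  hence "len A C + 1 \<le> len A B" using len_pos[of B C] h(4) by simp
  hence "real_of_int (len A C + 1) \<le> of_int (len A B)" by (simp only: of_int_le_iff)
  thus ?thesis by (simp add: h l1_length_seg)
qed

text \<open>By lemma \<open>longest_apex_unique\<close> at most two unimodular triangles have \<open>h\<close> as their longest side.\<close>

lemma card_children: "finite {f. child f h} \<and> card {f. child f h} \<le> 4"
proof (cases "{f. child f h} = {}")
  case False
  then obtain A B where h: "h = seg A B" unfolding child_def by blast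
  define K where "K s = {C. orient A B C = s \<and> len A B = len A C + len B C}" for s
  have K1: "C = D" if "C \<in> K 1" "D \<in> K 1" for C D
    using that longest_apex_unique[of A B C D] by (simp add: K_def)
  have K2: "C = D" if "C \<in> K (-1)" "D \<in> K (-1)" for C D
    using that longest_apex_unique[of B A C D] by (simp add: K_def orient_swap[of B A] len_commute[of B A])
  obtain C1 C2 where C: "K 1 \<subseteq> {C1}" "K (-1) \<subseteq> {C2}"
    using K1 K2 by (metis empty_subsetI insert_iff subsetI)
  have "{f. child f h} \<subseteq> {seg A C1, seg B C1, seg A C2, seg B C2}"
  proof
    fix f assume "f \<in> {f. child f h}"
    then obtain A' B' C where f: "h = seg A' B'" "f = seg A' C" "\<bar>orient A' B' C\<bar> = 1" "len A' B' = len A' C + len B' C"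
      unfolding child_def by blast
    have ab: "A' = A \<and> B' = B \<or> A' = B \<and> B' = A" using f(1) h by (auto simp: seg_eq_iff)
    hence "\<bar>orient A B C\<bar> = 1" "len A B = len A C + len B C"
      using f(3,4) by (auto simp: orient_swap[of B A] len_commute[of B A])
    hence "C \<in> K 1 \<or> C \<in> K (-1)" by (auto simp: K_def)
    hence "C = C1 \<or> C = C2" using C by blast
    thus "f \<in> {seg A C1, seg B C1, seg A C2, seg B C2}" using ab f(2) by blast
  qed
  moreover have "card {seg A C1, seg B C1, seg A C2, seg B C2} \<le> 4"
    using card_length[of "[seg A C1, seg B C1, seg A C2, seg B C2]"] by simp
  moreover have "finite {seg A C1, seg B C1, seg A C2, seg B C2}" by simp
  ultimately show ?thesis by (meson card_mono finite_subset order_trans)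
qed simp

text \<open>\<open>A + B - C\<close> is the fourth corner of the parallelogram; \<open>e\<close> is its long diagonal, being the longest side of both
  triangles. Flipping \<open>e\<close> to \<open>e'\<close> does not increase the length, and it decreases it unless the
  parallelogram is a unit square.\<close>

definition downflip :: "edge set \<Rightarrow> edge \<Rightarrow> edge \<Rightarrow> bool" where
  "downflip \<sigma> e e' \<longleftrightarrow> (\<exists>A B C. e = seg A B \<and> e' = seg C (A + B - C) \<and>
     orient A B C = 1 \<and> len A B = len A C + len B C \<and>
     {seg A B, seg A C, seg B C, seg A (A + B - C), seg B (A + B - C)} \<subseteq> \<sigma>)"

lemma two_apexes:
  assumes \<sigma>: "full_triangulation m n \<sigma>" and AB: "seg A B \<in> \<sigma>" and x: "pcross A B P Q"
    and PQ: "P \<in> grid m n" "Q \<in> grid m n"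
  obtains C D where "orient A B C = 1" "seg A C \<in> \<sigma>" "seg B C \<in> \<sigma>"
    "orient A B D = -1" "seg A D \<in> \<sigma>" "seg B D \<in> \<sigma>"
proof -
  have BA: "seg B A \<in> \<sigma>" using AB by (simp add: seg_commute)
  have "orient A B P * orient A B Q < 0" using x by (simp add: pcross_def)
  hence "\<exists>V\<in>grid m n. orient A B V > 0" "\<exists>V\<in>grid m n. orient B A V > 0"
    using PQ by (auto simp: mult_less_0_iff orient_swap[of B A])
  then obtain C D where "orient A B C = 1" "seg A C \<in> \<sigma>" "seg B C \<in> \<sigma>" "orient B A D = 1" "seg B D \<in> \<sigma>" "seg A D \<in> \<sigma>"
    using triangulation_apex[OF \<sigma> AB] triangulation_apex[OF \<sigma> BA] by metis
  thus ?thesis using that[of C D] by (simp add: orient_swap[of B A])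
qed

text \<open>Let \<open>e\<close> be an edge of a triangulation that \<open>g\<close> crosses. If \<open>e\<close> is the longest side of both adjacent triangles, then
  it can be flipped. Otherwise one of these triangles has a longer side, and \<open>g\<close> crosses this side as well
  unless \<open>g\<close> is longer than \<open>e\<close>.\<close>

lemma crossing_step:
  assumes \<sigma>: "full_triangulation m n \<sigma>" and e: "e \<in> \<sigma>" and g: "is_edge m n g" and x: "cross e g"
  shows "(\<exists>h\<in>\<sigma>. cross h g \<and> child e h) \<or> (l1_length g > l1_length e \<and> l1_length g \<ge> 3) \<or> (\<exists>e'. downflip \<sigma> e e')"
proof -
  obtain A B where AB: "e = seg A B" "primitive A B" using triangulation_edge[OF \<sigma> e] by metis
  obtain P Q where PQ: "g = seg P Q" "P \<in> grid m n" "Q \<in> grid m n" "primitive P Q" using is_edge_obtain[OF g] by metis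
  have px: "pcross A B P Q" using x cross_seg_iff[OF AB(2) PQ(4)] by (simp add: AB PQ)
  have in\<sigma>: "seg A B \<in> \<sigma>" using e AB by simp
  obtain C D where C: "orient A B C = 1" "seg A C \<in> \<sigma>" "seg B C \<in> \<sigma>"
    and D: "orient A B D = -1" "seg A D \<in> \<sigma>" "seg B D \<in> \<sigma>"
    using two_apexes[OF \<sigma> in\<sigma> px PQ(2,3)] .
  have step: ?thesis
    if S: "e = seg A' B'" "\<bar>orient A' B' X\<bar> = 1" "seg A' X \<in> \<sigma>" "pcross A' B' P Q" and l: "len A' X = len A' B' + len B' X" for A' B' X
  proof (cases "pcross A' X P Q")
    case True
    have "cross (seg A' X) g"
      using True cross_seg_iff[OF triangulation_seg(3)[OF \<sigma> S(3)] PQ(4)] by (simp add: PQ)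
    moreover have "child e (seg A' X)" unfolding child_def
    proof (intro exI conjI)
      show "\<bar>orient A' X B'\<bar> = 1" using S(2) by (simp add: orient_def algebra_simps)
      show "len A' X = len A' B' + len X B'" using l by (simp add: len_commute[of X])
    qed (use S in auto)
    ultimately show ?thesis using S(3) by blast
  next
    case False
    have "len P Q > len A' B' \<and> len P Q \<ge> 3"
      using longer_if_not_through_longest[OF S(2) PQ(4) S(4) l False] .
    hence "real_of_int (len P Q) > of_int (len A' B') \<and> real_of_int (len P Q) \<ge> of_int 3"
      by (simp only: of_int_less_iff of_int_le_iff)
    thus ?thesis using S(1) by (simp add: PQ l1_length_seg)
  qed
  have flip: ?thesis if l: "len A B = len A C + len B C" "len A B = len A D + len B D"
  proof -
    have "D = A + B - C" using longest_both_sides_parallelogram[OF C(1) D(1) l] .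
    hence "downflip \<sigma> e (seg C D)"
      unfolding downflip_def using AB(1) C D l(1) in\<sigma> by (intro exI[of _ A] exI[of _ B] exI[of _ C]) simp
    thus ?thesis by blast
  qed
  have ex: "e = seg B A" "pcross B A P Q" "\<bar>orient B A C\<bar> = 1" "\<bar>orient B A D\<bar> = 1"
    "\<bar>orient A B C\<bar> = 1" "\<bar>orient A B D\<bar> = 1" "len B A = len A B"
    using AB(1) px pcross_swap(1) C(1) D(1) by (auto simp: seg_commute orient_swap[of B A] len_commute)
  show ?thesis
    using triangle_longest[OF ex(5)] triangle_longest[OF ex(6)]
      step[of A B C] step[of B A C] step[of A B D] step[of B A D] flip AB(1) px ex C D
    by metis
qed

lemma downflipE:
  assumes "downflip \<sigma> e e'"
  obtains A B C where "e = seg A B" "e' = seg C (A + B - C)" "orient A B C = 1" "len A B = len A C + len B C"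
    "seg A B \<in> \<sigma>" "seg A C \<in> \<sigma>" "seg B C \<in> \<sigma>" "seg A (A + B - C) \<in> \<sigma>" "seg B (A + B - C) \<in> \<sigma>"
proof -
  obtain A B C where "e = seg A B \<and> e' = seg C (A + B - C) \<and>
     orient A B C = 1 \<and> len A B = len A C + len B C \<and>
     {seg A B, seg A C, seg B C, seg A (A + B - C), seg B (A + B - C)} \<subseteq> \<sigma>"
    using assms unfolding downflip_def by (elim exE)
  thus ?thesis using that[of A B C] by simp
qed

lemma downflip_lengths:
  assumes "downflip \<sigma> e e'"
  shows "l1_length e \<ge> 2" and "l1_length e < 3 \<Longrightarrow> l1_length e = 2" 
    and "l1_length e \<ge> 3 \<Longrightarrow> l1_length e' + 1 \<le> l1_length e"
proof -
  obtain A B C where e: "e = seg A B" "e' = seg C (A + B - C)" "orient A B C = 1" "len A B = len A C + len B C"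
    using downflipE[OF assms] by metis
  have "A \<noteq> C" "B \<noteq> C" using e(3) by (auto simp: orient_def)
  hence pos: "len A C \<ge> 1" "len B C \<ge> 1" by (auto intro: len_pos)
  thus 1: "l1_length e \<ge> 2" using e(4) by (simp add: e(1) l1_length_seg)
  show "l1_length e = 2" if "l1_length e < 3"
  proof -
    have "len A B < 3" using that by (simp add: e(1) l1_length_seg)
    hence "len A B = 2" using pos e(4) by linarith
    thus ?thesis by (simp add: e(1) l1_length_seg)
  qed
  show "l1_length e' + 1 \<le> l1_length e" if "l1_length e \<ge> 3"
  proof -
    have "len A B \<ge> 3" using that by (simp add: e(1) l1_length_seg)
    hence "len C (A + B - C) + 1 \<le> len A B" using short_diagonal_length(1)[of A B C] e(3,4) pos by simp
    hence "real_of_int (len C (A + B - C) + 1) \<le> of_int (len A B)" by (simp only: of_int_le_iff)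
    thus ?thesis by (simp add: e(1,2) l1_length_seg)
  qed
qed

lemma downflip_triangulation:
  assumes \<sigma>: "full_triangulation m n \<sigma>" and d: "downflip \<sigma> e e'"
  shows "full_triangulation m n (insert e' (\<sigma> - {e}))"
    and "\<And>f. f \<in> \<sigma> \<Longrightarrow> f \<noteq> e \<Longrightarrow> \<not> cross e' f"
    and "edge_midpoint e' = edge_midpoint e" "e' \<notin> \<sigma>" "e \<in> \<sigma>"
proof -
  obtain A B C where e: "e = seg A B" "e' = seg C (A + B - C)" "orient A B C = 1"
    "seg A B \<in> \<sigma>" "seg A C \<in> \<sigma>" "seg B C \<in> \<sigma>" "seg A (A + B - C) \<in> \<sigma>" "seg B (A + B - C) \<in> \<sigma>"
    by (rule downflipE[OF d])
  note f = flip[OF \<sigma> e(3) refl e(4-8)]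
  show "full_triangulation m n (insert e' (\<sigma> - {e}))"
    and "\<And>f. f \<in> \<sigma> \<Longrightarrow> f \<noteq> e \<Longrightarrow> \<not> cross e' f"
    and "edge_midpoint e' = edge_midpoint e" "e' \<notin> \<sigma>" "e \<in> \<sigma>"
    using f e by simp_all
qed

text \<open>\<open>A\<close> and \<open>B\<close> are the two apexes over \<open>CD\<close> in \<open>\<tau>\<close>, so they can be recovered from \<open>\<tau>\<close> and \<open>e'\<close>.\<close>

lemma downflip_source_unique:
  assumes \<tau>: "full_triangulation m n \<tau>" and f: "full_triangulation m n \<sigma>\<^sub>1" "full_triangulation m n \<sigma>\<^sub>2"
    and d: "downflip \<sigma>\<^sub>1 e\<^sub>1 e'" "downflip \<sigma>\<^sub>2 e\<^sub>2 e'"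
    and t: "\<tau> = insert e' (\<sigma>\<^sub>1 - {e\<^sub>1})" "\<tau> = insert e' (\<sigma>\<^sub>2 - {e\<^sub>2})"
  shows "e\<^sub>1 = e\<^sub>2 \<and> \<sigma>\<^sub>1 = \<sigma>\<^sub>2"
proof -
  have get: "\<exists>A B C D. e = seg A B \<and> e' = seg C D \<and> orient C D B = 1 \<and> orient D C A = 1 \<and>
      seg A C \<in> \<tau> \<and> seg B C \<in> \<tau> \<and> seg A D \<in> \<tau> \<and> seg B D \<in> \<tau>"
    if d: "downflip \<sigma> e e'" and t: "\<tau> = insert e' (\<sigma> - {e})" for \<sigma> e
  proof -
    obtain A B C where e: "e = seg A B" "e' = seg C (A + B - C)" "orient A B C = 1"
      "seg A B \<in> \<sigma>" "seg A C \<in> \<sigma>" "seg B C \<in> \<sigma>" "seg A (A + B - C) \<in> \<sigma>" "seg B (A + B - C) \<in> \<sigma>"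
      by (rule downflipE[OF d])
    have "orient C (A + B - C) B = 1" "orient (A + B - C) C A = 1"
      using e(3) by (simp_all add: orient_def algebra_simps)
    moreover have "seg X Y \<noteq> e" if "Y \<noteq> A" "Y \<noteq> B" for X Y using that by (auto simp: e(1) seg_eq_iff)
    moreover have "C \<noteq> A" "C \<noteq> B" using e(3) by (auto simp: orient_def)
    moreover from this have "A + B - C \<noteq> A" "A + B - C \<noteq> B" by (auto simp: prod_eq_iff)
    ultimately show ?thesis using e t by (metis DiffI insertCI singletonD)
  qed
  obtain A B C D where 1: "e\<^sub>1 = seg A B" "e' = seg C D" "orient C D B = 1" "orient D C A = 1"
      "seg A C \<in> \<tau>" "seg B C \<in> \<tau>" "seg A D \<in> \<tau>" "seg B D \<in> \<tau>" using get[OF d(1) t(1)] by blast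
  obtain A' B' C' D' where 2: "e\<^sub>2 = seg A' B'" "e' = seg C' D'" "orient C' D' B' = 1" "orient D' C' A' = 1"
      "seg A' C' \<in> \<tau>" "seg B' C' \<in> \<tau>" "seg A' D' \<in> \<tau>" "seg B' D' \<in> \<tau>" using get[OF d(2) t(2)] by blast
  have "C' = C \<and> D' = D \<or> C' = D \<and> D' = C" using 1(2) 2(2) by (auto simp: seg_eq_iff)
  hence e: "e\<^sub>1 = e\<^sub>2"
  proof
    assume "C' = C \<and> D' = D"
    hence "B = B'" "A = A'"
      using apex_unique[OF \<tau>, of C D B B'] apex_unique[OF \<tau>, of D C A A'] 1 2 by (auto simp: seg_commute)
    thus ?thesis using 1 2 by simp
  next
    assume "C' = D \<and> D' = C"
    hence "B = A'" "A = B'"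
      using apex_unique[OF \<tau>, of C D B A'] apex_unique[OF \<tau>, of D C A B'] 1 2 by (auto simp: seg_commute)
    thus ?thesis using 1 2 by (simp add: seg_commute)
  qed
  have "\<sigma>\<^sub>1 = insert e\<^sub>1 (\<tau> - {e'})" "\<sigma>\<^sub>2 = insert e\<^sub>2 (\<tau> - {e'})"
    using downflip_triangulation(4,5)[OF f(1) d(1)] downflip_triangulation(4,5)[OF f(2) d(2)] t by auto
  thus ?thesis using e by simp
qed

text \<open>Whenever \<open>g\<close> crosses the long diagonal \<open>e\<close>, it also crosses a long side \<open>w\<close> of the parallelogram, except when it is
  the short diagonal: entering either half of the parallelogram, it crosses the long side, ends at the
  corner, or crosses the short side. In the last case, by assumption \<open>H\<close> and lemma
  \<open>longer_if_not_through_longest\<close> for the triangle cut off by \<open>e'\<close>, it crosses a long side after all. The number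
  \<open>s\<close> is the length of the short sides.\<close>

lemma downflip_crossing_source:
  assumes \<sigma>: "full_triangulation m n \<sigma>" and g: "is_edge m n g" and x: "cross e g" and d: "downflip \<sigma> e e'"
    and e3: "l1_length e \<ge> 3" and H: "\<And>w. w \<in> \<sigma> \<Longrightarrow> cross w g \<Longrightarrow> l1_length w \<ge> l1_length g"
  shows "e' = g \<or> (\<exists>w\<in>insert e' (\<sigma> - {e}). cross w g \<and> child e' w \<and>
     (\<exists>s\<ge>1. l1_length e = l1_length w + s \<and> l1_length e - l1_length e' = 2 * s))"
proof -
  obtain A0 B0 C where e0: "e = seg A0 B0" "e' = seg C (A0 + B0 - C)" "orient A0 B0 C = 1" "len A0 B0 = len A0 C + len B0 C"
    "seg A0 C \<in> \<sigma>" "seg B0 C \<in> \<sigma>" "seg A0 (A0 + B0 - C) \<in> \<sigma>" "seg B0 (A0 + B0 - C) \<in> \<sigma>"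
    by (rule downflipE[OF d])
  obtain P Q where PQ: "g = seg P Q" "primitive P Q" using is_edge_obtain[OF g] by metis
  have core: ?thesis
    if e: "e = seg A B" "e' = seg C D" "D = A + B - C" "\<bar>orient A B C\<bar> = 1" "len A B = len A C + len B C"
    "seg A C \<in> \<sigma>" "seg B C \<in> \<sigma>" "seg A D \<in> \<sigma>" "seg B D \<in> \<sigma>" and longer: "len A C > len B C" for A B D
  proof -
    have primAB: "primitive A B" using orient_unit_primitive[OF e(4)] .
    have px: "pcross A B P Q" using x cross_seg_iff[OF primAB PQ(2)] by (simp add: e(1) PQ)
    have T: "\<bar>orient A B D\<bar> = 1" "\<bar>orient B C D\<bar> = 1" "\<bar>orient A D C\<bar> = 1" "\<bar>orient C A D\<bar> = 1" "\<bar>orient D B C\<bar> = 1"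
      using e(4) unfolding e(3) by (simp_all add: orient_def algebra_simps)
    have AB3: "len A B \<ge> 3" using e3 by (simp add: e(1) l1_length_seg)
    have l: "len A D = len B C" "len B D = len A C" by (simp_all add: len_def e(3) abs_minus_commute)
    have CD: "len C D = len A C - len B C"
      using short_diagonal_length(1)[OF e(4,5) AB3] longer by (simp add: e(3))
    have short: "\<not> len P Q > len X Y" if "seg X Y \<in> \<sigma>" "pcross X Y P Q" for X Y
    proof -
      have "cross (seg X Y) g" using that cross_seg_iff[OF triangulation_seg(3)[OF \<sigma> that(1)] PQ(2)] by (simp add: PQ)
      thus ?thesis using H[OF that(1)] by (simp add: PQ l1_length_seg)
    qed
    have BC: "pcross B C P Q \<Longrightarrow> pcross B D P Q"
      using longer_if_not_through_longest[OF T(2) PQ(2)] l CD short[OF e(7)] by fastforce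
    have AD: "pcross A D P Q \<Longrightarrow> pcross A C P Q"
      using longer_if_not_through_longest[OF T(3) PQ(2)] l CD short[OF e(8)] by (fastforce simp: len_commute[of D C])
    have CDne: "C \<noteq> D" using T(2) by (auto simp: orient_def)
    have BCne: "B \<noteq> C" using e(4) by (auto simp: orient_def)
    consider "pcross A C P Q" | "pcross B D P Q" | "seg C D = seg P Q"
    proof -
      have "pcross A C P Q \<or> pcross B D P Q \<or> C = P \<or> C = Q" "pcross A C P Q \<or> pcross B D P Q \<or> D = P \<or> D = Q"
        using exit_triangle[OF e(4) PQ(2) px] exit_triangle[OF T(1) PQ(2) px] BC AD by blast+
      moreover have "seg C D = seg P Q" if "C = P \<or> C = Q" "D = P \<or> D = Q"
        using that CDne unfolding seg_eq_iff by blast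
      ultimately show ?thesis using that by blast
    qed
    thus ?thesis
    proof cases
      case 3
      thus ?thesis using e(2) PQ(1) by simp
    next
      case 1
      have "cross (seg A C) g" using 1 cross_seg_iff[OF triangulation_seg(3)[OF \<sigma> e(6)] PQ(2)] by (simp add: PQ)
      moreover have "child e' (seg A C)" unfolding child_def
      proof (intro exI conjI)
        show "seg A C = seg C A" by (rule seg_commute)
        show "e' = seg C D" by fact
        show "\<bar>orient C A D\<bar> = 1" by fact
        show "len C A = len C D + len A D" using l CD by (simp add: len_commute[of C A])
      qed
      moreover have "seg A C \<noteq> e" using e(4) by (auto simp: e(1) seg_eq_iff orient_def)
      moreover have "real_of_int (len B C) \<ge> 1" using len_pos[OF BCne] by simp
      moreover have "l1_length e = l1_length (seg A C) + len B C" "l1_length e - l1_length e' = 2 * len B C"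
        using e(5) CD by (simp_all add: e(1,2) l1_length_seg)
      ultimately have "seg A C \<in> insert e' (\<sigma> - {e}) \<and> cross (seg A C) g \<and> child e' (seg A C) \<and> real_of_int (len B C) \<ge> 1 \<and>
        l1_length e = l1_length (seg A C) + len B C \<and> l1_length e - l1_length e' = 2 * len B C"
        using e(6) by (intro conjI insertI2 DiffI) simp_all
      thus ?thesis by (intro disjI2 bexI[of _ "seg A C"] conjI exI[of _ "real_of_int (len B C)"]) simp_all
    next
      case 2
      have "cross (seg B D) g" using 2 cross_seg_iff[OF triangulation_seg(3)[OF \<sigma> e(9)] PQ(2)] by (simp add: PQ)
      moreover have "child e' (seg B D)" unfolding child_def
      proof (intro exI conjI)
        show "seg B D = seg D B" by (rule seg_commute)
        show "e' = seg D C" using e(2) by (simp add: seg_commute)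
        show "\<bar>orient D B C\<bar> = 1" by fact
        show "len D B = len D C + len B C" using l CD by (simp add: len_commute[of D])
      qed
      moreover have "seg B D \<noteq> e" using T(1) by (auto simp: e(1) seg_eq_iff orient_def)
      moreover have "real_of_int (len B C) \<ge> 1" using len_pos[OF BCne] by simp
      moreover have "l1_length e = l1_length (seg B D) + len B C" "l1_length e - l1_length e' = 2 * len B C"
        using e(5) CD l by (simp_all add: e(1,2) l1_length_seg)
      ultimately have "seg B D \<in> insert e' (\<sigma> - {e}) \<and> cross (seg B D) g \<and> child e' (seg B D) \<and> real_of_int (len B C) \<ge> 1 \<and>
        l1_length e = l1_length (seg B D) + len B C \<and> l1_length e - l1_length e' = 2 * len B C"
        using e(9) by (intro conjI insertI2 DiffI) simp_all
      thus ?thesis by (intro disjI2 bexI[of _ "seg B D"] conjI exI[of _ "real_of_int (len B C)"]) simp_all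
    qed
  qed
  have "len A0 B0 \<ge> 3" using e3 by (simp add: e0(1) l1_length_seg)
  hence "len A0 C \<noteq> len B0 C" using short_diagonal_length(2)[of A0 B0 C] e0 by simp
  hence "len A0 C > len B0 C \<or> len B0 C > len A0 C" by linarith
  thus ?thesis
  proof
    assume "len A0 C > len B0 C"
    thus ?thesis using core[of A0 B0 "A0 + B0 - C"] e0 by simp
  next
    assume *: "len B0 C > len A0 C"
    have "A0 + B0 - C = B0 + A0 - C" "e = seg B0 A0" "\<bar>orient B0 A0 C\<bar> = 1" "len B0 A0 = len B0 C + len A0 C"
      using e0 by (simp_all add: seg_commute orient_swap[of B0 A0] len_commute[of B0 A0] add.commute)
    thus ?thesis using core[of B0 A0 "A0 + B0 - C"] * e0(2,5-8) by simp
  qed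
qed

section \<open>Edges that cross the ground state\<close>

lemma Omega_triangulation: "\<sigma> \<in> Omega m n \<eta> \<Delta> \<Longrightarrow> full_triangulation m n \<sigma>"
  by (simp add: Omega_def)

text \<open>A constraint edge belongs to all triangulations in \<open>Omega\<close>, so none of their edges crosses it.\<close>

lemma crossed_unconstrained:
  assumes c: "\<Delta> \<subseteq> midpoints m n" and \<sigma>: "\<sigma> \<in> Omega m n \<eta> \<Delta>" and \<tau>: "\<tau> \<in> Omega m n \<eta> \<Delta>"
    and e: "e \<in> \<sigma>" and f: "f \<in> \<tau>" and x: "cross e f"
  shows "edge_midpoint e \<notin> \<Delta>"
proof
  assume y: "edge_midpoint e \<in> \<Delta>"
  have "e = edge_at \<sigma> (edge_midpoint e)" using edge_at_midpoint[OF Omega_triangulation[OF \<sigma>] e] by simp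
  also have "\<dots> = edge_at \<tau> (edge_midpoint e)" using \<sigma> \<tau> y by (simp add: Omega_def)
  also have "\<dots> \<in> \<tau>" using edge_at_in(1)[OF Omega_triangulation[OF \<tau>]] y c by blast
  finally show False using triangulation_not_cross[OF Omega_triangulation[OF \<tau>] _ f] x by blast
qed

lemma downflip_Omega:
  assumes c: "\<Delta> \<subseteq> midpoints m n" and \<sigma>: "\<sigma> \<in> Omega m n \<eta> \<Delta>" and d: "downflip \<sigma> e e'"
    and u: "edge_midpoint e \<notin> \<Delta>"
  shows "insert e' (\<sigma> - {e}) \<in> Omega m n \<eta> \<Delta>"
    and "total_length m n (insert e' (\<sigma> - {e})) = total_length m n \<sigma> - l1_length e + l1_length e'"
proof -
  note full = Omega_triangulation[OF \<sigma>]
  note f = downflip_triangulation[OF full d]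
  have "edge_at (insert e' (\<sigma> - {e})) x = \<eta> x" if x: "x \<in> \<Delta>" for x
  proof -
    have xm: "x \<in> midpoints m n" using x c by blast
    have mid: "edge_midpoint (edge_at \<sigma> x) = x" using edge_at_in(2)[OF full xm] .
    have "edge_at \<sigma> x \<in> insert e' (\<sigma> - {e})"
      using edge_at_in(1)[OF full xm] mid u x by auto
    hence "edge_at (insert e' (\<sigma> - {e})) x = edge_at \<sigma> x"
      using edge_at_midpoint[OF f(1)] mid by metis
    thus ?thesis using \<sigma> x by (simp add: Omega_def)
  qed
  thus "insert e' (\<sigma> - {e}) \<in> Omega m n \<eta> \<Delta>" using f(1) by (simp add: Omega_def)
  have fin: "finite \<sigma>" using finite_triangulation[OF full] .
  have "(\<Sum>a\<in>insert e' (\<sigma> - {e}). l1_length a) = l1_length e' + (\<Sum>a\<in>\<sigma> - {e}. l1_length a)"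
    using fin f(4) by (subst sum.insert) auto
  also have "(\<Sum>a\<in>\<sigma> - {e}. l1_length a) = (\<Sum>a\<in>\<sigma>. l1_length a) - l1_length e"
    using fin f(5) by (simp add: sum_diff1)
  finally show "total_length m n (insert e' (\<sigma> - {e})) = total_length m n \<sigma> - l1_length e + l1_length e'"
    unfolding total_length_sum[OF f(1)] total_length_sum[OF full] by simp
qed

text \<open>Among the edges of the ground state that \<open>f\<close> crosses let \<open>e\<close> be a longest one. It is unconstrained. By lemma
  \<open>crossing_step\<close> either \<open>f\<close> is longer than \<open>e\<close>, or \<open>f\<close> crosses an edge still longer than \<open>e\<close>, which is excluded, or \<open>e\<close>
  can be flipped. As the flip cannot shorten a ground state, \<open>e\<close> is then a unit diagonal, and \<open>f\<close>
  is the other diagonal of the same unit square or has length at least \<open>3\<close>.\<close>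

lemma crossing_ground_state_longer:
  assumes c: "\<Delta> \<subseteq> midpoints m n" and gs: "ground_state m n \<eta> \<Delta> \<gamma>"
    and \<tau>: "\<tau> \<in> Omega m n \<eta> \<Delta>" and f: "f \<in> \<tau>" and g: "g \<in> \<gamma>" and x: "cross f g"
  shows "(l1_length f > l1_length g \<and> l1_length f \<ge> 3) \<or>
    (edge_midpoint f = edge_midpoint g \<and> l1_length f = l1_length g)"
proof -
  have \<gamma>: "\<gamma> \<in> Omega m n \<eta> \<Delta>" and min: "\<And>\<sigma>. \<sigma> \<in> Omega m n \<eta> \<Delta> \<Longrightarrow> total_length m n \<gamma> \<le> total_length m n \<sigma>"
    using gs by (auto simp: ground_state_def)
  note full = Omega_triangulation[OF \<gamma>]
  have fe: "is_edge m n f" using triangulation_is_edge[OF Omega_triangulation[OF \<tau>] f] .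
  define X where "X = {e \<in> \<gamma>. cross e f}"
  have "finite X" "X \<noteq> {}" using finite_triangulation[OF full] g x cross_commute by (auto simp: X_def)
  then obtain e where e: "e \<in> X" "\<And>h. h \<in> X \<Longrightarrow> l1_length h \<le> l1_length e"
    using arg_min_if_finite[of X "\<lambda>e. - l1_length e"] by (metis linorder_not_less neg_less_iff_less)
  have e': "e \<in> \<gamma>" "cross e f" using e(1) by (simp_all add: X_def)
  have ge: "l1_length g \<le> l1_length e" using e(2) g x cross_commute by (simp add: X_def)
  have unc: "edge_midpoint e \<notin> \<Delta>" using crossed_unconstrained[OF c \<gamma> \<tau> e'(1) f e'(2)] .
  from crossing_step[OF full e'(1) fe e'(2)]
  consider h where "h \<in> \<gamma>" "cross h f" "child e h" | "l1_length f > l1_length e" "l1_length f \<ge> 3" | e1 where "downflip \<gamma> e e1"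
    by blast
  thus ?thesis
  proof cases
    case 1
    thus ?thesis using e(2)[of h] child_shorter[of e h] by (simp add: X_def)
  next
    case 2
    thus ?thesis using ge by simp
  next
    case (3 e1)
    have "l1_length e \<le> l1_length e1"
      using min[OF downflip_Omega(1)[OF c \<gamma> 3 unc]] downflip_Omega(2)[OF c \<gamma> 3 unc] by simp
    hence e2: "l1_length e = 2" using downflip_lengths[OF 3] by linarith
    obtain A B C D where AB: "e = seg A B" "e1 = seg C D" "D = A + B - C" "orient A B C = 1" "len A B = len A C + len B C"
      using downflipE[OF 3] by metis
    obtain P Q where PQ: "f = seg P Q" "primitive P Q" using is_edge_obtain[OF fe] by metis
    have T: "\<bar>orient A B C\<bar> = 1" "\<bar>orient A B D\<bar> = 1" using AB(4) unfolding AB(3) by (simp_all add: orient_def algebra_simps)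
    have px: "pcross A B P Q"
      using e'(2) cross_seg_iff[OF orient_unit_primitive[OF T(1)] PQ(2)] by (simp add: AB(1) PQ(1))
    have "A \<noteq> C" "B \<noteq> C" using T(1) by (auto simp: orient_def)
    hence "len A C \<ge> 1" "len B C \<ge> 1" by (auto intro: len_pos)
    moreover have "len A B = 2" using e2 by (simp add: AB(1) l1_length_seg)
    ultimately have unit: "len A C = 1" "len B C = 1" using AB(5) by linarith+
    have unit': "len A D = 1" "len B D = 1" using unit unfolding AB(3) by (simp_all add: len_def abs_minus_commute)
    show ?thesis
    proof (cases "pcross A C P Q \<or> pcross B C P Q \<or> pcross A D P Q \<or> pcross B D P Q")
      case True
      hence "len P Q \<ge> 3" using cross_unit_edge unit unit' PQ(2) by blast
      hence "l1_length f \<ge> 3" by (simp add: PQ(1) l1_length_seg)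
      thus ?thesis using ge e2 by simp
    next
      case False
      have ACD: "\<bar>orient A C D\<bar> = 1" using T(1) unfolding AB(3) by (simp add: orient_def algebra_simps)
      moreover have "orient A C C = 0" by (simp add: orient_def)
      ultimately have "C \<noteq> D" by (metis abs_zero zero_neq_one)
      hence "f = e1"
        using exit_triangle[OF T(1) PQ(2) px] exit_triangle[OF T(2) PQ(2) px] False AB(2) PQ(1) by (auto simp: seg_commute)
      moreover from this have "g = e" using downflip_triangulation(2)[OF full 3 g] x by blast
      moreover have "l1_length e1 = 2"
      proof -
        have "len C D = 2"
          using triangle_longest[OF ACD] unit unit' len_pos[OF \<open>C \<noteq> D\<close>] by linarith
        thus ?thesis by (simp add: AB(2) l1_length_seg)
      qed
      ultimately show ?thesis using downflip_triangulation(3)[OF full 3] e2 by simp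
    qed
  qed
qed

lemma crossing_ground_state_cases:
  assumes c: "\<Delta> \<subseteq> midpoints m n" and gs: "ground_state m n \<eta> \<Delta> \<gamma>"
    and \<tau>: "\<tau> \<in> Omega m n \<eta> \<Delta>" and f: "f \<in> \<tau>" and g: "g \<in> \<gamma>" and x: "cross f g"
  shows "(l1_length f \<ge> 3 \<and> (\<exists>e'. downflip \<tau> f e')) \<or> (edge_midpoint f = edge_midpoint g \<and> l1_length f = l1_length g)
    \<or> (\<exists>w\<in>\<tau>. cross w g \<and> child f w)"
proof -
  have "is_edge m n g" using gs g triangulation_is_edge Omega_triangulation by (metis ground_state_def)
  from crossing_step[OF Omega_triangulation[OF \<tau>] f this x] crossing_ground_state_longer[OF assms]
  show ?thesis by fastforce
qed

section \<open>The exponential tail\<close>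

lemma sum_over_children:
  fixes u :: "edge \<Rightarrow> real"
  assumes "finite S" "finite T" and u: "\<And>w. w \<in> T \<Longrightarrow> u w \<ge> 0"
  shows "(\<Sum>f\<in>S. \<Sum>w\<in>T. if child f w then u w else 0) \<le> 4 * (\<Sum>w\<in>T. u w)"
proof -
  have "(\<Sum>f\<in>S. if child f w then u w else 0) \<le> 4 * u w" if w: "w \<in> T" for w
  proof -
    have "(\<Sum>f\<in>S. if child f w then u w else 0) = card (S \<inter> {f. child f w}) * u w"
      using assms(1) by (simp add: sum.If_cases)
    moreover have "card (S \<inter> {f. child f w}) \<le> 4"
      using card_children[of w] by (meson Int_lower2 card_mono order_trans)
    hence "real (card (S \<inter> {f. child f w})) \<le> 4" by simp
    ultimately show ?thesis using u[OF w] by (simp add: mult_right_mono)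
  qed
  hence "(\<Sum>w\<in>T. \<Sum>f\<in>S. if child f w then u w else 0) \<le> (\<Sum>w\<in>T. 4 * u w)" by (rule sum_mono)
  thus ?thesis by (subst sum.swap) (simp add: sum_distrib_left)
qed

text \<open>An edge \<open>g\<close> of the ground state is fixed. The weight \<open>\<alpha>\<close> per unit of length is chosen such that \<open>lam * \<alpha> = 1 / 16\<close>: an
  upward flip by \<open>d\<close> is penalised by \<open>lam ^ d\<close>, which beats the gain \<open>\<alpha> ^ d\<close> in edge weight.\<close>

locale ground_edge =
  fixes m n :: nat and \<eta> :: "point \<Rightarrow> edge" and \<Delta> :: "point set" and \<gamma> :: "edge set" and g :: edge and lam :: real
  assumes constrained: "\<Delta> \<subseteq> midpoints m n" and ground: "ground_state m n \<eta> \<Delta> \<gamma>" and g: "g \<in> \<gamma>"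
    and lam: "0 < lam" "lam \<le> 1 / 256"
begin

definition \<alpha> :: real where "\<alpha> = 1 / (16 * lam)"

definition edge_weight :: "edge \<Rightarrow> real" where "edge_weight e = \<alpha> powr l1_length e"

definition weight :: "edge set \<Rightarrow> real" where "weight \<sigma> = lam powr total_length m n \<sigma>"

definition crossers :: "edge set \<Rightarrow> edge set" where "crossers \<sigma> = {e \<in> \<sigma>. cross e g}"

definition shortenable :: "edge set \<Rightarrow> edge set" where "shortenable \<sigma> = {e \<in> crossers \<sigma>. l1_length e \<ge> 3 \<and> (\<exists>e'. downflip \<sigma> e e')}"

abbreviation \<Omega> :: "edge set set" where "\<Omega> \<equiv> Omega m n \<eta> \<Delta>"

lemma alpha_ge: "\<alpha> \<ge> 16" using lam by (simp add: \<alpha>_def field_simps)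

lemma edge_weight_pos: "edge_weight e > 0" using alpha_ge by (simp add: edge_weight_def)

lemma weight_pos: "weight e > 0" using lam by (simp add: weight_def)

lemma g_edge: "is_edge m n g"
  using ground g triangulation_is_edge Omega_triangulation by (metis ground_state_def)

lemma finite_crossers: "\<sigma> \<in> \<Omega> \<Longrightarrow> finite (crossers \<sigma>)"
  unfolding crossers_def by (intro finite_Collect_conjI disjI1) (simp add: finite_triangulation[OF Omega_triangulation])

lemma child_sum_nonneg: "(\<Sum>w\<in>T. if child f w then edge_weight w else 0) \<ge> 0"
  using edge_weight_pos by (intro sum_nonneg) (simp add: less_imp_le)

text \<open>A crossing edge that cannot be shortened either has the midpoint of \<open>g\<close> and the same length, which happens for at most
  one edge, or it is the child of another crossing edge. The latter is longer by at least one, and so has at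
  least \<open>\<alpha>\<close> times the weight; it has at most four children, and \<open>4 / \<alpha> \<le> 1 / 4\<close>.\<close>

lemma crossers_le_shortenable:
  assumes \<tau>: "\<tau> \<in> \<Omega>"
  shows "(\<Sum>e\<in>crossers \<tau>. edge_weight e) \<le> (\<Sum>e\<in>shortenable \<tau>. edge_weight e) + edge_weight g + 1 / 4 * (\<Sum>e\<in>crossers \<tau>. edge_weight e)"
proof -
  note fin = finite_crossers[OF \<tau>]
  have each: "edge_weight f \<le> (if f \<in> shortenable \<tau> then edge_weight f else 0) + (if edge_midpoint f = edge_midpoint g then edge_weight g else 0)
      + 1 / \<alpha> * (\<Sum>w\<in>crossers \<tau>. if child f w then edge_weight w else 0)" if f: "f \<in> crossers \<tau>" for f
  proof -
    have f': "f \<in> \<tau>" "cross f g" using f by (simp_all add: crossers_def)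
    have nn: "1 / \<alpha> * (\<Sum>w\<in>crossers \<tau>. if child f w then edge_weight w else 0) \<ge> 0"
      using child_sum_nonneg alpha_ge by (intro mult_nonneg_nonneg) auto
    from crossing_ground_state_cases[OF constrained ground \<tau> f'(1) g f'(2)]
    consider "f \<in> shortenable \<tau>" | "edge_midpoint f = edge_midpoint g" "l1_length f = l1_length g"
      | w where "w \<in> \<tau>" "cross w g" "child f w"
      using f by (auto simp: shortenable_def)
    thus ?thesis
    proof cases
      case (3 w)
      have w: "w \<in> crossers \<tau>" using 3 by (simp add: crossers_def)
      have "edge_weight f \<le> \<alpha> powr (l1_length w - 1)"
        unfolding edge_weight_def using child_shorter[OF 3(3)] alpha_ge by (intro powr_mono) auto
      also have "\<dots> = 1 / \<alpha> * edge_weight w" using alpha_ge by (simp add: edge_weight_def powr_diff)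
      also have "edge_weight w \<le> (\<Sum>w\<in>crossers \<tau>. if child f w then edge_weight w else 0)"
        using member_le_sum[OF w, of "\<lambda>w. if child f w then edge_weight w else 0"] fin 3(3) edge_weight_pos by (simp add: less_imp_le)
      hence "1 / \<alpha> * edge_weight w \<le> 1 / \<alpha> * (\<Sum>w\<in>crossers \<tau>. if child f w then edge_weight w else 0)"
        using alpha_ge by (intro mult_left_mono) auto
      finally show ?thesis using edge_weight_pos[of f] edge_weight_pos[of g] by auto
    qed (use nn edge_weight_pos[of f] edge_weight_pos[of g] in \<open>auto simp: edge_weight_def\<close>)
  qed
  have "(\<Sum>f\<in>crossers \<tau>. edge_weight f) \<le> (\<Sum>f\<in>crossers \<tau>. if f \<in> shortenable \<tau> then edge_weight f else 0)
     + (\<Sum>f\<in>crossers \<tau>. if edge_midpoint f = edge_midpoint g then edge_weight g else 0)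
     + 1 / \<alpha> * (\<Sum>f\<in>crossers \<tau>. \<Sum>w\<in>crossers \<tau>. if child f w then edge_weight w else 0)"
    using sum_mono[of "crossers \<tau>", OF each] by (simp add: sum.distrib sum_distrib_left)
  moreover have "(\<Sum>f\<in>crossers \<tau>. if f \<in> shortenable \<tau> then edge_weight f else 0) = (\<Sum>f\<in>shortenable \<tau>. edge_weight f)"
  proof -
    have "crossers \<tau> \<inter> shortenable \<tau> = shortenable \<tau>" by (auto simp: shortenable_def)
    thus ?thesis using fin by (simp add: sum.If_cases)
  qed
  moreover have "(\<Sum>f\<in>crossers \<tau>. if edge_midpoint f = edge_midpoint g then edge_weight g else 0) \<le> edge_weight g"
  proof -
    let ?S = "crossers \<tau> \<inter> {f. edge_midpoint f = edge_midpoint g}"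
    have "a = b" if "a \<in> ?S" "b \<in> ?S" for a b
      using triangulation_midpoint_unique[OF Omega_triangulation[OF \<tau>], of a b] that by (simp add: crossers_def)
    hence "card ?S \<le> 1" using fin by (simp add: card_le_Suc0_iff_eq)
    hence "real (card ?S) * edge_weight g \<le> 1 * edge_weight g" using edge_weight_pos[of g] by (intro mult_right_mono) auto
    thus ?thesis using fin by (simp add: sum.If_cases)
  qed
  moreover have "1 / \<alpha> * (\<Sum>f\<in>crossers \<tau>. \<Sum>w\<in>crossers \<tau>. if child f w then edge_weight w else 0) \<le> 1 / 4 * (\<Sum>e\<in>crossers \<tau>. edge_weight e)"
  proof -
    have s: "(\<Sum>f\<in>crossers \<tau>. \<Sum>w\<in>crossers \<tau>. if child f w then edge_weight w else 0) \<le> 4 * (\<Sum>e\<in>crossers \<tau>. edge_weight e)"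
      using fin edge_weight_pos by (intro sum_over_children) (auto simp: less_imp_le)
    have "(\<Sum>e\<in>crossers \<tau>. edge_weight e) \<ge> 0" using edge_weight_pos by (intro sum_nonneg) (auto simp: less_imp_le)
    hence "4 / \<alpha> * (\<Sum>e\<in>crossers \<tau>. edge_weight e) \<le> 1 / 4 * (\<Sum>e\<in>crossers \<tau>. edge_weight e)" using alpha_ge by (intro mult_right_mono) (auto simp: field_simps)
    have "1 / \<alpha> * (\<Sum>f\<in>crossers \<tau>. \<Sum>w\<in>crossers \<tau>. if child f w then edge_weight w else 0) \<le> 1 / \<alpha> * (4 * (\<Sum>e\<in>crossers \<tau>. edge_weight e))"
      using alpha_ge by (intro mult_left_mono s) auto
    also have "\<dots> = 4 / \<alpha> * (\<Sum>e\<in>crossers \<tau>. edge_weight e)" by simp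
    also note \<open>4 / \<alpha> * (\<Sum>e\<in>crossers \<tau>. edge_weight e) \<le> _\<close>
    finally show ?thesis .
  qed
  ultimately show ?thesis by linarith
qed

text \<open>The weight in \<open>\<tau>\<close> to which the flip producing \<open>\<tau>\<close> by the new edge \<open>e'\<close> is charged, following
  lemma \<open>downflip_crossing_source\<close>.\<close>

definition target_weight :: "edge set \<Rightarrow> edge \<Rightarrow> real" where
  "target_weight \<tau> e' = (if e' = g then edge_weight g else 0) + (\<Sum>w\<in>crossers \<tau>. if child e' w then edge_weight w else 0)"

lemma target_weight_nonneg: "target_weight \<tau> e' \<ge> 0"
  using child_sum_nonneg edge_weight_pos[of g] unfolding target_weight_def by (intro add_nonneg_nonneg) (simp_all add: less_imp_le)

lemma downflip_in_Omega:
  assumes \<sigma>: "\<sigma> \<in> \<Omega>" and e: "e \<in> shortenable \<sigma>" and d: "downflip \<sigma> e e'"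
  shows "insert e' (\<sigma> - {e}) \<in> \<Omega>"
    and "total_length m n \<sigma> = total_length m n (insert e' (\<sigma> - {e})) + (l1_length e - l1_length e')"
proof -
  have \<gamma>: "\<gamma> \<in> \<Omega>" using ground by (simp add: ground_state_def)
  have "e \<in> \<sigma>" "cross e g" using e by (auto simp: shortenable_def crossers_def)
  hence "edge_midpoint e \<notin> \<Delta>" using crossed_unconstrained[OF constrained \<sigma> \<gamma> _ g] by blast
  from downflip_Omega[OF constrained \<sigma> d this]
  show "insert e' (\<sigma> - {e}) \<in> \<Omega>"
    and "total_length m n \<sigma> = total_length m n (insert e' (\<sigma> - {e})) + (l1_length e - l1_length e')" by simp_all
qed

text \<open>If \<open>e' = g\<close> and the flip shortens by \<open>\<delta> \<ge> 1\<close>, the quotient of both sides is controlled by \<open>(lam * \<alpha>) ^ \<delta>\<close>. Otherwise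
  \<open>e\<close> exceeds the long side \<open>w\<close> by \<open>s\<close> while the flip gains \<open>2 s\<close>, so \<open>(lam * \<alpha>) ^ s * lam ^ s\<close> remains.\<close>

lemma downflip_weight:
  assumes \<sigma>: "\<sigma> \<in> \<Omega>" and e: "e \<in> shortenable \<sigma>" and d: "downflip \<sigma> e e'"
  defines "\<tau> \<equiv> insert e' (\<sigma> - {e})"
  shows "weight \<sigma> * edge_weight e \<le> 1 / 16 * (weight \<tau> * target_weight \<tau> e')"
proof -
  have e': "e \<in> \<sigma>" "cross e g" "l1_length e \<ge> 3" using e by (auto simp: shortenable_def crossers_def)
  define \<delta> where "\<delta> = l1_length e - l1_length e'"
  have W: "weight \<sigma> = weight \<tau> * lam powr \<delta>"
    unfolding weight_def downflip_in_Omega(2)[OF \<sigma> e d] \<tau>_def \<delta>_def by (simp add: powr_add)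
  have la: "lam * \<alpha> = 1 / 16" using lam by (simp add: \<alpha>_def)
  have small: "lam powr t * \<alpha> powr t \<le> 1 / 16" if "t \<ge> 1" for t
  proof -
    have "lam powr t * \<alpha> powr t = (1 / 16) powr t" using lam alpha_ge by (simp add: la flip: powr_mult)
    also have "\<dots> \<le> (1 / 16) powr 1" using that by (intro powr_mono') auto
    finally show ?thesis by simp
  qed
  have H: "l1_length w \<ge> l1_length g" if "w \<in> \<sigma>" "cross w g" for w
    using crossing_ground_state_longer[OF constrained ground \<sigma> that(1) g that(2)] by auto
  have "e' = g \<or> (\<exists>w\<in>insert e' (\<sigma> - {e}). cross w g \<and> child e' w \<and>
     (\<exists>s\<ge>1. l1_length e = l1_length w + s \<and> l1_length e - l1_length e' = 2 * s))"
    by (rule downflip_crossing_source[OF Omega_triangulation[OF \<sigma>] g_edge e'(2) d e'(3)]) (rule H)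
  hence "lam powr \<delta> * edge_weight e \<le> 1 / 16 * target_weight \<tau> e'"
  proof (elim disjE bexE conjE exE)
    assume eg: "e' = g"
    have "\<delta> \<ge> 1" using downflip_lengths(3)[OF d e'(3)] by (simp add: \<delta>_def)
    have "lam powr \<delta> * edge_weight e = (lam powr \<delta> * \<alpha> powr \<delta>) * edge_weight g"
      using alpha_ge by (simp add: edge_weight_def \<delta>_def eg flip: powr_add)
    also have "\<dots> \<le> 1 / 16 * edge_weight g" using small[OF \<open>\<delta> \<ge> 1\<close>] edge_weight_pos[of g] by (intro mult_right_mono) auto
    also have "edge_weight g \<le> target_weight \<tau> e'"
      using child_sum_nonneg unfolding target_weight_def eg by simp
    finally show ?thesis by simp
  next
    fix w s assume w: "w \<in> insert e' (\<sigma> - {e})" "cross w g" "child e' w"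
      and s: "1 \<le> s" "l1_length e = l1_length w + s" "l1_length e - l1_length e' = 2 * s"
    have wC: "w \<in> crossers \<tau>" using w by (simp add: crossers_def \<tau>_def)
    have fin: "finite (crossers \<tau>)" using finite_crossers[OF downflip_in_Omega(1)[OF \<sigma> e d]] by (simp add: \<tau>_def)
    have "\<delta> = s + s" using s by (simp add: \<delta>_def)
    hence "lam powr \<delta> = lam powr s * lam powr s" by (simp only: powr_add)
    hence "lam powr \<delta> * edge_weight e = lam powr s * ((lam powr s * \<alpha> powr s) * edge_weight w)"
      by (simp add: edge_weight_def s(2) powr_add)
    also have "\<dots> \<le> 1 * (1 / 16 * edge_weight w)"
      using small[OF s(1)] edge_weight_pos[of w] lam s(1) powr_mono'[of 0 s lam]
      by (intro mult_mono mult_right_mono) auto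
    also have "edge_weight w \<le> (\<Sum>w\<in>crossers \<tau>. if child e' w then edge_weight w else 0)"
      using member_le_sum[OF wC, of "\<lambda>w. if child e' w then edge_weight w else 0"] fin w(3) edge_weight_pos by (simp add: less_imp_le)
    also have "\<dots> \<le> target_weight \<tau> e'" using edge_weight_pos[of g] by (simp add: target_weight_def)
    finally show ?thesis by simp
  qed
  hence "weight \<tau> * (lam powr \<delta> * edge_weight e) \<le> weight \<tau> * (1 / 16 * target_weight \<tau> e')"
    using weight_pos[of \<tau>] by (intro mult_left_mono) auto
  thus ?thesis by (simp add: W mult_ac)
qed

text \<open>Flip each shortenable edge: the pairs of a triangulation and such an edge are mapped injectively to pairs of a
  triangulation and one of its edges, and each term is charged to its image.\<close>

lemma shortenable_bound:
  "(\<Sum>\<sigma>\<in>\<Omega>. weight \<sigma> * (\<Sum>e\<in>shortenable \<sigma>. edge_weight e)) \<le> 1 / 16 * (\<Sum>\<tau>\<in>\<Omega>. weight \<tau> * (edge_weight g + 4 * (\<Sum>e\<in>crossers \<tau>. edge_weight e)))"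
proof -
  have fin: "finite \<sigma>" if "\<sigma> \<in> \<Omega>" for \<sigma> using finite_triangulation Omega_triangulation that by blast
  have finD: "finite (shortenable \<sigma>)" if "\<sigma> \<in> \<Omega>" for \<sigma> using finite_crossers[OF that] by (simp add: shortenable_def)
  \<comment> \<open>The short diagonal is determined by \<open>e\<close>, but a choice function is enough for the counting argument.\<close>
  define flipped where "flipped \<sigma> e = (SOME e'. downflip \<sigma> e e')" for \<sigma> e
  have flipped: "downflip \<sigma> e (flipped \<sigma> e)" if "e \<in> shortenable \<sigma>" for \<sigma> e
    using that someI_ex[of "downflip \<sigma> e"] by (simp add: shortenable_def flipped_def)
  define \<phi> where "\<phi> = (\<lambda>(\<sigma>, e). (insert (flipped \<sigma> e) (\<sigma> - {e}), flipped \<sigma> e))"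
  define h where "h = (\<lambda>(\<tau>, e'). 1 / 16 * (weight \<tau> * target_weight \<tau> e'))"
  let ?P = "Sigma \<Omega> shortenable"
  have into: "\<phi> ` ?P \<subseteq> Sigma \<Omega> (\<lambda>\<tau>. \<tau>)"
    using downflip_in_Omega(1) flipped by (auto simp: \<phi>_def)
  have inj: "inj_on \<phi> ?P"
  proof (rule inj_onI)
    fix p q assume p: "p \<in> ?P" and q: "q \<in> ?P" and eq: "\<phi> p = \<phi> q"
    obtain \<sigma> e where pe: "p = (\<sigma>, e)" "\<sigma> \<in> \<Omega>" "e \<in> shortenable \<sigma>" using p by blast
    obtain \<sigma>' e' where qe: "q = (\<sigma>', e')" "\<sigma>' \<in> \<Omega>" "e' \<in> shortenable \<sigma>'" using q by blast
    have E: "insert (flipped \<sigma> e) (\<sigma> - {e}) = insert (flipped \<sigma>' e') (\<sigma>' - {e'})"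
      using arg_cong[OF eq, of fst] unfolding \<phi>_def pe qe prod.case fst_conv .
    have E': "flipped \<sigma> e = flipped \<sigma>' e'"
      using arg_cong[OF eq, of snd] unfolding \<phi>_def pe qe prod.case snd_conv .
    note t = Omega_triangulation[OF pe(2)] Omega_triangulation[OF qe(2)]
    have "e = e' \<and> \<sigma> = \<sigma>'"
    proof (rule downflip_source_unique[OF downflip_triangulation(1)[OF t(1) flipped[OF pe(3)]] t flipped[OF pe(3)] _ refl])
      show "downflip \<sigma>' e' (flipped \<sigma> e)" unfolding E' by (rule flipped[OF qe(3)])
      show "insert (flipped \<sigma> e) (\<sigma> - {e}) = insert (flipped \<sigma> e) (\<sigma>' - {e'})" using E unfolding E' .
    qed
    thus "p = q" using pe qe by simp
  qed
  have "(\<Sum>\<sigma>\<in>\<Omega>. weight \<sigma> * (\<Sum>e\<in>shortenable \<sigma>. edge_weight e)) = (\<Sum>(\<sigma>, e)\<in>?P. weight \<sigma> * edge_weight e)"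
    using finite_Omega finD by (simp add: sum_distrib_left sum.Sigma)
  also have "\<dots> \<le> (\<Sum>p\<in>?P. h (\<phi> p))"
    using downflip_weight flipped by (intro sum_mono) (auto simp: \<phi>_def h_def)
  also have "\<dots> = (\<Sum>p\<in>\<phi> ` ?P. h p)" using inj by (simp add: sum.reindex)
  also have "\<dots> \<le> (\<Sum>p\<in>Sigma \<Omega> (\<lambda>\<tau>. \<tau>). h p)"
  proof (rule sum_mono2[OF _ into])
    show "finite (Sigma \<Omega> (\<lambda>\<tau>. \<tau>))" using finite_Omega fin by (intro finite_SigmaI) auto
    show "0 \<le> h b" for b using weight_pos target_weight_nonneg by (auto simp: h_def less_imp_le split: prod.split)
  qed
  also have "\<dots> = (\<Sum>\<tau>\<in>\<Omega>. \<Sum>e'\<in>\<tau>. h (\<tau>, e'))" using finite_Omega fin by (simp add: sum.Sigma)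
  also have "\<dots> \<le> (\<Sum>\<tau>\<in>\<Omega>. 1 / 16 * (weight \<tau> * (edge_weight g + 4 * (\<Sum>e\<in>crossers \<tau>. edge_weight e))))"
  proof (rule sum_mono)
    fix \<tau> assume \<tau>: "\<tau> \<in> \<Omega>"
    have "(\<Sum>e'\<in>\<tau>. target_weight \<tau> e') = (\<Sum>e'\<in>\<tau>. if e' = g then edge_weight g else 0)
        + (\<Sum>e'\<in>\<tau>. \<Sum>w\<in>crossers \<tau>. if child e' w then edge_weight w else 0)"
      by (simp add: target_weight_def sum.distrib)
    also have "(\<Sum>e'\<in>\<tau>. if e' = g then edge_weight g else 0) \<le> edge_weight g" using fin[OF \<tau>] edge_weight_pos[of g] by simp
    also have "(\<Sum>e'\<in>\<tau>. \<Sum>w\<in>crossers \<tau>. if child e' w then edge_weight w else 0) \<le> 4 * (\<Sum>e\<in>crossers \<tau>. edge_weight e)"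
      using fin[OF \<tau>] finite_crossers[OF \<tau>] edge_weight_pos by (intro sum_over_children) (auto simp: less_imp_le)
    finally have "(\<Sum>e'\<in>\<tau>. target_weight \<tau> e') \<le> edge_weight g + 4 * (\<Sum>e\<in>crossers \<tau>. edge_weight e)" by simp
    hence "weight \<tau> * (\<Sum>e'\<in>\<tau>. target_weight \<tau> e') \<le> weight \<tau> * (edge_weight g + 4 * (\<Sum>e\<in>crossers \<tau>. edge_weight e))"
      using weight_pos[of \<tau>] by (intro mult_left_mono) auto
    moreover have "(\<Sum>e'\<in>\<tau>. h (\<tau>, e')) = 1 / 16 * (weight \<tau> * (\<Sum>e'\<in>\<tau>. target_weight \<tau> e'))"
      by (simp add: h_def sum_distrib_left sum_divide_distrib)
    ultimately show "(\<Sum>e'\<in>\<tau>. h (\<tau>, e')) \<le> 1 / 16 * (weight \<tau> * (edge_weight g + 4 * (\<Sum>e\<in>crossers \<tau>. edge_weight e)))"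
      by linarith
  qed
  finally show ?thesis by (simp add: sum_distrib_left)
qed

lemma crossers_bound: "(\<Sum>\<sigma>\<in>\<Omega>. weight \<sigma> * (\<Sum>e\<in>crossers \<sigma>. edge_weight e)) \<le> 3 * edge_weight g * (\<Sum>\<sigma>\<in>\<Omega>. weight \<sigma>)"
proof -
  define F where "F \<sigma> = (\<Sum>e\<in>crossers \<sigma>. edge_weight e)" for \<sigma>
  define Z where "Z = (\<Sum>\<sigma>\<in>\<Omega>. weight \<sigma>)"
  define E where "E = (\<Sum>\<sigma>\<in>\<Omega>. weight \<sigma> * F \<sigma>)"
  have "E \<le> (\<Sum>\<sigma>\<in>\<Omega>. weight \<sigma> * ((\<Sum>e\<in>shortenable \<sigma>. edge_weight e) + edge_weight g + 1 / 4 * F \<sigma>))"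
    unfolding E_def F_def using crossers_le_shortenable weight_pos by (intro sum_mono mult_left_mono) (auto simp: less_imp_le)
  also have "\<dots> = (\<Sum>\<sigma>\<in>\<Omega>. weight \<sigma> * (\<Sum>e\<in>shortenable \<sigma>. edge_weight e)) + edge_weight g * Z + 1 / 4 * E"
    by (simp add: Z_def E_def distrib_left sum.distrib sum_distrib_left mult_ac)
  also have "(\<Sum>\<sigma>\<in>\<Omega>. weight \<sigma> * (\<Sum>e\<in>shortenable \<sigma>. edge_weight e)) \<le> 1 / 16 * (\<Sum>\<tau>\<in>\<Omega>. weight \<tau> * (edge_weight g + 4 * F \<tau>))"
    using shortenable_bound by (simp add: F_def)
  also have "(\<Sum>\<tau>\<in>\<Omega>. weight \<tau> * (edge_weight g + 4 * F \<tau>)) = edge_weight g * Z + 4 * E"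
    by (simp add: Z_def E_def distrib_left sum.distrib sum_distrib_left mult_ac)
  finally have "E \<le> 1 / 16 * (edge_weight g * Z + 4 * E) + edge_weight g * Z + 1 / 4 * E" by simp
  moreover have "edge_weight g * Z \<ge> 0" using edge_weight_pos weight_pos unfolding Z_def by (intro mult_nonneg_nonneg sum_nonneg) (auto simp: less_imp_le)
  moreover have "E \<le> 3 * y" if "E \<le> 1 / 16 * (y + 4 * E) + y + 1 / 4 * E" "y \<ge> 0" for y :: real
    using that by (simp add: field_simps)
  ultimately have "E \<le> 3 * (edge_weight g * Z)" by blast
  thus ?thesis by (simp add: E_def F_def Z_def)
qed

text \<open>If the edge with the midpoint of \<open>g\<close> is not \<open>g\<close>, it crosses \<open>g\<close> at the midpoint, so Markov's inequality can be
  applied to the total weight of the edges that cross \<open>g\<close>.\<close>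

lemma tail_bound:
  assumes "k \<ge> 1"
  shows "(\<Sum>\<sigma> | \<sigma> \<in> \<Omega> \<and> l1_length (edge_at \<sigma> (edge_midpoint g)) = l1_length g + real k. weight \<sigma>)
    \<le> 3 * (16 * lam) ^ k * (\<Sum>\<sigma>\<in>\<Omega>. weight \<sigma>)"
proof -
  let ?A = "{\<sigma> \<in> \<Omega>. l1_length (edge_at \<sigma> (edge_midpoint g)) = l1_length g + real k}"
  have x: "edge_midpoint g \<in> midpoints m n" using is_edge_midpoint_in_midpoints[OF g_edge] .
  have "edge_weight g * \<alpha> ^ k * (\<Sum>\<sigma>\<in>?A. weight \<sigma>) = (\<Sum>\<sigma>\<in>?A. weight \<sigma> * (edge_weight g * \<alpha> ^ k))"
    by (simp add: sum_distrib_left mult_ac)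
  also have "\<dots> \<le> (\<Sum>\<sigma>\<in>?A. weight \<sigma> * (\<Sum>e\<in>crossers \<sigma>. edge_weight e))"
  proof (intro sum_mono mult_left_mono)
    fix \<sigma> assume \<sigma>: "\<sigma> \<in> ?A"
    hence full: "full_triangulation m n \<sigma>" and \<Omega>: "\<sigma> \<in> \<Omega>" using Omega_triangulation by auto
    let ?f = "edge_at \<sigma> (edge_midpoint g)"
    note f = edge_at_in[OF full x]
    have len: "l1_length ?f = l1_length g + real k" using \<sigma> by simp
    hence "?f \<noteq> g" using assms by auto
    hence "cross ?f g"
      using cross_if_same_midpoint[OF triangulation_is_edge[OF full f(1)] g_edge f(2)] by blast
    hence "?f \<in> crossers \<sigma>" using f by (simp add: crossers_def)
    hence "edge_weight ?f \<le> (\<Sum>e\<in>crossers \<sigma>. edge_weight e)"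
      using finite_crossers[OF \<Omega>] edge_weight_pos by (intro member_le_sum) (auto simp: less_imp_le)
    moreover have "edge_weight ?f = edge_weight g * \<alpha> ^ k"
      using alpha_ge by (simp add: edge_weight_def len powr_add powr_realpow)
    ultimately show "edge_weight g * \<alpha> ^ k \<le> (\<Sum>e\<in>crossers \<sigma>. edge_weight e)" by simp
  qed (use weight_pos in \<open>auto simp: less_imp_le\<close>)
  also have "\<dots> \<le> (\<Sum>\<sigma>\<in>\<Omega>. weight \<sigma> * (\<Sum>e\<in>crossers \<sigma>. edge_weight e))"
    using finite_Omega weight_pos edge_weight_pos by (intro sum_mono2) (auto intro!: mult_nonneg_nonneg sum_nonneg simp: less_imp_le)
  also have "\<dots> \<le> 3 * edge_weight g * (\<Sum>\<sigma>\<in>\<Omega>. weight \<sigma>)" by (rule crossers_bound)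
  finally have "\<alpha> ^ k * (\<Sum>\<sigma>\<in>?A. weight \<sigma>) \<le> 3 * (\<Sum>\<sigma>\<in>\<Omega>. weight \<sigma>)"
    using edge_weight_pos[of g] by (simp add: mult_ac)
  hence "(16 * lam) ^ k * (\<alpha> ^ k * (\<Sum>\<sigma>\<in>?A. weight \<sigma>)) \<le> (16 * lam) ^ k * (3 * (\<Sum>\<sigma>\<in>\<Omega>. weight \<sigma>))"
    using lam by (intro mult_left_mono) auto
  moreover have "16 * lam * \<alpha> = 1" using lam by (simp add: \<alpha>_def)
  hence "(16 * lam) ^ k * \<alpha> ^ k = 1" unfolding power_mult_distrib[symmetric] by simp
  ultimately have "1 * (\<Sum>\<sigma>\<in>?A. weight \<sigma>) \<le> (16 * lam) ^ k * (3 * (\<Sum>\<sigma>\<in>\<Omega>. weight \<sigma>))"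
    by (simp only: mult.assoc[symmetric])
  thus ?thesis by (simp add: mult_ac)
qed

end

theorem corollary4p3:
  "\<exists>lam0::real. 0 < lam0 \<and> lam0 < 1 \<and>
     (\<forall>(m::nat) (n::nat) \<eta> \<Delta> (lam::real) x (k::nat) \<sigma>bar.
        m \<ge> 1 \<longrightarrow> n \<ge> 1 \<longrightarrow> constraints m n \<eta> \<Delta> \<longrightarrow> lam > 0 \<longrightarrow> x \<in> midpoints m n \<longrightarrow>
        ground_state m n \<eta> \<Delta> \<sigma>bar \<longrightarrow>
        measure (gibbs m n \<eta> \<Delta> lam)
          {\<sigma> \<in> Omega m n \<eta> \<Delta>. l1_length (edge_at \<sigma> x) = l1_length (edge_at \<sigma>bar x) + real k}
        \<le> (lam / lam0) ^ k)"
proof (intro exI[of _ "1 / 256"] conjI allI impI)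
  fix m n :: nat and \<eta> \<Delta> and lam :: real and x and k :: nat and \<gamma>
  assume c: "constraints m n \<eta> \<Delta>" and lam: "lam > 0" and x: "x \<in> midpoints m n"
    and gs: "ground_state m n \<eta> \<Delta> \<gamma>"
  let ?\<Omega> = "Omega m n \<eta> \<Delta>"
  define w where "w \<sigma> = lam powr total_length m n \<sigma>" for \<sigma>
  define Z where "Z = (\<Sum>\<sigma>\<in>?\<Omega>. w \<sigma>)"
  let ?A = "{\<sigma> \<in> ?\<Omega>. l1_length (edge_at \<sigma> x) = l1_length (edge_at \<gamma> x) + real k}"
  have \<gamma>: "\<gamma> \<in> ?\<Omega>" using gs by (simp add: ground_state_def)
  have w: "w \<sigma> > 0" for \<sigma> using lam by (simp add: w_def)
  have Z: "Z > 0" unfolding Z_def using \<gamma> finite_Omega w by (intro sum_pos) auto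
  have "measure (gibbs m n \<eta> \<Delta> lam) ?A = (\<Sum>\<sigma>\<in>?A. w \<sigma> / Z)"
    unfolding gibbs_def w_def[symmetric] Z_def[symmetric]
    using w Z finite_Omega by (subst measure_point_measure_finite_if) (auto simp: less_imp_le)
  hence eq: "measure (gibbs m n \<eta> \<Delta> lam) ?A = (\<Sum>\<sigma>\<in>?A. w \<sigma>) / Z" by (simp add: sum_divide_distrib)
  show "measure (gibbs m n \<eta> \<Delta> lam) ?A \<le> (lam / (1 / 256)) ^ k"
  proof (cases "k = 0 \<or> lam > 1 / 256")
    case True
    have "(\<Sum>\<sigma>\<in>?A. w \<sigma>) \<le> Z"
      unfolding Z_def using finite_Omega w by (intro sum_mono2) (auto simp: less_imp_le)
    hence "measure (gibbs m n \<eta> \<Delta> lam) ?A \<le> 1" using eq Z by simp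
    also have "1 \<le> (lam / (1 / 256)) ^ k"
    proof (cases "k = 0")
      case False
      with True have "1 \<le> lam / (1 / 256)" by simp
      thus ?thesis by (rule one_le_power)
    qed simp
    finally show ?thesis .
  next
    case False
    define g where "g = edge_at \<gamma> x"
    have gx: "g \<in> \<gamma>" "edge_midpoint g = x"
      using edge_at_in[OF Omega_triangulation[OF \<gamma>] x] by (simp_all add: g_def)
    have \<Delta>: "\<Delta> \<subseteq> midpoints m n" using c by (simp add: constraints_def)
    interpret ground_edge m n \<eta> \<Delta> \<gamma> g lam
      using \<Delta> gs gx(1) lam False by unfold_locales auto
    have "(\<Sum>\<sigma>\<in>?A. w \<sigma>) \<le> 3 * (16 * lam) ^ k * Z"
      using tail_bound[of k, unfolded gx(2) weight_def] False unfolding Z_def w_def g_def by simp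
    hence "measure (gibbs m n \<eta> \<Delta> lam) ?A \<le> 3 * (16 * lam) ^ k" using eq Z by (simp add: divide_le_eq)
    also have "\<dots> \<le> 16 ^ k * (16 * lam) ^ k"
    proof (rule mult_right_mono)
      have "(16::real) ^ 1 \<le> 16 ^ k" using False by (intro power_increasing) auto
      thus "3 \<le> (16::real) ^ k" by simp
    qed (use lam in simp)
    also have "\<dots> = (16 * (16 * lam)) ^ k" by (rule power_mult_distrib[symmetric])
    also have "16 * (16 * lam) = lam / (1 / 256)" by simp
    finally show ?thesis .
  qed
qed simp_all

end
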